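(* For all $q\in(0,1)$ there is $c=c(q)>0$ so that for all sufficiently large $n$, the probability of reconstructing a uniformly random $n$-bit string from $T=\lfloor c\log^{5/2}(n)/(\log\log n)^{7}\rfloor$ traces is at most $\exp(-n^{0.15})$, under trace reconstruction with deletion probability $q$. That is, for every function $g:(\{0,1\}^{\le n})^T\to\{0,1\}^n$, if $X$ is uniformly distributed on $\{0,1\}^n$ and, conditionally on $X$, $\widetilde U^1,\dots,\widetilde U^T$ are independent traces of $X$ with deletion probability $q$, then $\mathbb{P}[g(\widetilde U^1,\dots,\widetilde U^T)=X]\le \exp(-n^{0.15})$.
   Context: $\{0,1\}^{\le n}$ is the set of binary strings of length at most $n$ (including the empty string). For $x\in\{0,1\}^n$, a trace of $x$ with deletion probability $q$ is the random string obtained by deleting each bit of $x$ independently with probability $q$ and concatenating the remaining bits in order. $\log$ is the natural logarithm. *)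

theory Defs
  imports "HOL-Probability.Probability"
begin

definition bitstrings :: "nat \<Rightarrow> bool list set" where
  "bitstrings n = {x. length x = n}"

definition bitstrings_upto :: "nat \<Rightarrow> bool list set" where
  "bitstrings_upto n = {x. length x \<le> n}"

text \<open>The tuples \<open>A\<^sup>T\<close> are represented as lists of length \<open>T\<close>.\<close>

definition tuples :: "nat \<Rightarrow> 'a set \<Rightarrow> 'a list set" where
  "tuples T A = {us. length us = T \<and> set us \<subseteq> A}"

text \<open>The list \<open>ds\<close> consists of independent deletion flags: bit \<open>x ! i\<close> is deleted iff \<open>ds ! i\<close>
  is true, which has probability \<open>q\<close>.\<close>

definition trace_pmf :: "real \<Rightarrow> bool list \<Rightarrow> bool list pmf" where
  "trace_pmf q x =
     map_pmf (\<lambda>ds. map fst (filter (\<lambda>(b, d). \<not> d) (zip x ds)))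
       (replicate_pmf (length x) (bernoulli_pmf q))"

text \<open>The joint law of \<open>(X, (U\<^sub>1, \<dots>, U\<^sub>T))\<close>: \<open>replicate_pmf\<close> draws the \<open>T\<close> traces
  independently given \<open>X\<close>.\<close>

definition random_string_traces_pmf ::
    "real \<Rightarrow> nat \<Rightarrow> nat \<Rightarrow> (bool list \<times> bool list list) pmf" where
  "random_string_traces_pmf q n T =
     bind_pmf (pmf_of_set (bitstrings n)) (\<lambda>x.
       map_pmf (\<lambda>us. (x, us)) (replicate_pmf T (trace_pmf q x)))"

definition num_traces :: "real \<Rightarrow> nat \<Rightarrow> nat" where
  "num_traces c n = nat \<lfloor>c * ln (real n) powr (5/2) / ln (ln (real n)) ^ 7\<rfloor>"

lemma bitstrings_nonempty: "bitstrings n \<noteq> {}"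
  using Ex_list_of_length[of n] by (auto simp: bitstrings_def)

lemma finite_bitstrings: "finite (bitstrings n)"
  using finite_lists_length_eq[of "UNIV :: bool set" n] by (simp add: bitstrings_def)

lemma set_pmf_trace_subset: "set_pmf (trace_pmf q x) \<subseteq> bitstrings_upto (length x)"
proof -
  have "length (filter P (zip x ds)) \<le> length x" for P :: "bool \<times> bool \<Rightarrow> bool" and ds
    by (rule order_trans[OF length_filter_le]) simp
  then show ?thesis by (auto simp: trace_pmf_def bitstrings_upto_def)
qed

end

theory Submission
  imports Defs "HOL-Real_Asymp.Real_Asymp"
begin

text \<open>
  Cut the random string into blocks of length \<open>m = 6a + 2\<close> with \<open>a \<approx> ln n / 18\<close>.  Revealing which part
  of each trace stems from which block only helps the reconstruction, so the success probability is
  at most \<open>(1 - \<tau> / 2^m)^(n div m)\<close>, where \<open>\<tau>\<close> is the overlap of the laws of \<open>T\<close> traces of two fixed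
  blocks \<open>x\<close> and \<open>y\<close>.  By the Cauchy-Schwarz inequality \<open>\<tau>\<close> is at least half of the Bhattacharyya
  coefficient to the power \<open>2 T\<close>, so it remains to bound \<open>\<chi> = \<Sum>u. (P_x u - P_y u)^2 / (P_x u + P_y u)\<close>
  by \<open>O(ln^5 a / a^(3/2))\<close>.

  Take \<open>x = (01)^a 10 (10)^(2a)\<close> and \<open>y = (01)^a 01 (10)^(2a)\<close>.  Both become the same alternating string when
  one of the two adjacent ones is deleted, so \<open>P_x\<close> and \<open>P_y\<close> dominate \<open>q\<close> times the trace law of that
  string.  Reveal in addition what happens after bit \<open>L \<approx> 4 (1 - q) a\<close> of the trace.  Then, relative to
  the alternating string, \<open>P_x - P_y\<close> is an alternating sum over the flips of the trace of
  hypergeometric weights, whereas these flips are independent under the dominating law.  The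
  alternating sum is a telescoping sum plus a martingale plus second differences of the weights.
  Up to logarithms, only \<open>sqrt a\<close> steps contribute and the martingale increments are of order
  \<open>1 / a\<close>, whence the second moment \<open>a^(- 3/2)\<close>.
\<close>

section \<open>Traces of alternating strings\<close>

text \<open>The exponent 5/2 is 1 + 3/2. The overlap of two blocks is at least about
  \<open>exp (- 2 T \<chi>)\<close>, and this factor may be as small as a fixed negative power of
  \<open>n\<close>, because nearly \<open>n\<close> blocks compensate for it. So
  \<open>T \<chi>\<close> may be of order \<open>ln n\<close>; as \<open>a\<close> is of order
  \<open>ln n\<close> and \<open>\<chi>\<close> of order \<open>a^(-3/2)\<close> up to logarithms,
  \<open>T\<close> may reach the power 1 + 3/2. The obstacle is the size of \<open>\<chi>\<close>.
  The hypergeometric weights are themselves of order \<open>a^(-1/2)\<close>; it is the alternation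
  of signs that lets first differences, of order \<open>1 / a\<close>, take their place. Bit
  \<open>L\<close> is cut off because, once its source position is fixed, the trace law of an
  alternating string is explicit: a gap \<open>2 h - e\<close> has a geometric \<open>h\<close> with
  parameter \<open>1 - q^2\<close>, and \<open>e\<close> is an independent coin with probability
  \<open>1 / (1 + q)\<close>. Hence the flips are independent, the weights depend on few parameters,
  and the two densities \<open>1 - q^2\<close> and \<open>1 / (1 + q)\<close> recur
  throughout.\<close>

fun trace_prob :: "real \<Rightarrow> bool list \<Rightarrow> bool list \<Rightarrow> real" where
  "trace_prob q [] u = (if u = [] then 1 else 0)"
| "trace_prob q (c # x) [] = q * trace_prob q x []"
| "trace_prob q (c # x) (b # u) =
     q * trace_prob q x (b # u) + (if b = c then (1 - q) * trace_prob q x u else 0)"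

primrec alt :: "bool \<Rightarrow> nat \<Rightarrow> bool list" where
  "alt c 0 = []"
| "alt c (Suc n) = c # alt (\<not> c) n"

text \<open>Together with the length this is the only statistic of \<open>u\<close> on which its
  likelihood under an alternating string depends (\<open>trace_prob_alt\<close>); \<open>c\<close>
  is a virtual bit in front of \<open>u\<close>.\<close>

primrec flips :: "bool \<Rightarrow> bool list \<Rightarrow> nat" where
  "flips c [] = 0"
| "flips c (b # u) = (if b = c then 0 else 1) + flips b u"

lemma trace_pmf_Nil: "trace_pmf q [] = return_pmf []"
  by (simp add: trace_pmf_def)

lemma trace_pmf_Cons:
  "trace_pmf q (c # x) =
     bind_pmf (bernoulli_pmf q) (\<lambda>d. map_pmf (\<lambda>u. if d then u else c # u) (trace_pmf q x))"
  by (auto simp: trace_pmf_def map_bind_pmf pmf.map_comp map_pmf_def[symmetric] o_def intro!: bind_pmf_cong map_pmf_cong)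

lemma trace_pmf_append:
  "trace_pmf q (x @ y) =
     bind_pmf (trace_pmf q x) (\<lambda>u. map_pmf (\<lambda>w. u @ w) (trace_pmf q y))"
proof (induction x)
  case Nil
  have "(@) [] = (\<lambda>w::bool list. w)" by (rule ext) simp
  then show ?case by (simp add: trace_pmf_Nil bind_return_pmf map_pmf_ident)
next
  case (Cons c x)
  show ?case
    by (auto simp: trace_pmf_Cons Cons map_bind_pmf bind_map_pmf bind_assoc_pmf pmf.map_comp o_def
        intro!: bind_pmf_cong map_pmf_cong)
qed

lemma pmf_trace_pmf:
  assumes "0 \<le> q" "q \<le> 1"
  shows "pmf (trace_pmf q x) u = trace_prob q x u"
proof (induction x arbitrary: u)
  case Nil
  show ?case by (simp add: trace_pmf_Nil)
next
  case (Cons c x)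
  have inj: "inj (\<lambda>u. c # u)" by (simp add: inj_def)
  have "pmf (map_pmf (\<lambda>u. c # u) p) (b # u) = (if b = c then pmf p u else 0)" for p b u
    using pmf_map_inj'[OF inj, of p u]
    by (auto intro!: pmf_map_outside)
  moreover have "pmf (map_pmf (\<lambda>u. c # u) p) [] = 0" for p
    by (intro pmf_map_outside) auto
  ultimately show ?case
    using assms by (cases u) (simp_all add: trace_pmf_Cons pmf_bind Cons[symmetric] map_pmf_ident)
qed

lemma trace_prob_nonneg: "0 \<le> q \<Longrightarrow> q \<le> 1 \<Longrightarrow> 0 \<le> trace_prob q x u"
  by (simp flip: pmf_trace_pmf)

lemma length_alt [simp]: "length (alt c n) = n"
  by (induction n arbitrary: c) auto

lemma flips_le: "flips c u \<le> length u"
  by (induction u arbitrary: c) (auto intro: le_SucI)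

text \<open>
  The gap before each kept bit is \<open>2 h - e\<close> with \<open>h \<ge> 1\<close> and \<open>e = 1\<close> if the bit flips, \<open>e = 0\<close> otherwise.
  So the embeddings correspond to the sequences of values \<open>h\<close> with sum at most \<open>(n + flips) div 2\<close>.
\<close>

lemma trace_prob_alt:
  assumes "0 < q"
  shows "trace_prob q (alt c n) u =
    q ^ n * ((1 - q) / q) ^ length u * real ((n + flips (\<not> c) u) div 2 choose length u)"
proof (induction n arbitrary: c u)
  case 0
  show ?case
  proof (cases u)
    case (Cons b w)
    have "flips (\<not> c) u div 2 < length u"
      using flips_le[of "\<not> c" u] Cons by (simp del: flips.simps)
    then show ?thesis using Cons by (simp del: flips.simps add: binomial_eq_0)
  qed simp
next
  case (Suc n)
  show ?case
  proof (cases u)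
    case Nil
    then show ?thesis by (simp add: Suc)
  next
    case (Cons b w)
    show ?thesis
    proof (cases "b = c")
      case True
      have "(Suc n + (1 + flips c w)) div 2 = Suc ((n + flips c w) div 2)" by simp
      then have "(Suc n + flips (\<not> c) u) div 2 choose length u =
         ((n + flips c w) div 2 choose length u) + ((n + flips c w) div 2 choose length w)"
        using Cons True by simp
      then show ?thesis
        using Cons True assms by (simp add: Suc field_simps)
    next
      case False
      then have "flips (\<not> c) u = flips b w" "flips c u = Suc (flips b w)" "b = (\<not> c)"
        using Cons by auto
      then show ?thesis
        using Cons False assms by (simp add: Suc del: flips.simps)
    qed
  qed
qed

section \<open>Inserting a bit, cutting a trace, and the length of a trace\<close>

lemma sum_nth_eq_Cons:
  "(\<Sum>k | k < length (b # w) \<and> (b # w) ! k = c. f k) =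
     (if b = c then f 0 else 0) + (\<Sum>k | k < length w \<and> w ! k = c. f (Suc k))"
  for f :: "nat \<Rightarrow> 'b :: comm_monoid_add"
proof -
  let ?A = "{k. k < length (b # w) \<and> (b # w) ! k = c}"
  let ?B = "{k. k < length w \<and> w ! k = c}"
  have A: "?A = (if b = c then {0} else {}) \<union> Suc ` ?B"
  proof (rule set_eqI)
    fix k show "k \<in> ?A \<longleftrightarrow> k \<in> (if b = c then {0} else {}) \<union> Suc ` ?B"
      by (cases k) auto
  qed
  have "sum f ?A = sum f (if b = c then {0} else {}) + sum f (Suc ` ?B)"
    unfolding A by (rule sum.union_disjoint) auto
  then show ?thesis by (simp add: sum.reindex)
qed

text \<open>The bit \<open>b\<close> is either deleted or survives as bit \<open>k\<close> of
  \<open>v\<close>; in the latter case \<open>x\<close> and \<open>y\<close> produce exactly the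
  parts of \<open>v\<close> on its two sides. Two insertions that restore the same string share the
  first summand.\<close>

lemma trace_prob_insert:
  "trace_prob q (x @ b # y) v = q * trace_prob q (x @ y) v +
     (1 - q) * (\<Sum>k | k < length v \<and> v ! k = b.
        trace_prob q x (take k v) * trace_prob q y (drop (Suc k) v))"
proof (induction x arbitrary: v)
  case Nil
  show ?case
  proof (cases v)
    case (Cons c w)
    have "(\<Sum>k | k < length v \<and> v ! k = b.
        trace_prob q [] (take k v) * trace_prob q y (drop (Suc k) v)) =
       (\<Sum>k \<in> (if c = b then {0} else {}). trace_prob q y (drop (Suc k) v))"
      by (rule sum.mono_neutral_cong_right) (auto simp: Cons split: if_splits)
    then show ?thesis by (auto simp: Cons)
  qed simp
next
  case (Cons d x)
  show ?case
  proof (cases v)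
    case Nil
    then show ?thesis by (simp add: Cons)
  next
    case v: (Cons c w)
    have *: "trace_prob q (x @ b # y) v = q * trace_prob q (x @ y) v + (1 - q) *
       ((if c = b then trace_prob q x [] * trace_prob q y w else 0) +
        (\<Sum>k\<in>{k. k < length w \<and> w ! k = b}. trace_prob q x (c # take k w) * trace_prob q y (drop (Suc k) w)))"
      unfolding Cons[of v] unfolding v sum_nth_eq_Cons by auto
    define p where "p = 1 - q"
    show ?thesis
      unfolding v sum_nth_eq_Cons using * Cons[of w]
      by (cases "c = d")
         (simp_all add: v p_def[symmetric] ring_distribs sum.distrib sum_distrib_left mult_ac)
  qed
qed

text \<open>Here \<open>t\<close> is the source position of the marked bit \<open>c\<close>; what
  lies before and after it is deleted independently.\<close>

lemma trace_prob_cut: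
  "trace_prob q x (v @ c # w) =
     (\<Sum>t | t < length x \<and> x ! t = c.
        (1 - q) * (trace_prob q (take t x) v * trace_prob q (drop (Suc t) x) w))"
proof (induction x arbitrary: v)
  case (Cons d x)
  show ?case
  proof (cases v)
    case Nil
    then show ?thesis
      unfolding sum_nth_eq_Cons using Cons[of "[]"] by (auto simp: sum_distrib_left algebra_simps)
  next
    case (Cons b v')
    define p where "p = 1 - q"
    show ?thesis
      unfolding sum_nth_eq_Cons using Cons.IH[of v] Cons.IH[of v']
      by (cases "b = d") (auto simp: Cons p_def[symmetric] sum_distrib_left ring_distribs sum.distrib mult_ac)
  qed
qed simp

lemma bitstrings_Suc: "bitstrings (Suc n) = (\<lambda>(b, u). b # u) ` (UNIV \<times> bitstrings n)"
  by (auto simp: bitstrings_def length_Suc_conv image_iff)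

lemma sum_bitstrings_Suc:
  "(\<Sum>u\<in>bitstrings (Suc n). f u) =
     (\<Sum>u\<in>bitstrings n. f (True # u)) + (\<Sum>u\<in>bitstrings n. (f (False # u) :: 'a :: comm_monoid_add))"
proof -
  have "(\<Sum>u\<in>bitstrings (Suc n). f u) = (\<Sum>(b, u)\<in>UNIV \<times> bitstrings n. f (b # u))"
    unfolding bitstrings_Suc by (subst sum.reindex) (auto simp: inj_on_def case_prod_unfold o_def)
  then show ?thesis
    by (simp add: sum.cartesian_product[symmetric] UNIV_bool add.commute)
qed

lemma bitstrings_0 [simp]: "bitstrings 0 = {[]}"
  by (auto simp: bitstrings_def)

lemma sum_trace_prob_bitstrings:
  assumes "0 \<le> q" "q \<le> 1"
  shows "(\<Sum>u\<in>bitstrings k. trace_prob q x u) = pmf (binomial_pmf (length x) (1 - q)) k"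
proof (induction x arbitrary: k)
  case Nil
  show ?case
  proof (cases k)
    case (Suc n)
    have "(\<Sum>u\<in>bitstrings (Suc n). trace_prob q [] u) = 0"
      by (rule sum.neutral) (auto simp: bitstrings_def)
    then show ?thesis using Suc assms by (simp add: binomial_pmf_0)
  qed (use assms in \<open>simp add: binomial_pmf_0\<close>)
next
  case (Cons c x)
  \<comment> \<open>First-trial recursion of the binomial law, shaped like the clauses of
    \<open>trace_prob\<close>; \<open>j = 0\<close> is separate because \<open>j - 1\<close>
    truncates.\<close>
  have S: "pmf (binomial_pmf (Suc n) (1 - q)) j = q * pmf (binomial_pmf n (1 - q)) j
     + (if j = 0 then 0 else (1 - q) * pmf (binomial_pmf n (1 - q)) (j - 1))" for n j
  proof -
    have inj: "inj Suc" by simp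
    have "(+) (0::nat) = (\<lambda>k. k)" by (rule ext) simp
    then have plus: "map_pmf ((+) (0::nat)) X = X" "(+) (Suc 0) = Suc" for X
      by (simp_all only: map_pmf_ident) (rule ext, simp)
    show ?thesis
    proof (cases j)
      case 0
      have "pmf (map_pmf Suc (binomial_pmf n (1 - q))) 0 = 0"
        by (intro pmf_map_outside) auto
      then show ?thesis using assms 0
        by (simp add: binomial_pmf_Suc pmf_bind map_pmf_def[symmetric] bind_return_pmf' plus del: pmf_binomial)
    next
      case (Suc i)
      show ?thesis using assms Suc pmf_map_inj'[OF inj, of "binomial_pmf n (1 - q)" i]
        by (simp add: binomial_pmf_Suc pmf_bind map_pmf_def[symmetric] bind_return_pmf' plus del: pmf_binomial)
    qed
  qed
  show ?case
  proof (cases k)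
    case 0
    then show ?thesis using Cons[of 0] S[of "length x" 0] by simp
  next
    case (Suc n)
    have "(\<Sum>u\<in>bitstrings (Suc n). trace_prob q (c # x) u) =
       q * (\<Sum>u\<in>bitstrings (Suc n). trace_prob q x u) + (1 - q) * (\<Sum>u\<in>bitstrings n. trace_prob q x u)"
      unfolding sum_bitstrings_Suc
      by (cases c) (simp_all add: sum.distrib sum_subtractf sum_distrib_left algebra_simps)
    then show ?thesis using Suc Cons S[of "length x" "Suc n"] by (simp del: pmf_binomial)
  qed
qed

text \<open>
  The state of a path consists of the number \<open>E\<close> of flips and the number \<open>k\<close> of bits read so far, and
  of the last bit \<open>c\<close>; the last argument of \<open>I\<close> tells whether the next bit is a flip.
\<close>

primrec path_sum :: "(nat \<Rightarrow> nat \<Rightarrow> bool \<Rightarrow> real) \<Rightarrow> nat \<Rightarrow> nat \<Rightarrow> bool \<Rightarrow> bool list \<Rightarrow> real" where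
  "path_sum I E k c [] = 0"
| "path_sum I E k c (b # u) =
     I E k (b \<noteq> c) + path_sum I (E + of_bool (b \<noteq> c)) (Suc k) b u"

text \<open>The case distinction keeps the truncated subtractions \<open>k - 2\<close> and \<open>L - k\<close> from producing junk terms.\<close>

definition split_count :: "nat \<Rightarrow> nat \<Rightarrow> nat \<Rightarrow> nat \<Rightarrow> real" where
  "split_count R L s k =
     (if 2 \<le> k \<and> k \<le> L then real ((s choose (k - 2)) * (R - s choose (L - k))) else 0)"

text \<open>With a virtual \<open>True\<close> in front of the trace, an even \<open>E\<close> means
  that the current bit is \<open>True\<close>. So a flip that leaves a run of ones counts positively
  and a flip that enters one negatively.\<close>

definition flip_term :: "nat \<Rightarrow> (nat \<Rightarrow> nat \<Rightarrow> real) \<Rightarrow> nat \<Rightarrow> nat \<Rightarrow> bool \<Rightarrow> real" where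
  "flip_term a G E k \<epsilon> =
     (if \<epsilon> then (if even E then 1 else - 1) * G (a + E div 2) (Suc k) else 0)"

text \<open>If \<open>w\<close> starts with \<open>True\<close>, the larger \<open>n\<close> makes
  up for the smaller flip count. If it starts with \<open>False\<close>, the upper arguments differ
  by exactly one and Pascal's rule leaves a single term.\<close>

lemma suffix_count_diff:
  assumes "0 < n"
  shows "real ((n + flips True w) div 2 choose length w)
       - real ((n - 1 + flips False w) div 2 choose length w)
     = (if w \<noteq> [] \<and> \<not> hd w then real ((n + flips True w) div 2 - 1 choose (length w - 1)) else 0)"
proof (cases w)
  case (Cons b u)
  obtain m where n: "n = Suc m" using assms by (cases n) auto
  show ?thesis using Cons n by (cases b) auto
qed simp

text \<open>Compares, for the two strings, the embeddings in which the inserted \<open>True\<close>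
  lands at bit \<open>i\<close> of \<open>w\<close>: prefix count times suffix count as in
  \<open>trace_prob_alt\<close>, with lengths \<open>2 * a\<close> and \<open>n\<close> against
  \<open>2 * a + 1\<close> and \<open>n - 1\<close>. The state \<open>E\<close>, \<open>k\<close>,
  \<open>c\<close> records what was read before \<open>w\<close>, so that the sum unrolls along a
  path.\<close>

definition defect_term :: "nat \<Rightarrow> nat \<Rightarrow> nat \<Rightarrow> nat \<Rightarrow> bool \<Rightarrow> bool list \<Rightarrow> nat \<Rightarrow> real" where
  "defect_term a n E k c w i =
       real ((2 * a + (E + flips c (take i w))) div 2 choose (k + i))
         * real ((n + flips True (drop (Suc i) w)) div 2 choose length (drop (Suc i) w))
     - real ((2 * a + 1 + (E + flips c (take i w))) div 2 choose (k + i))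
         * real ((n - 1 + flips False (drop (Suc i) w)) div 2 choose length (drop (Suc i) w))"

lemma defect_term_Cons_Suc:
  "defect_term a n E k c (b # w) (Suc i) = defect_term a n (E + of_bool (b \<noteq> c)) (Suc k) b w i"
  by (simp add: defect_term_def add_ac)

text \<open>A one contributes through its suffix count only if a zero follows, and through its
  prefix count only if a zero precedes. So all contributions sit at the ends of runs of ones, that
  is, at flips. The right-hand side is the term of an upcoming flip that belongs to the one just
  read. \<open>R\<close> is invariant along the path.\<close>

lemma sum_defect_eq_path_sum:
  fixes a n :: nat
  assumes "0 < n" "c = even E" "L = k + length w" "R = (2 * a + n + E + flips c w) div 2 - 1"
  shows "path_sum (flip_term a (split_count R L)) E k c w
       - (\<Sum>i | i < length w \<and> w ! i = True. defect_term a n E k c w i)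
    = (if c \<and> w \<noteq> [] \<and> \<not> hd w then split_count R L (a + E div 2) (Suc k) else 0)"
  using assms(2-)
proof (induction w arbitrary: E k c)
  case (Cons b w)
  let ?M = "(n + flips True w) div 2"
  note B = suffix_count_diff[OF assms(1), of w]
  have IH: "path_sum (flip_term a (split_count R L)) E' (Suc k) b w
       - (\<Sum>i | i < length w \<and> w ! i = True. defect_term a n E' (Suc k) b w i)
    = (if b \<and> w \<noteq> [] \<and> \<not> hd w then split_count R L (a + E' div 2) (Suc (Suc k)) else 0)"
    if "E' = E + of_bool (b \<noteq> c)" for E'
    by (rule Cons.IH) (use that Cons.prems in auto)
  have goal: "path_sum (flip_term a (split_count R L)) E k c (b # w)
       - (\<Sum>i | i < length (b # w) \<and> (b # w) ! i = True. defect_term a n E k c (b # w) i)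
     = flip_term a (split_count R L) E k (b \<noteq> c) - (if b then defect_term a n E k c (b # w) 0 else 0)
       + (if b \<and> w \<noteq> [] \<and> \<not> hd w then
            split_count R L (a + (E + of_bool (b \<noteq> c)) div 2) (Suc (Suc k)) else 0)"
    unfolding sum_nth_eq_Cons defect_term_Cons_Suc IH[OF refl, symmetric] by simp
  show ?case
  proof (cases b)
    case False
    then show ?thesis
      using Cons.prems(1) unfolding goal by (cases c) (auto simp: flip_term_def)
  next
    case True
    define i where "i = (E + of_bool (\<not> c)) div 2"
    have E: "E + of_bool (\<not> c) = 2 * i" "c \<longleftrightarrow> even E"
      using Cons.prems(1) by (auto simp: i_def)
    have R: "R = a + i + ?M - 1"
      using Cons.prems E True by (cases c) (auto simp: add_ac)
    have M: "?M - 1 = R - (a + i)" if "0 < ?M" using R that by simp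
    have Mpos: "0 < ?M" if "w \<noteq> [] \<and> \<not> hd w"
      using that assms(1) by (cases w) auto
    have next_flip: "real (a + i choose k) * (real (?M choose length w)
       - real ((n - 1 + flips False w) div 2 choose length w))
       = (if w \<noteq> [] \<and> \<not> hd w then split_count R L (a + i) (Suc (Suc k)) else 0)"
      unfolding B using Cons.prems(2) Mpos M
      by (cases w) (auto simp: split_count_def)
    show ?thesis
    proof (cases c)
      case c: True
      then have E2: "E = 2 * i" using E by simp
      show ?thesis
        using next_flip True c
        unfolding goal by (simp add: E2 flip_term_def defect_term_def right_diff_distrib)
    next
      case c: False
      then have E2: "Suc E = 2 * i" and odd: "odd E" and i: "0 < i" using E by auto
      have E3: "E div 2 = i - 1" "(2 * a + E) div 2 = a + (i - 1)" "(2 * a + 1 + E) div 2 = a + i"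
        using E2 i by auto
      have "real (a + i choose k) = real (a + (i - 1) choose k) + (if k = 0 then 0 else real (a + (i - 1) choose (k - 1)))"
        using i by (cases k; cases i) auto
      moreover have "split_count R L (a + (i - 1)) (Suc k) =
          (if k = 0 then 0 else real (a + (i - 1) choose (k - 1))) * real (?M choose length w)"
      proof (cases "k = 0")
        case False
        have "R - (a + (i - 1)) = ?M" using R i by simp
        then show ?thesis using False Cons.prems(2) by (simp add: split_count_def)
      qed (simp add: split_count_def)
      ultimately have "real (a + (i - 1) choose k) * real (?M choose length w)
         = real (a + i choose k) * real (?M choose length w) - split_count R L (a + (i - 1)) (Suc k)"
        by (simp add: ring_distribs)
      moreover have "defect_term a n E k c (b # w) 0 =
         real (a + (i - 1) choose k) * real (?M choose length w) -
         real (a + i choose k) * real ((n - 1 + flips False w) div 2 choose length w)"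
        using E3 by (simp add: defect_term_def)
      moreover have "(E + of_bool (b \<noteq> c)) div 2 = i" using c True E2 by simp
      moreover have "flip_term a (split_count R L) E k (b \<noteq> c) = - split_count R L (a + (i - 1)) (Suc k)"
        using c True odd E3 by (simp add: flip_term_def)
      ultimately show ?thesis
        using next_flip True c
        unfolding goal right_diff_distrib by (simp only: if_True simp_thms) argo
    qed
  qed
qed simp

lemma alt_append: "alt c m @ alt (if even m then c else \<not> c) n = alt c (m + n)"
proof (induction m arbitrary: c)
  case (Suc m)
  show ?case using Suc[of "\<not> c"] by (auto split: if_splits)
qed simp

text \<open>When the inserted bit is deleted, both strings reduce to
  \<open>alt False (2 * a + n)\<close>, so these parts of \<open>trace_prob_insert\<close> cancel.
  What is left is the sum of defect terms over the ones of \<open>v\<close>.\<close>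

lemma trace_prob_defect_diff:
  fixes a n :: nat
  assumes "0 < q" "q < 1" "0 < n"
  defines "t \<equiv> 2 * a + 1 + n"
  shows "trace_prob q (alt False (2 * a) @ True # alt False n) v
       - trace_prob q (alt False (2 * a + 1) @ True # alt True (n - 1)) v
     = q ^ t * ((1 - q) / q) ^ length v *
       path_sum (flip_term a (split_count ((t - 1 + flips True v) div 2 - 1) (length v))) 0 0 True v"
proof -
  have base: "alt False (2 * a) @ alt False n = alt False (2 * a + n)"
    "alt False (2 * a + 1) @ alt True (n - 1) = alt False (2 * a + n)"
    using alt_append[of False "2 * a" n] alt_append[of False "2 * a + 1" "n - 1"] assms(3) by auto
  let ?K = "{k. k < length v \<and> v ! k = True}"
  let ?f = "defect_term a n 0 0 True v"
  have "trace_prob q (alt False (2 * a) @ True # alt False n) v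
       - trace_prob q (alt False (2 * a + 1) @ True # alt True (n - 1)) v
     = (1 - q) * (\<Sum>k\<in>?K.
         trace_prob q (alt False (2 * a)) (take k v) * trace_prob q (alt False n) (drop (Suc k) v) -
         trace_prob q (alt False (2 * a + 1)) (take k v) * trace_prob q (alt True (n - 1)) (drop (Suc k) v))"
    unfolding trace_prob_insert base by (simp add: sum_subtractf right_diff_distrib)
  also have "\<dots> = (1 - q) * (\<Sum>k\<in>?K. q ^ (t - 1) * ((1 - q) / q) ^ (length v - 1) * ?f k)"
  proof (intro arg_cong2[where f = "(*)"] sum.cong refl)
    fix k assume "k \<in> ?K"
    then have k: "k < length v" by simp
    have pw: "((1 - q) / q) ^ (length v - 1) = ((1 - q) / q) ^ k * ((1 - q) / q) ^ (length v - Suc k)"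
      using k by (simp flip: power_add)
    have qw: "q ^ (2 * a) * q ^ n = q ^ (t - 1)" "q ^ (2 * a + 1) * q ^ (n - 1) = q ^ (t - 1)"
      using assms(3) by (cases n; simp add: t_def power_add)+
    have len: "length (take k v) = k" using k by simp
    have 1: "trace_prob q (alt False (2 * a)) (take k v) * trace_prob q (alt False n) (drop (Suc k) v)
      = (q ^ (2 * a) * q ^ n) * ((1 - q) / q) ^ (length v - 1) *
         (real ((2 * a + (0 + flips True (take k v))) div 2 choose (0 + k))
         * real ((n + flips True (drop (Suc k) v)) div 2 choose length (drop (Suc k) v)))"
      unfolding trace_prob_alt[OF assms(1)] pw len by (simp add: mult_ac)
    have 2: "trace_prob q (alt False (2 * a + 1)) (take k v) * trace_prob q (alt True (n - 1)) (drop (Suc k) v)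
      = (q ^ (2 * a + 1) * q ^ (n - 1)) * ((1 - q) / q) ^ (length v - 1) *
         (real ((2 * a + 1 + (0 + flips True (take k v))) div 2 choose (0 + k))
         * real ((n - 1 + flips False (drop (Suc k) v)) div 2 choose length (drop (Suc k) v)))"
      unfolding trace_prob_alt[OF assms(1)] pw len by (simp add: mult_ac)
    show "trace_prob q (alt False (2 * a)) (take k v) * trace_prob q (alt False n) (drop (Suc k) v) -
         trace_prob q (alt False (2 * a + 1)) (take k v) * trace_prob q (alt True (n - 1)) (drop (Suc k) v)
       = q ^ (t - 1) * ((1 - q) / q) ^ (length v - 1) * ?f k"
      unfolding 1 2 qw defect_term_def by (simp only: right_diff_distrib)
  qed
  also have "\<dots> = (1 - q) * q ^ (t - 1) * ((1 - q) / q) ^ (length v - 1) * (\<Sum>k\<in>?K. ?f k)"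
    by (simp add: sum_distrib_left mult.assoc)
  also have "(\<Sum>k\<in>?K. ?f k) = path_sum (flip_term a (split_count ((t - 1 + flips True v) div 2 - 1) (length v))) 0 0 True v"
    (is "_ = ?P")
  proof -
    have "?P - (\<Sum>k\<in>?K. ?f k) = (if True \<and> v \<noteq> [] \<and> \<not> hd v then
         split_count ((t - 1 + flips True v) div 2 - 1) (length v) (a + 0 div 2) (Suc 0) else 0)"
      by (rule sum_defect_eq_path_sum) (use assms(3) in \<open>auto simp: t_def\<close>)
    \<comment> \<open>The boundary term has index 1, where \<open>split_count\<close>
      vanishes.\<close>
    also have "\<dots> = 0" by (simp add: split_count_def)
    finally show ?thesis by linarith
  qed
  also have "(1 - q) * q ^ (t - 1) * ((1 - q) / q) ^ (length v - 1) * ?P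
     = q ^ t * ((1 - q) / q) ^ length v * ?P"
  proof (cases v)
    case (Cons b u)
    have "q ^ t = q * q ^ (t - 1)" by (simp add: t_def)
    then show ?thesis using Cons assms by simp
  qed simp
  finally show ?thesis .
qed

section \<open>Path sums and martingales\<close>

text \<open>The law of a bit string with independent flips of probability \<open>r\<close>. A flip
  in a trace of an alternating string is an odd gap, of probability
  \<open>(1 - q) / (1 - q\<^sup>2)\<close>, whence the later choice
  \<open>r = 1 / (1 + q)\<close>.\<close>

primrec path_weight :: "real \<Rightarrow> bool \<Rightarrow> bool list \<Rightarrow> real" where
  "path_weight r c [] = 1"
| "path_weight r c (b # u) = (if b \<noteq> c then r else 1 - r) * path_weight r b u"

lemma path_weight_nonneg: "0 \<le> r \<Longrightarrow> r \<le> 1 \<Longrightarrow> 0 \<le> path_weight r c u"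
  by (induction u arbitrary: c) auto

lemma path_weight_eq:
  assumes "0 < q"
  shows "path_weight (1 / (1 + q)) c u = q ^ length u / q ^ flips c u / (1 + q) ^ length u"
proof (induction u arbitrary: c)
  case (Cons b u)
  have "1 - 1 / (1 + q) = q / (1 + q)" using assms by (simp add: field_simps)
  then show ?case using assms by (simp add: Cons)
qed simp

lemma sum_path_weight: "(\<Sum>u\<in>bitstrings n. path_weight r c u) = 1"
proof (induction n arbitrary: c)
  case (Suc n)
  show ?case
    by (cases c) (simp_all add: sum_bitstrings_Suc sum_distrib_left[symmetric] Suc)
qed simp

lemma path_sum_add:
  "path_sum (\<lambda>E k \<epsilon>. I E k \<epsilon> + J E k \<epsilon>) E k c u = path_sum I E k c u + path_sum J E k c u"
  by (induction u arbitrary: E k c) auto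

lemma path_sum_const: "path_sum (\<lambda>E k \<epsilon>. x) E k c u = x * real (length u)"
  by (induction u arbitrary: E k c) (auto simp: algebra_simps)

lemma path_sum_cmult: "path_sum (\<lambda>E k \<epsilon>. x * I E k \<epsilon>) E k c u = x * path_sum I E k c u"
  by (induction u arbitrary: E k c) (auto simp: algebra_simps)

lemma path_sum_mono:
  assumes "\<And>E k \<epsilon>. E \<le> k \<Longrightarrow> k < L \<Longrightarrow> I E k \<epsilon> \<le> J E k \<epsilon>" "E \<le> k" "k + length u \<le> L"
  shows "path_sum I E k c u \<le> path_sum J E k c u"
  using assms(2,3)
proof (induction u arbitrary: E k c)
  case (Cons b u)
  have "path_sum I (E + of_bool (b \<noteq> c)) (Suc k) b u \<le> path_sum J (E + of_bool (b \<noteq> c)) (Suc k) b u"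
    using Cons.prems by (intro Cons.IH) auto
  moreover have "I E k (b \<noteq> c) \<le> J E k (b \<noteq> c)"
    using Cons.prems by (intro assms(1)) auto
  ultimately show ?case unfolding path_sum.simps by (rule add_mono[rotated])
qed simp

lemma path_sum_abs: "\<bar>path_sum I E k c u\<bar> \<le> path_sum (\<lambda>E k \<epsilon>. \<bar>I E k \<epsilon>\<bar>) E k c u"
proof (induction u arbitrary: E k c)
  case (Cons b u)
  show ?case using Cons[of "E + of_bool (b \<noteq> c)" "Suc k" b] by simp
qed simp

lemma path_sum_telescope:
  "path_sum (\<lambda>E k \<epsilon>. V (E + of_bool \<epsilon>) (Suc k) - V E k) E k c u
     = V (E + flips c u) (k + length u) - V E k"
  by (induction u arbitrary: E k c) (auto simp: add_ac)

text \<open>\<open>E0\<close>, \<open>k0\<close> is the state at a first visit to the window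
  \<open>W\<close>. All later visits have \<open>k \<le> k0 + N\<close>, and the truncated
  difference counts the steps still admissible.\<close>

lemma path_sum_window_aux:
  assumes "\<And>E k. W E k \<Longrightarrow> E0 \<le> E \<Longrightarrow> E - E0 \<le> k - k0 \<Longrightarrow> k0 \<le> k \<Longrightarrow> k \<le> k0 + N"
  assumes "E0 \<le> E" "E - E0 \<le> k - k0" "k0 \<le> k"
  shows "path_sum (\<lambda>E k \<epsilon>. of_bool (W E k)) E k c u \<le> real (k0 + N + 1 - k)"
  using assms(2-)
proof (induction u arbitrary: E k c)
  case (Cons b u)
  have "path_sum (\<lambda>E k \<epsilon>. of_bool (W E k)) (E + of_bool (b \<noteq> c)) (Suc k) b u \<le> real (k0 + N + 1 - Suc k)"
    by (rule Cons.IH) (use Cons.prems in auto)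
  then show ?case
    using assms(1)[of E k] Cons.prems by (cases "W E k") (auto simp: of_nat_diff)
qed simp

text \<open>Follow the path up to its first visit to \<open>W\<close> and apply
  \<open>path_sum_window_aux\<close> from there.\<close>

lemma path_sum_window:
  assumes "\<And>E0 k0 E k. W E0 k0 \<Longrightarrow> W E k \<Longrightarrow> E0 \<le> E \<Longrightarrow> E - E0 \<le> k - k0 \<Longrightarrow> k0 \<le> k \<Longrightarrow> k \<le> k0 + N"
  shows "path_sum (\<lambda>E k \<epsilon>. of_bool (W E k)) E k c u \<le> real (N + 1)"
proof (induction u arbitrary: E k c)
  case (Cons b u)
  show ?case
  proof (cases "W E k")
    case True
    have "path_sum (\<lambda>E k \<epsilon>. of_bool (W E k)) E k c (b # u) \<le> real (k + N + 1 - k)"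
      by (rule path_sum_window_aux) (use assms[OF True] in auto)
    then show ?thesis by simp
  next
    case False
    then show ?thesis using Cons[of "E + of_bool (b \<noteq> c)" "Suc k" b] by simp
  qed
qed simp

lemma sum_path_weight_Cons:
  "(\<Sum>u\<in>bitstrings (Suc n). path_weight r c u * F u) =
     r * (\<Sum>u\<in>bitstrings n. path_weight r (\<not> c) u * F ((\<not> c) # u))
   + (1 - r) * (\<Sum>u\<in>bitstrings n. path_weight r c u * F (c # u))"
  by (cases c) (simp_all add: sum_bitstrings_Suc sum_distrib_left mult_ac)

lemma martingale_mean_zero:
  assumes "\<And>E k. r * \<psi> E k True + (1 - r) * \<psi> E k False = 0"
  shows "(\<Sum>u\<in>bitstrings n. path_weight r c u * path_sum \<psi> E k c u) = 0"
proof (induction n arbitrary: E k c)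
  case (Suc n)
  have "(\<Sum>u\<in>bitstrings n. path_weight r b u * (x + path_sum \<psi> E' k' b u)) = x" for x E' k' b
  proof -
    have "(\<Sum>u\<in>bitstrings n. path_weight r b u * (x + path_sum \<psi> E' k' b u))
      = x * (\<Sum>u\<in>bitstrings n. path_weight r b u)
        + (\<Sum>u\<in>bitstrings n. path_weight r b u * path_sum \<psi> E' k' b u)"
      by (simp add: distrib_left sum.distrib sum_distrib_left mult.commute)
    then show ?thesis by (simp add: Suc sum_path_weight)
  qed
  note * = this
  have "(\<Sum>u\<in>bitstrings (Suc n). path_weight r c u * path_sum \<psi> E k c u)
     = r * \<psi> E k ((\<not> c) \<noteq> c) + (1 - r) * \<psi> E k (c \<noteq> c)"
    unfolding sum_path_weight_Cons path_sum.simps * ..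
  then show ?case using assms[of E k] by simp
qed simp

text \<open>Martingale increments are orthogonal: when the first increment \<open>x\<close> is split
  off, the cross term vanishes by \<open>martingale_mean_zero\<close>.\<close>

lemma martingale_second_moment:
  assumes "\<And>E k. r * \<psi> E k True + (1 - r) * \<psi> E k False = 0"
  shows "(\<Sum>u\<in>bitstrings n. path_weight r c u * (path_sum \<psi> E k c u)\<^sup>2)
       = (\<Sum>u\<in>bitstrings n. path_weight r c u * path_sum (\<lambda>E k \<epsilon>. (\<psi> E k \<epsilon>)\<^sup>2) E k c u)"
proof (induction n arbitrary: E k c)
  case (Suc n)
  have sq: "(\<Sum>u\<in>bitstrings n. path_weight r b u * (x + path_sum \<psi> E' k' b u)\<^sup>2)
     = (\<Sum>u\<in>bitstrings n. path_weight r b u * (x\<^sup>2 + path_sum (\<lambda>E k \<epsilon>. (\<psi> E k \<epsilon>)\<^sup>2) E' k' b u))" for x E' k' b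
  proof -
    let ?w = "path_weight r b" and ?S = "path_sum \<psi> E' k' b"
    have "(\<Sum>u\<in>bitstrings n. ?w u * (x + ?S u)\<^sup>2) =
      (\<Sum>u\<in>bitstrings n. x\<^sup>2 * ?w u + 2 * x * (?w u * ?S u) + ?w u * (?S u)\<^sup>2)"
      by (intro sum.cong refl) (simp add: power2_eq_square algebra_simps)
    also have "\<dots> = x\<^sup>2 * (\<Sum>u\<in>bitstrings n. ?w u) + 2 * x * (\<Sum>u\<in>bitstrings n. ?w u * ?S u)
        + (\<Sum>u\<in>bitstrings n. ?w u * (?S u)\<^sup>2)"
      by (simp only: sum.distrib sum_distrib_left)
    also have "(\<Sum>u\<in>bitstrings n. ?w u * ?S u) = 0"
      by (rule martingale_mean_zero[OF assms])
    also have "x\<^sup>2 * (\<Sum>u\<in>bitstrings n. ?w u) + 2 * x * 0 + (\<Sum>u\<in>bitstrings n. ?w u * (?S u)\<^sup>2)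
       = (\<Sum>u\<in>bitstrings n. ?w u * (x\<^sup>2 + path_sum (\<lambda>E k \<epsilon>. (\<psi> E k \<epsilon>)\<^sup>2) E' k' b u))"
      unfolding Suc by (simp only: distrib_left sum.distrib sum_distrib_left mult.commute mult_zero_right add_0_right)
    finally show ?thesis .
  qed
  show ?case unfolding sum_path_weight_Cons path_sum.simps sq ..
qed simp

text \<open>Doob decomposition. Subtracting the conditional mean \<open>m\<close> leaves martingale
  increments \<open>\<psi>\<close> of size at most \<open>2 * B\<close>; the predictable part is
  bounded on every path by \<open>\<kappa>\<close>. The remaining factor 2 is that of
  \<open>(x + y)\<^sup>2 \<le> 2 * x\<^sup>2 + 2 * y\<^sup>2\<close>.\<close>

lemma path_sum_second_moment_bound:
  fixes I :: "nat \<Rightarrow> nat \<Rightarrow> bool \<Rightarrow> real"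
  assumes r: "0 \<le> r" "r \<le> 1"
    and B: "\<And>E k \<epsilon>. E \<le> k \<Longrightarrow> k < L \<Longrightarrow> \<bar>I E k \<epsilon>\<bar> \<le> B E k"
    and M: "\<And>E k. E \<le> k \<Longrightarrow> k < L \<Longrightarrow> \<bar>r * I E k True + (1 - r) * I E k False\<bar> \<le> M E k"
    and \<beta>: "\<And>u. length u = L \<Longrightarrow> path_sum (\<lambda>E k \<epsilon>. (B E k)\<^sup>2) 0 0 True u \<le> \<beta>"
    and \<kappa>: "\<And>u. length u = L \<Longrightarrow> path_sum (\<lambda>E k \<epsilon>. M E k) 0 0 True u \<le> \<kappa>"
  shows "(\<Sum>u\<in>bitstrings L. path_weight r True u * (path_sum I 0 0 True u)\<^sup>2) \<le> 8 * \<beta> + 2 * \<kappa>\<^sup>2"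
proof -
  let ?E = "\<lambda>F. \<Sum>u\<in>bitstrings L. path_weight r True u * F u"
  define m where "m = (\<lambda>E k. r * I E k True + (1 - r) * I E k False)"
  define \<psi> where "\<psi> = (\<lambda>E k \<epsilon>. I E k \<epsilon> - m E k)"
  have zero: "r * \<psi> E k True + (1 - r) * \<psi> E k False = 0" for E k
    by (simp add: \<psi>_def m_def algebra_simps)
  have \<psi>: "(\<psi> E k \<epsilon>)\<^sup>2 \<le> 4 * (B E k)\<^sup>2" if "E \<le> k" "k < L" for E k \<epsilon>
  proof -
    have "\<bar>m E k\<bar> \<le> r * \<bar>I E k True\<bar> + (1 - r) * \<bar>I E k False\<bar>"
      unfolding m_def using r abs_triangle_ineq[of "r * I E k True" "(1 - r) * I E k False"]
      by (simp add: abs_mult)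
    also have "\<dots> \<le> r * B E k + (1 - r) * B E k"
      using r B[OF that] by (intro add_mono mult_left_mono) auto
    finally have "\<bar>\<psi> E k \<epsilon>\<bar> \<le> 2 * B E k"
      using B[OF that, of \<epsilon>] unfolding \<psi>_def by (simp add: algebra_simps)
    then have "\<bar>\<psi> E k \<epsilon>\<bar>\<^sup>2 \<le> (2 * B E k)\<^sup>2" by (intro power_mono) auto
    then show ?thesis by (simp add: power2_eq_square)
  qed
  have w: "0 \<le> path_weight r True u" for u by (rule path_weight_nonneg[OF r])
  have "(path_sum I 0 0 True u)\<^sup>2 \<le> 2 * (path_sum \<psi> 0 0 True u)\<^sup>2 + 2 * \<kappa>\<^sup>2" if "length u = L" for u
  proof -
    let ?m = "path_sum (\<lambda>E k \<epsilon>. m E k) 0 0 True u"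
    have "I = (\<lambda>E k \<epsilon>. \<psi> E k \<epsilon> + m E k)" by (simp add: \<psi>_def)
    then have I: "path_sum I 0 0 True u = path_sum \<psi> 0 0 True u + ?m"
      by (simp only: path_sum_add)
    have "\<bar>?m\<bar> \<le> path_sum (\<lambda>E k \<epsilon>. \<bar>m E k\<bar>) 0 0 True u"
      by (rule path_sum_abs)
    also have "\<dots> \<le> path_sum (\<lambda>E k \<epsilon>. M E k) 0 0 True u"
      by (rule path_sum_mono[where L = L]) (use M that in \<open>auto simp: m_def\<close>)
    finally have "\<bar>?m\<bar> \<le> \<kappa>" using \<kappa>[OF that] by linarith
    then have m: "?m\<^sup>2 \<le> \<kappa>\<^sup>2" by (rule power2_le_iff_abs_le[THEN iffD2, rotated]) (use \<open>\<bar>?m\<bar> \<le> \<kappa>\<close> in linarith)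
    have "2 * (path_sum \<psi> 0 0 True u * ?m) \<le> (path_sum \<psi> 0 0 True u)\<^sup>2 + ?m\<^sup>2"
      using sum_squares_bound[of "path_sum \<psi> 0 0 True u" ?m] by (simp add: mult.assoc)
    then show ?thesis unfolding I power2_sum using m by (simp add: mult.assoc)
  qed
  then have "?E (\<lambda>u. (path_sum I 0 0 True u)\<^sup>2)
    \<le> ?E (\<lambda>u. (2 * (path_sum \<psi> 0 0 True u)\<^sup>2 + 2 * \<kappa>\<^sup>2))"
    by (intro sum_mono mult_left_mono w) (auto simp: bitstrings_def)
  also have "\<dots> = 2 * ?E (\<lambda>u. (path_sum \<psi> 0 0 True u)\<^sup>2) + 2 * \<kappa>\<^sup>2 * (\<Sum>u\<in>bitstrings L. path_weight r True u)"
    by (simp add: distrib_left sum.distrib sum_distrib_left mult_ac)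
  also have "\<dots> = 2 * ?E (\<lambda>u. path_sum (\<lambda>E k \<epsilon>. (\<psi> E k \<epsilon>)\<^sup>2) 0 0 True u) + 2 * \<kappa>\<^sup>2"
    by (simp add: sum_path_weight martingale_second_moment[OF zero])
  also have "?E (\<lambda>u. path_sum (\<lambda>E k \<epsilon>. (\<psi> E k \<epsilon>)\<^sup>2) 0 0 True u)
     \<le> ?E (\<lambda>u. (4 * \<beta>))"
  proof (intro sum_mono mult_left_mono w)
    fix u assume "u \<in> bitstrings L"
    then have u: "length u = L" by (simp add: bitstrings_def)
    have "path_sum (\<lambda>E k \<epsilon>. (\<psi> E k \<epsilon>)\<^sup>2) 0 0 True u \<le> path_sum (\<lambda>E k \<epsilon>. 4 * (B E k)\<^sup>2) 0 0 True u"
      by (rule path_sum_mono[where L = L]) (use \<psi> u in auto)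
    then show "path_sum (\<lambda>E k \<epsilon>. (\<psi> E k \<epsilon>)\<^sup>2) 0 0 True u \<le> 4 * \<beta>"
      using \<beta>[OF u] by (simp add: path_sum_cmult)
  qed
  also have "\<dots> = 4 * \<beta>" using sum_path_weight[where n = L and r = r and c = True] by (simp only: sum_distrib_right[symmetric])
  finally show ?thesis by simp
qed

section \<open>The chi-square distance between trace laws\<close>

text \<open>The summand of the triangular discrimination, a symmetric chi-square distance. It is
  homogeneous of degree one and jointly convex, hence subadditive; at \<open>x = y = 0\<close>
  division by zero yields the right value 0.\<close>

definition chi :: "real \<Rightarrow> real \<Rightarrow> real" where "chi x y = (x - y)\<^sup>2 / (x + y)"

lemma chi_nonneg: "0 \<le> x \<Longrightarrow> 0 \<le> y \<Longrightarrow> 0 \<le> chi x y"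
  by (simp add: chi_def)

lemma chi_0 [simp]: "chi 0 0 = 0"
  by (simp add: chi_def)

lemma chi_mult: "chi (z * x) (z * y) = z * chi x y"
  by (simp add: chi_def power2_eq_square flip: right_diff_distrib distrib_left)

lemma chi_le_abs_diff:
  assumes "0 \<le> x" "0 \<le> y"
  shows "chi x y \<le> \<bar>x - y\<bar>"
proof (cases "x + y = 0")
  case False
  have "\<bar>x - y\<bar> * \<bar>x - y\<bar> \<le> \<bar>x - y\<bar> * (x + y)" using assms by (intro mult_left_mono) auto
  then show ?thesis using assms False by (simp add: chi_def power2_eq_square divide_le_eq)
qed (simp add: chi_def)

lemma chi_le_add: "0 \<le> x \<Longrightarrow> 0 \<le> y \<Longrightarrow> chi x y \<le> x + y"
  using chi_le_abs_diff[of x y] by linarith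

lemma chi_add_le:
  assumes "0 \<le> x" "0 \<le> y" "0 \<le> x'" "0 \<le> y'"
  shows "chi (x + x') (y + y') \<le> chi x y + chi x' y'"
proof -
  have "(d + d')\<^sup>2 / (s + s') \<le> d\<^sup>2 / s + d'\<^sup>2 / s'" if "0 < s" "0 < s'" for d d' s s' :: real
  proof -
    have "(d + d')\<^sup>2 * (s * s') \<le> (d\<^sup>2 * s' + d'\<^sup>2 * s) * (s + s')"
    proof -
      \<comment> \<open>This square is exactly the difference of the two sides.\<close>
      have "0 \<le> (d * s' - d' * s)\<^sup>2" by simp
      then show ?thesis by (simp add: power2_eq_square algebra_simps)
    qed
    moreover have "d\<^sup>2 / s + d'\<^sup>2 / s' = (d\<^sup>2 * s' + d'\<^sup>2 * s) / (s * s')"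
      using that by (simp add: field_simps)
    ultimately show ?thesis
      using that by (simp add: pos_divide_le_eq pos_le_divide_eq mult_ac)
  qed
  from this[of "x + y" "x' + y'" "x - y" "x' - y'"] assms show ?thesis
    by (cases "x + y = 0"; cases "x' + y' = 0")
       (auto simp: chi_def add_nonneg_eq_0_iff algebra_simps)
qed

lemma chi_sum_le:
  assumes "finite A" "\<And>i. i \<in> A \<Longrightarrow> 0 \<le> f i" "\<And>i. i \<in> A \<Longrightarrow> 0 \<le> g i"
  shows "chi (sum f A) (sum g A) \<le> (\<Sum>i\<in>A. chi (f i) (g i))"
  using assms
proof (induction A rule: finite_induct)
  case (insert i A)
  have "chi (f i + sum f A) (g i + sum g A) \<le> chi (f i) (g i) + chi (sum f A) (sum g A)"
    using insert.prems by (intro chi_add_le sum_nonneg) auto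
  then show ?case using insert by simp
qed simp

lemma finite_bitstrings_upto: "finite (bitstrings_upto n)"
  using finite_lists_length_le[of "UNIV :: bool set" n] by (simp add: bitstrings_upto_def)

lemma sum_trace_prob_le_1:
  assumes "0 \<le> q" "q \<le> 1" "finite A"
  shows "(\<Sum>u\<in>A. trace_prob q x u) \<le> 1"
proof -
  have "(\<Sum>u\<in>A. trace_prob q x u) = measure_pmf.prob (trace_pmf q x) A"
    using assms by (simp add: measure_measure_pmf_finite pmf_trace_pmf)
  then show ?thesis by simp
qed

definition trace_chi :: "real \<Rightarrow> bool list \<Rightarrow> bool list \<Rightarrow> real" where
  "trace_chi q x y = (\<Sum>u\<in>bitstrings_upto (length x). chi (trace_prob q x u) (trace_prob q y u))"

text \<open>
  For the traces with more than \<open>L\<close> bits, condition on the position \<open>t\<close> of the bit number \<open>L\<close> (counted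
  from \<open>0\<close>) of the trace and use the joint convexity of \<open>chi\<close>.
\<close>

lemma trace_chi_le:
  assumes q: "0 \<le> q" "q \<le> 1" and len: "length y = length x"
    and same: "\<And>t. s0 \<le> t \<Longrightarrow> t < length x \<Longrightarrow> x ! t = y ! t \<and> drop (Suc t) x = drop (Suc t) y"
    and s0: "s0 \<le> length x"
  shows "trace_chi q x y \<le>
     (\<Sum>l\<le>L. \<Sum>u\<in>bitstrings l. trace_prob q x u + trace_prob q y u)
   + (\<Sum>t<s0. \<Sum>v\<in>bitstrings L. trace_prob q (take t x) v + trace_prob q (take t y) v)
   + (\<Sum>t\<in>{s0..<length x}. \<Sum>v\<in>bitstrings L. chi (trace_prob q (take t x) v) (trace_prob q (take t y) v))"
proof -
  define m where "m = length x"
  define \<phi> where "\<phi> = (\<lambda>u. chi (trace_prob q x u) (trace_prob q y u))"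
  note nn = trace_prob_nonneg[OF q]
  have \<phi>0: "0 \<le> \<phi> u" for u unfolding \<phi>_def by (intro chi_nonneg nn)
  let ?short = "{u \<in> bitstrings_upto m. length u \<le> L}" and ?long = "{u \<in> bitstrings_upto m. L < length u}"
  have "trace_chi q x y = sum \<phi> (?short \<union> ?long)"
    unfolding trace_chi_def \<phi>_def m_def by (rule sum.cong) auto
  also have "\<dots> = sum \<phi> ?short + sum \<phi> ?long"
    by (rule sum.union_disjoint) (auto simp: finite_bitstrings_upto)
  finally have split: "trace_chi q x y = sum \<phi> ?short + sum \<phi> ?long" .
  have short: "sum \<phi> ?short \<le> (\<Sum>l\<le>L. \<Sum>u\<in>bitstrings l. trace_prob q x u + trace_prob q y u)"
  proof -
    have "sum \<phi> ?short \<le> sum \<phi> (\<Union>l\<in>{..L}. bitstrings l)"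
      by (intro sum_mono2) (simp_all add: \<phi>0 finite_bitstrings, auto simp: bitstrings_def)
    also have "\<dots> = (\<Sum>l\<le>L. sum \<phi> (bitstrings l))"
      by (rule sum.UNION_disjoint) (simp_all add: finite_bitstrings, auto simp: bitstrings_def)
    also have "\<dots> \<le> (\<Sum>l\<le>L. \<Sum>u\<in>bitstrings l. trace_prob q x u + trace_prob q y u)"
      unfolding \<phi>_def by (intro sum_mono chi_le_add nn)
    finally show ?thesis .
  qed
  define P where "P = (\<lambda>z t v c w. (if z ! t = c then 1 else 0) * (1 - q) *
      (trace_prob q (take t z) v * trace_prob q (drop (Suc t) z) w))"
  have P0: "0 \<le> P z t v c w" for z t v c w
    unfolding P_def using q nn by (intro mult_nonneg_nonneg) auto
  have cut: "trace_prob q z (v @ c # w) = (\<Sum>t<m. P z t v c w)" if "length z = m" for z v c w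
  proof -
    have "trace_prob q z (v @ c # w) = (\<Sum>t | t < m \<and> z ! t = c.
        (1 - q) * (trace_prob q (take t z) v * trace_prob q (drop (Suc t) z) w))"
      unfolding trace_prob_cut that ..
    also have "\<dots> = (\<Sum>t<m. P z t v c w)"
      by (rule sum.mono_neutral_cong_left) (auto simp: P_def)
    finally show ?thesis .
  qed
  \<comment> \<open>For a cut before \<open>s0\<close> the strings may still differ behind it, and
    the total mass serves as the bound.\<close>
  define Q where "Q = (\<lambda>t v. if t < s0 then trace_prob q (take t x) v + trace_prob q (take t y) v
      else chi (trace_prob q (take t x) v) (trace_prob q (take t y) v))"
  let ?W = "bitstrings_upto m"
  have one: "(\<Sum>c\<in>UNIV. \<Sum>w\<in>?W. P z t v c w) \<le> trace_prob q (take t z) v" for z t v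
  proof -
    have "(\<Sum>c\<in>UNIV. \<Sum>w\<in>?W. P z t v c w) =
       (1 - q) * (trace_prob q (take t z) v * (\<Sum>w\<in>?W. trace_prob q (drop (Suc t) z) w))"
      unfolding P_def UNIV_bool by (cases "z ! t") (simp_all add: sum_distrib_left)
    also have "\<dots> \<le> 1 * (trace_prob q (take t z) v * 1)"
      using q nn sum_trace_prob_le_1[OF q finite_bitstrings_upto] 
      by (intro mult_mono mult_nonneg_nonneg sum_nonneg) auto
    finally show ?thesis by simp
  qed
  have bound: "(\<Sum>c\<in>UNIV. \<Sum>w\<in>?W. chi (P x t v c w) (P y t v c w)) \<le> Q t v" if "t < m" for t v
  proof (cases "t < s0")
    case True
    have "(\<Sum>c\<in>UNIV. \<Sum>w\<in>?W. chi (P x t v c w) (P y t v c w))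
      \<le> (\<Sum>c\<in>UNIV. \<Sum>w\<in>?W. P x t v c w + P y t v c w)"
      by (intro sum_mono chi_le_add P0)
    also have "\<dots> = (\<Sum>c\<in>UNIV. \<Sum>w\<in>?W. P x t v c w) + (\<Sum>c\<in>UNIV. \<Sum>w\<in>?W. P y t v c w)"
      by (simp only: sum.distrib)
    also have "\<dots> \<le> Q t v" using True one[of x t v] one[of y t v] by (simp add: Q_def)
    finally show ?thesis .
  next
    case False
    then have s: "x ! t = y ! t" "drop (Suc t) x = drop (Suc t) y"
      using same[of t] that by (auto simp: m_def)
    \<comment> \<open>The bit at the cut and everything behind it are common to both strings; their
      weight \<open>z\<close> factors out of \<open>chi\<close> and has total mass at most
      1.\<close>
    define z where "z = (\<lambda>c w. (if x ! t = c then 1 else 0) * (1 - q) * trace_prob q (drop (Suc t) x) w)"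
    let ?\<phi> = "chi (trace_prob q (take t x) v) (trace_prob q (take t y) v)"
    have z: "P x t v c w = z c w * trace_prob q (take t x) v" "P y t v c w = z c w * trace_prob q (take t y) v" for c w
      by (simp_all add: P_def z_def s)
    have "(\<Sum>c\<in>UNIV. \<Sum>w\<in>?W. z c w) = (1 - q) * (\<Sum>w\<in>?W. trace_prob q (drop (Suc t) x) w)"
      unfolding z_def UNIV_bool by (cases "x ! t") (simp_all add: sum_distrib_left)
    also have "\<dots> \<le> 1 * 1"
      using q nn sum_trace_prob_le_1[OF q finite_bitstrings_upto]
      by (intro mult_mono sum_nonneg) auto
    finally have "(\<Sum>c\<in>UNIV. \<Sum>w\<in>?W. z c w) * ?\<phi> \<le> 1 * ?\<phi>"
      by (intro mult_right_mono chi_nonneg nn) auto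
    then show ?thesis unfolding z chi_mult using False by (simp add: Q_def sum_distrib_right)
  qed
  have long: "sum \<phi> ?long \<le> (\<Sum>v\<in>bitstrings L. \<Sum>t<m. Q t v)"
  proof -
    let ?f = "\<lambda>(v, c, w). v @ c # (w :: bool list)"
    let ?A = "bitstrings L \<times> UNIV \<times> ?W"
    have "?long \<subseteq> ?f ` ?A"
    proof
      fix u assume u: "u \<in> ?long"
      then have "u = ?f (take L u, u ! L, drop (Suc L) u)" by (simp add: id_take_nth_drop)
      moreover have "(take L u, u ! L, drop (Suc L) u) \<in> ?A"
        using u by (auto simp: bitstrings_def bitstrings_upto_def)
      ultimately show "u \<in> ?f ` ?A" by (rule image_eqI)
    qed
    then have "sum \<phi> ?long \<le> sum \<phi> (?f ` ?A)"
      by (intro sum_mono2) (auto simp: \<phi>0 finite_bitstrings finite_bitstrings_upto)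
    also have "\<dots> = (\<Sum>a\<in>?A. \<phi> (?f a))"
      by (subst sum.reindex) (auto simp: inj_on_def bitstrings_def)
    also have "\<dots> = (\<Sum>v\<in>bitstrings L. \<Sum>c\<in>UNIV. \<Sum>w\<in>?W. \<phi> (v @ c # w))"
      by (simp add: sum.cartesian_product split_def)
    also have "\<dots> \<le> (\<Sum>v\<in>bitstrings L. \<Sum>c\<in>UNIV. \<Sum>w\<in>?W. \<Sum>t<m. chi (P x t v c w) (P y t v c w))"
      unfolding \<phi>_def using len
      by (intro sum_mono) (simp add: cut m_def[symmetric] chi_sum_le P0)
    also have "\<dots> = (\<Sum>v\<in>bitstrings L. \<Sum>t<m. \<Sum>c\<in>UNIV. \<Sum>w\<in>?W. chi (P x t v c w) (P y t v c w))"
      by (intro sum.cong refl) (subst sum.swap[of _ "{..<m}"], subst sum.swap[of _ "{..<m}"], rule refl)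
    also have "\<dots> \<le> (\<Sum>v\<in>bitstrings L. \<Sum>t<m. Q t v)"
      by (intro sum_mono bound) auto
    finally show ?thesis .
  qed
  have "(\<Sum>v\<in>bitstrings L. \<Sum>t<m. Q t v) = (\<Sum>t<m. \<Sum>v\<in>bitstrings L. Q t v)"
    by (rule sum.swap)
  also have "\<dots> = (\<Sum>t\<in>{..<s0} \<union> {s0..<m}. \<Sum>v\<in>bitstrings L. Q t v)"
    using s0 by (intro sum.cong) (auto simp: m_def)
  also have "\<dots> = (\<Sum>t<s0. \<Sum>v\<in>bitstrings L. Q t v) + (\<Sum>t\<in>{s0..<m}. \<Sum>v\<in>bitstrings L. Q t v)"
    by (rule sum.union_disjoint) auto
  also have "(\<Sum>t<s0. \<Sum>v\<in>bitstrings L. Q t v)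
     = (\<Sum>t<s0. \<Sum>v\<in>bitstrings L. trace_prob q (take t x) v + trace_prob q (take t y) v)"
    by (simp add: Q_def)
  also have "(\<Sum>t\<in>{s0..<m}. \<Sum>v\<in>bitstrings L. Q t v)
     = (\<Sum>t\<in>{s0..<m}. \<Sum>v\<in>bitstrings L. chi (trace_prob q (take t x) v) (trace_prob q (take t y) v))"
    by (simp add: Q_def)
  finally show ?thesis using split short long unfolding m_def by linarith
qed

section \<open>Hypergeometric weights\<close>

text \<open>The hypergeometric law: \<open>K\<close> of \<open>R\<close> items are drawn, and
  \<open>j\<close> of them are among \<open>s\<close> marked ones.\<close>

definition hyp :: "nat \<Rightarrow> nat \<Rightarrow> nat \<Rightarrow> nat \<Rightarrow> real" where
  "hyp R K s j = real ((s choose j) * (R - s choose (K - j))) / real (R choose K)"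

lemma hyp_nonneg: "0 \<le> hyp R K s j"
  by (simp add: hyp_def)

lemma sum_hyp:
  assumes "s \<le> R" "K \<le> R"
  shows "(\<Sum>j\<le>K. hyp R K s j) = 1"
proof -
  have "(\<Sum>j\<le>K. hyp R K s j) = real (\<Sum>j\<le>K. (s choose j) * (R - s choose (K - j))) / real (R choose K)"
    unfolding hyp_def by (simp add: sum_divide_distrib)
  also have "(\<Sum>j\<le>K. (s choose j) * (R - s choose (K - j))) = R choose K"
    using vandermonde[of s "R - s" K] assms by simp
  finally show ?thesis using assms by simp
qed

section \<open>Ratios and tail bounds\<close>

lemma choose_Suc_ratio: "real (n choose Suc k) * (real k + 1) = real (n choose k) * (real n - real k)"
proof (cases "k \<le> n")
  case True
  have "Suc k * (n choose Suc k) = (n - k) * (n choose k)"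
    using binomial_absorption[of k n] binomial_absorb_comp[of n k] by simp
  then have "real (Suc k) * real (n choose Suc k) = real (n - k) * real (n choose k)"
    by (metis of_nat_mult)
  then show ?thesis using True by (simp add: of_nat_diff algebra_simps)
qed (simp add: binomial_eq_0)

lemma choose_Suc_upper_ratio:
  "real (Suc n choose k) * (real n + 1 - real k) = real (n choose k) * (real n + 1)"
proof (cases "k \<le> Suc n")
  case True
  have "(Suc n - k) * (Suc n choose k) = Suc n * (n choose k)"
    using binomial_absorb_comp[of "Suc n" k] by simp
  then have "real (Suc n - k) * real (Suc n choose k) = real (Suc n) * real (n choose k)"
    by (metis of_nat_mult)
  then show ?thesis using True by (simp add: of_nat_diff algebra_simps)
qed (simp add: binomial_eq_0)

text \<open>Kept free of division so that it stays true where factors vanish; likewise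
  \<open>hyp_Suc_left\<close>, where the number of marked items grows.\<close>

lemma hyp_Suc_right:
  assumes "j < K" "s \<le> R"
  shows "hyp R K s (Suc j) * ((real j + 1) * (real R - real s - real K + real j + 1))
       = hyp R K s j * ((real s - real j) * (real K - real j))"
proof -
  let ?m = "K - Suc j"
  have m: "K - j = Suc ?m" "real ?m = real K - real j - 1" using assms by auto
  have "real (R - s choose Suc ?m) * (real ?m + 1) = real (R - s choose ?m) * (real (R - s) - real ?m)"
    by (rule choose_Suc_ratio)
  then have 1: "real (R - s choose (K - j)) * (real K - real j)
      = real (R - s choose ?m) * (real R - real s - real K + real j + 1)"
    using assms m by (simp add: of_nat_diff algebra_simps)
  have 2: "real (s choose Suc j) * (real j + 1) = real (s choose j) * (real s - real j)"
    by (rule choose_Suc_ratio)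
  have "real (s choose Suc j) * real (R - s choose ?m) * ((real j + 1) * (real R - real s - real K + real j + 1))
     = (real (s choose Suc j) * (real j + 1)) * (real (R - s choose ?m) * (real R - real s - real K + real j + 1))"
    by (simp only: mult_ac)
  also have "\<dots> = real (s choose j) * real (R - s choose (K - j)) * ((real s - real j) * (real K - real j))"
    unfolding 1[symmetric] 2 by (simp only: mult_ac)
  finally show ?thesis unfolding hyp_def by (simp add: divide_simps)
qed

lemma hyp_Suc_left:
  assumes "j \<le> K" "s < R"
  shows "hyp R K (Suc s) j * ((real s + 1 - real j) * (real R - real s))
       = hyp R K s j * ((real s + 1) * (real R - real s - real K + real j))"
proof -
  let ?n = "R - Suc s"
  have n: "R - s = Suc ?n" "real ?n = real R - real s - 1" using assms by auto
  have "real (Suc ?n choose (K - j)) * (real ?n + 1 - real (K - j)) = real (?n choose (K - j)) * (real ?n + 1)"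
    by (rule choose_Suc_upper_ratio)
  then have 1: "real (?n choose (K - j)) * (real R - real s)
      = real (R - s choose (K - j)) * (real R - real s - real K + real j)"
    using assms n by (simp add: of_nat_diff algebra_simps)
  have 2: "real (Suc s choose j) * (real s + 1 - real j) = real (s choose j) * (real s + 1)"
    by (rule choose_Suc_upper_ratio)
  have "real (Suc s choose j) * real (?n choose (K - j)) * ((real s + 1 - real j) * (real R - real s))
     = (real (Suc s choose j) * (real s + 1 - real j)) * (real (?n choose (K - j)) * (real R - real s))"
    by (simp only: mult_ac)
  also have "\<dots> = real (s choose j) * real (R - s choose (K - j)) * ((real s + 1) * (real R - real s - real K + real j))"
    unfolding 1 2 by (simp only: mult_ac)
  finally show ?thesis unfolding hyp_def by (simp add: divide_simps)
qed

text \<open>The weights increase up to \<open>K\<close> and decrease from there on, so the weight at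
  \<open>K\<close> is at least the average of the \<open>R + 1\<close> weights.\<close>

lemma binomial_mode_ge:
  assumes "0 < R" "K \<le> R"
  shows "1 / (real R + 1) \<le> pmf (binomial_pmf R (real K / real R)) K"
proof -
  define \<theta> where "\<theta> = real K / real R"
  have \<theta>: "0 \<le> \<theta>" "\<theta> \<le> 1" using assms by (auto simp: \<theta>_def)
  define b where "b = (\<lambda>k. pmf (binomial_pmf R \<theta>) k)"
  have b: "b k = real (R choose k) * \<theta> ^ k * (1 - \<theta>) ^ (R - k)" for k
    unfolding b_def using \<theta> by (subst pmf_binomial) auto
  have b0: "0 \<le> b k" for k by (simp add: b_def)
  have step: "b (Suc k) * ((real k + 1) * (1 - \<theta>)) = b k * ((real R - real k) * \<theta>)" if "k < R" for k
  proof -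
    have "R - k = Suc (R - Suc k)" using that by simp
    then have "b k = real (R choose k) * \<theta> ^ k * ((1 - \<theta>) * (1 - \<theta>) ^ (R - Suc k))"
      by (simp add: b)
    then have "b k * ((real R - real k) * \<theta>) =
      (real (R choose k) * (real R - real k)) * \<theta> ^ Suc k * ((1 - \<theta>) * (1 - \<theta>) ^ (R - Suc k))"
      by (simp only: mult_ac power_Suc)
    also have "\<dots> = b (Suc k) * ((real k + 1) * (1 - \<theta>))"
      unfolding choose_Suc_ratio[symmetric] b by (simp only: mult_ac)
    finally show ?thesis ..
  qed
  have R\<theta>: "real R * \<theta> = real K" using assms by (simp add: \<theta>_def)
  have ratio: "(real R - real k) * \<theta> - (real k + 1) * (1 - \<theta>) = real K - (real k + 1) + \<theta>" for k
    using R\<theta> by (simp add: algebra_simps)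
  have up: "b k \<le> b (Suc k)" if "k < K" for k
  proof -
    have k: "k < R" using that assms by simp
    show ?thesis
    proof (cases "\<theta> = 1")
      case True
      then show ?thesis using k by (simp add: b power_0_left)
    next
      case False
      have "(real k + 1) * (1 - \<theta>) \<le> (real R - real k) * \<theta>"
        using ratio[of k] that \<theta> by simp
      then have "b k * ((real k + 1) * (1 - \<theta>)) \<le> b (Suc k) * ((real k + 1) * (1 - \<theta>))"
        unfolding step[OF k] by (rule mult_left_mono) (rule b0)
      moreover have "0 < (real k + 1) * (1 - \<theta>)" using False \<theta> by simp
      ultimately show ?thesis by (rule mult_right_le_imp_le)
    qed
  qed
  have down: "b (Suc k) \<le> b k" if "K \<le> k" for k
  proof (cases "k < R")
    case False
    then show ?thesis using b0[of k] by (simp add: b binomial_eq_0)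
  next
    case k: True
    then have \<theta>1: "\<theta> < 1" using that assms by (simp add: \<theta>_def)
    have "(real R - real k) * \<theta> \<le> (real k + 1) * (1 - \<theta>)"
      using ratio[of k] that \<theta> by simp
    then have "b (Suc k) * ((real k + 1) * (1 - \<theta>)) \<le> b k * ((real k + 1) * (1 - \<theta>))"
      unfolding step[OF k] by (rule mult_left_mono) (rule b0)
    moreover have "0 < (real k + 1) * (1 - \<theta>)" using \<theta>1 by simp
    ultimately show ?thesis by (rule mult_right_le_imp_le)
  qed
  have "b k \<le> b K" for k
  proof (cases "k \<le> K")
    case True
    then show ?thesis
    proof (induction k rule: inc_induct)
      case (step n)
      then show ?case using up[of n] by simp
    qed simp
  next
    case False
    then have "K \<le> k" by simp
    then show ?thesis
    proof (induction k rule: dec_induct)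
      case (step n)
      then show ?case using down[of n] by simp
    qed simp
  qed
  then have "(\<Sum>k\<le>R. b k) \<le> (\<Sum>k\<le>R. b K)" by (intro sum_mono)
  moreover have "(\<Sum>k\<le>R. b k) = 1"
  proof -
    have "(\<Sum>k\<le>R. b k) = (\<theta> + (1 - \<theta>)) ^ R"
      unfolding binomial_ring by (simp add: b)
    then show ?thesis by simp
  qed
  ultimately have "1 \<le> (real R + 1) * b K" by (simp add: add.commute)
  then show ?thesis unfolding \<theta>_def[symmetric] b_def[symmetric] by (simp add: field_simps)
qed

lemma pmf_binomial_le_exp:
  assumes "0 \<le> p" "p \<le> 1" "0 < n"
  shows "pmf (binomial_pmf n p) k \<le> 2 * exp (- 2 * (real k - real n * p)\<^sup>2 / real n)"
proof -
  interpret binomial_distribution n p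
    by unfold_locales (use assms in auto)
  let ?\<epsilon> = "\<bar>real k - real n * p\<bar>"
  have "pmf (binomial_pmf n p) k = measure_pmf.prob (binomial_pmf n p) {k}"
    by (simp add: measure_pmf_single del: pmf_binomial)
  also have "\<dots> \<le> measure_pmf.prob (binomial_pmf n p) {x. \<bar>real x - real n * p\<bar> \<ge> ?\<epsilon>}"
    by (intro measure_pmf.finite_measure_mono) auto
  also have "\<dots> \<le> 2 * exp (- 2 * ?\<epsilon>\<^sup>2 / real n)"
    by (rule prob_abs_ge) (use assms in auto)
  finally show ?thesis by simp
qed

text \<open>A hypergeometric variable is a binomial one, with success probability
  \<open>K / R\<close>, conditioned on the total being \<open>K\<close>. As \<open>K\<close> is the
  mode of the total, the conditioning costs only a factor \<open>R + 1\<close>; Hoeffding's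
  inequality does the rest.\<close>

lemma hyp_le_exp:
  assumes "0 < s" "s \<le> R" "K \<le> R" "j \<le> K"
  shows "hyp R K s j \<le> 2 * (real R + 1) *
    exp (- 2 * ((real s * real K - real j * real R) / real R)\<^sup>2 / real s)"
proof (cases "j \<le> s \<and> K - j \<le> R - s")
  case False
  then have "hyp R K s j = 0" by (auto simp: hyp_def not_le binomial_eq_0)
  then show ?thesis by simp
next
  case True
  define \<theta> where "\<theta> = real K / real R"
  have R: "0 < R" using assms by simp
  have \<theta>: "0 \<le> \<theta>" "\<theta> \<le> 1" using assms by (auto simp: \<theta>_def)
  let ?P = "\<lambda>n k. pmf (binomial_pmf n \<theta>) k"
  have P: "?P n k = real (n choose k) * \<theta> ^ k * (1 - \<theta>) ^ (n - k)" for n k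
    using \<theta> by (subst pmf_binomial) auto
  have pos: "1 / (real R + 1) \<le> ?P R K"
    unfolding \<theta>_def by (rule binomial_mode_ge[OF R assms(3)])
  have e1: "\<theta> ^ j * \<theta> ^ (K - j) = \<theta> ^ K" using assms by (simp flip: power_add)
  have e2: "(1 - \<theta>) ^ (s - j) * (1 - \<theta>) ^ (R - s - (K - j)) = (1 - \<theta>) ^ (R - K)"
  proof -
    have "s - j + (R - s - (K - j)) = R - K" using assms True by linarith
    then show ?thesis by (simp only: power_add[symmetric])
  qed
  have "?P s j * ?P (R - s) (K - j) = real ((s choose j) * (R - s choose (K - j))) *
      (\<theta> ^ j * \<theta> ^ (K - j)) * ((1 - \<theta>) ^ (s - j) * (1 - \<theta>) ^ (R - s - (K - j)))"
    unfolding P by (simp add: mult_ac)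
  also have "\<dots> = hyp R K s j * ?P R K"
    unfolding e1 e2 P hyp_def using assms by simp
  finally have eq: "hyp R K s j * ?P R K = ?P s j * ?P (R - s) (K - j)" by simp
  have "hyp R K s j * (1 / (real R + 1)) \<le> hyp R K s j * ?P R K"
    by (rule mult_left_mono[OF pos hyp_nonneg])
  also have "\<dots> \<le> ?P s j * 1"
    unfolding eq by (rule mult_left_mono) (auto intro: pmf_le_1)
  also have "?P s j \<le> 2 * exp (- 2 * (real j - real s * \<theta>)\<^sup>2 / real s)"
    by (rule pmf_binomial_le_exp) (use \<theta> assms in auto)
  also have "(real j - real s * \<theta>)\<^sup>2 = ((real s * real K - real j * real R) / real R)\<^sup>2"
    using R by (subst power2_commute) (simp add: \<theta>_def diff_divide_distrib)
  finally show ?thesis using R by (simp add: field_simps)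
qed

lemma abs_divide_le:
  fixes x y b d :: real
  assumes "\<bar>x\<bar> \<le> b" "0 < d" "d \<le> y"
  shows "\<bar>x / y\<bar> \<le> b / d"
  using assms by (auto simp: abs_divide intro!: frac_le)

text \<open>\<open>A\<close> is the scale of all counts, and \<open>\<eta> * A\<close> bounds from
  below the four cells of the contingency table with margins \<open>s\<close> and \<open>K\<close>.
  \<open>D\<close> measures the window for \<open>s K - j R\<close>, which is \<open>R\<close> times
  the deviation of \<open>j\<close> from its mean. \<open>A ^ 3 \<le> D ^ 2\<close> puts the window
  at or above the standard deviation, the bound on \<open>24 * D\<close> keeps relative changes
  small, and \<open>c\<close> approximates the density \<open>K / R\<close>.\<close>

locale hyp_window =
  fixes R K s :: nat and A \<eta> D c :: real
  assumes \<eta>: "0 < \<eta>" "\<eta> \<le> 1"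
    and A: "1 \<le> A" and R: "real R \<le> 5 * A" and K: "K \<le> R" and s: "s < R"
    and D: "30 * A \<le> D" "A ^ 3 \<le> D ^ 2" "24 * D \<le> \<eta>\<^sup>2 * A\<^sup>2"
    and c: "0 \<le> c" "c \<le> 1" "\<bar>c * real R - real K\<bar> * A\<^sup>2 \<le> D * real R"
    and bulk: "\<And>j::nat. \<bar>real s * real K - real j * real R\<bar> \<le> 5 * D \<Longrightarrow>
       \<eta> * A \<le> real j \<and> \<eta> * A \<le> real s - real j \<and> \<eta> * A \<le> real K - real j \<and>
       \<eta> * A \<le> real R - real s - real K + real j"
begin

definition X :: "nat \<Rightarrow> real" where "X j = real s * real K - real j * real R"

abbreviation h :: "nat \<Rightarrow> real" where "h \<equiv> hyp R K s"

definition \<rho> :: "nat \<Rightarrow> real" where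
  "\<rho> j = (real s - real j) * (real K - real j) / ((real j + 1) * (real R - real s - real K + real j + 1))"

text \<open>The size, up to constants, of the relative change of \<open>h\<close> in one step; for
  \<open>D\<close> near \<open>A powr (3/2)\<close> it is of order
  \<open>1 / sqrt A\<close>.\<close>

definition \<kappa> :: real where "\<kappa> = D / (\<eta>\<^sup>2 * A\<^sup>2)"

lemma bulk':
  assumes "\<bar>X j\<bar> \<le> 5 * D"
  shows "\<eta> * A \<le> real j" "\<eta> * A \<le> real s - real j" "\<eta> * A \<le> real K - real j"
    "\<eta> * A \<le> real R - real s - real K + real j"
  using bulk[of j] assms by (auto simp: X_def)

lemma \<eta>A: "0 < \<eta> * A"
  using \<eta> A by simp

lemma \<kappa>_pos: "0 < \<kappa>"
  using \<eta> A D(1) by (simp add: \<kappa>_def)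

lemma \<kappa>_small: "24 * \<kappa> \<le> 1"
  using D(3) \<eta> A by (simp add: \<kappa>_def field_simps)

text \<open>Through this, \<open>A ^ 3 \<le> D ^ 2\<close> lets \<open>\<kappa>\<^sup>2\<close>
  absorb all errors of relative order \<open>1 / A\<close>.\<close>

lemma inverse_A_le: "1 / (\<eta>\<^sup>2 * A) \<le> \<kappa>\<^sup>2"
proof -
  have "1 / (\<eta>\<^sup>2 * A) = \<eta>\<^sup>2 * A ^ 3 / (\<eta> ^ 4 * A ^ 4)"
    using \<eta> A by (simp add: field_simps eval_nat_numeral)
  also have "\<dots> \<le> 1 * D\<^sup>2 / (\<eta> ^ 4 * A ^ 4)"
    using \<eta> A D(2) power_le_one[of \<eta> 2] by (intro divide_right_mono mult_mono) auto
  also have "\<dots> = \<kappa>\<^sup>2" by (simp add: \<kappa>_def power_divide power_mult_distrib)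
  finally show ?thesis .
qed

lemma in_range:
  assumes "\<bar>X j\<bar> \<le> 5 * D"
  shows "j < K" "j < s" "real R - real s - real K + real j > 0"
  using bulk'[OF assms] \<eta>A by auto

lemma h_Suc: "\<bar>X j\<bar> \<le> 5 * D \<Longrightarrow> h (Suc j) = h j * \<rho> j"
proof -
  assume a: "\<bar>X j\<bar> \<le> 5 * D"
  have "h (Suc j) * ((real j + 1) * (real R - real s - real K + real j + 1))
       = h j * ((real s - real j) * (real K - real j))"
    by (rule hyp_Suc_right) (use in_range[OF a] s in auto)
  moreover have "0 < (real j + 1) * (real R - real s - real K + real j + 1)"
    using in_range[OF a] by (intro mult_pos_pos) auto
  ultimately show ?thesis by (simp add: \<rho>_def field_simps)
qed

lemma denom_ge:
  assumes "\<bar>X j\<bar> \<le> 5 * D"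
  shows "\<eta>\<^sup>2 * A\<^sup>2 \<le> (real j + 1) * (real R - real s - real K + real j + 1)"
proof -
  have "(\<eta> * A) * (\<eta> * A) \<le> (real j + 1) * (real R - real s - real K + real j + 1)"
    using bulk'[OF assms] \<eta>A by (intro mult_mono) auto
  then show ?thesis by (simp add: power2_eq_square mult_ac)
qed

lemma \<rho>_minus_1:
  assumes "\<bar>X j\<bar> \<le> 5 * D"
  shows "\<rho> j - 1 = (X j - (real R - real s - real K + 2 * real j + 1))
       / ((real j + 1) * (real R - real s - real K + real j + 1))"
proof -
  have "0 < (real j + 1) * (real R - real s - real K + real j + 1)"
    using in_range[OF assms] by (intro mult_pos_pos) auto
  then have nz: "(real j + 1) * (real R - real s - real K + real j + 1) \<noteq> 0" by linarith
  have "x / y - 1 = (x - y) / y" if "y \<noteq> 0" for x y :: real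
    using that by (simp add: diff_divide_distrib)
  then have "\<rho> j - 1 = ((real s - real j) * (real K - real j) -
     (real j + 1) * (real R - real s - real K + real j + 1))
       / ((real j + 1) * (real R - real s - real K + real j + 1))"
    unfolding \<rho>_def using nz by blast
  also have "(real s - real j) * (real K - real j) - (real j + 1) * (real R - real s - real K + real j + 1)
    = X j - (real R - real s - real K + 2 * real j + 1)"
    by (simp add: X_def algebra_simps)
  finally show ?thesis .
qed

lemma abs_\<rho>_minus_1:
  assumes "\<bar>X j\<bar> \<le> 5 * D"
  shows "\<bar>\<rho> j - 1\<bar> \<le> 6 * \<kappa>"
proof -
  have "\<bar>X j - (real R - real s - real K + 2 * real j + 1)\<bar> \<le> 6 * D"
    using assms in_range[OF assms] R D A s K by linarith
  then have "\<bar>\<rho> j - 1\<bar> \<le> 6 * D / (\<eta>\<^sup>2 * A\<^sup>2)"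
    unfolding \<rho>_minus_1[OF assms] using denom_ge[OF assms] \<eta> A by (intro abs_divide_le) auto
  then show ?thesis by (simp add: \<kappa>_def)
qed

text \<open>By \<open>abs_\<rho>_minus_1\<close> the weight keeps at least half its value over the
  next \<open>n\<close>, about \<open>1 / (12 * \<kappa>)\<close>, steps:
  \<open>(1 - 6 * \<kappa>) ^ n \<ge> 1 / 2\<close> by Bernoulli's inequality. As
  \<open>n * R \<le> D\<close>, these steps stay within \<open>5 * D\<close>. The total mass is 1,
  whence the bound.\<close>

lemma h_le:
  assumes "\<bar>X j\<bar> \<le> 4 * D"
  shows "h j \<le> 24 * \<kappa>"
proof -
  define n where "n = nat \<lfloor>1 / (12 * \<kappa>)\<rfloor>"
  have n: "real n \<le> 1 / (12 * \<kappa>)" "1 / (12 * \<kappa>) < real n + 1"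
  proof -
    have "real n = of_int \<lfloor>1 / (12 * \<kappa>)\<rfloor>"
      unfolding n_def using \<kappa>_pos by (intro of_nat_nat) simp
    then show "real n \<le> 1 / (12 * \<kappa>)" "1 / (12 * \<kappa>) < real n + 1"
      by linarith+
  qed
  have nR: "real n * real R \<le> D"
  proof -
    have "real n * real R \<le> 1 / (12 * \<kappa>) * (5 * A)"
      using n R \<kappa>_pos by (intro mult_mono) auto
    also have "\<dots> = 5 * A / (12 * \<kappa>)" by simp
    also have "\<dots> \<le> D"
    proof -
      have "\<eta>\<^sup>2 * A ^ 3 \<le> 1 * A ^ 3"
        using A power_le_one[of \<eta> 2] \<eta> by (intro mult_right_mono) auto
      then have "A * (\<eta>\<^sup>2 * A\<^sup>2) \<le> D * D"
        using D(2) by (simp add: power2_eq_square power3_eq_cube mult_ac)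
      moreover have "0 < \<eta>\<^sup>2 * A\<^sup>2" using \<eta> A by simp
      ultimately have "A \<le> D * \<kappa>"
        by (simp add: \<kappa>_def pos_le_divide_eq)
      moreover have "0 \<le> D * \<kappa>" using calculation A by linarith
      ultimately have "5 * A \<le> D * (12 * \<kappa>)" by linarith
      then show ?thesis using \<kappa>_pos by (simp add: pos_divide_le_eq)
    qed
    finally show ?thesis .
  qed
  have X: "X (j + i) = X j - real i * real R" for i
    by (simp add: X_def algebra_simps)
  have win: "\<bar>X (j + i)\<bar> \<le> 5 * D" if "i \<le> n" for i
  proof -
    have "real i * real R \<le> real n * real R" using that by (intro mult_right_mono) auto
    moreover have "0 \<le> real i * real R" by simp
    ultimately show ?thesis using X[of i] nR assms by linarith
  qed
  have ge: "h j * (1 - 6 * \<kappa>) ^ i \<le> h (j + i)" if "i \<le> n" for i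
    using that
  proof (induction i)
    case (Suc i)
    have "h j * (1 - 6 * \<kappa>) ^ Suc i = h j * (1 - 6 * \<kappa>) ^ i * (1 - 6 * \<kappa>)" by simp
    also have "\<dots> \<le> h (j + i) * (1 - 6 * \<kappa>)"
      using Suc \<kappa>_small by (intro mult_right_mono) auto
    also have "\<dots> \<le> h (j + i) * \<rho> (j + i)"
      using abs_\<rho>_minus_1[OF win[of i]] Suc.prems by (intro mult_left_mono hyp_nonneg) auto
    also have "\<dots> = h (j + Suc i)"
      using h_Suc[OF win[of i]] Suc.prems by simp
    finally show ?case .
  qed simp
  have half: "1 / 2 \<le> (1 - 6 * \<kappa>) ^ i" if "i \<le> n" for i
  proof -
    have "real i * (6 * \<kappa>) \<le> real n * (6 * \<kappa>)" using that \<kappa>_pos by (intro mult_right_mono) auto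
    also have "\<dots> \<le> 1 / (12 * \<kappa>) * (6 * \<kappa>)" using n \<kappa>_pos by (intro mult_right_mono) auto
    also have "\<dots> = 1 / 2" using \<kappa>_pos by simp
    finally have "1 / 2 \<le> 1 + real i * (- (6 * \<kappa>))" by simp
    also have "\<dots> \<le> (1 + - (6 * \<kappa>)) ^ i"
      by (rule Bernoulli_inequality) (use \<kappa>_small in auto)
    finally show ?thesis by simp
  qed
  have "(\<Sum>i\<le>n. h j / 2) \<le> (\<Sum>i\<le>n. h (j + i))"
  proof (intro sum_mono)
    fix i assume "i \<in> {..n}"
    then have "h j * (1 / 2) \<le> h j * (1 - 6 * \<kappa>) ^ i"
      using half by (intro mult_left_mono hyp_nonneg) auto
    then show "h j / 2 \<le> h (j + i)" using ge[of i] \<open>i \<in> {..n}\<close> by simp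
  qed
  also have "(\<Sum>i\<le>n. h (j + i)) = (\<Sum>k\<in>(\<lambda>i. j + i) ` {..n}. h k)"
    by (simp add: sum.reindex)
  also have "\<dots> \<le> (\<Sum>k\<le>K. h k)"
  proof (rule sum_mono2)
    show "(\<lambda>i. j + i) ` {..n} \<subseteq> {..K}"
    proof
      fix k assume "k \<in> (\<lambda>i. j + i) ` {..n}"
      then obtain i where i: "i \<le> n" "k = j + i" by auto
      then have "j + i < K" by (intro in_range(1) win)
      then show "k \<in> {..K}" using i by simp
    qed
  qed (simp_all add: hyp_nonneg)
  also have "\<dots> = 1" by (rule sum_hyp) (use s K in auto)
  finally have "(real n + 1) * h j \<le> 2" by (simp add: add.commute)
  moreover have "1 / (12 * \<kappa>) * h j \<le> (real n + 1) * h j"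
    by (rule mult_right_mono[OF less_imp_le[OF n(2)] hyp_nonneg])
  ultimately have "1 / (12 * \<kappa>) * h j \<le> 2" by linarith
  then show ?thesis using \<kappa>_pos by (simp add: pos_divide_le_eq)
qed

text \<open>Quotient rule: numerator and denominator of \<open>\<rho>\<close> are quadratic in
  \<open>j\<close>, so they move by order \<open>A\<close>, against a denominator of order
  \<open>A\<^sup>2\<close>.\<close>

lemma abs_diff_\<rho>:
  assumes "\<bar>X j\<bar> \<le> 5 * D" "\<bar>X (Suc j)\<bar> \<le> 5 * D"
  shows "\<bar>\<rho> (Suc j) - \<rho> j\<bar> \<le> 36 * \<kappa>\<^sup>2"
proof -
  define f where "f = (\<lambda>j. (real s - real j) * (real K - real j))"
  define g where "g = (\<lambda>j. (real j + 1) * (real R - real s - real K + real j + 1))"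
  have \<rho>: "\<rho> i = f i / g i" for i by (simp add: \<rho>_def f_def g_def)
  have g: "\<eta>\<^sup>2 * A\<^sup>2 \<le> g j" "\<eta>\<^sup>2 * A\<^sup>2 \<le> g (Suc j)"
    using denom_ge[OF assms(1)] denom_ge[OF assms(2)] by (auto simp: g_def)
  have pos: "0 < \<eta>\<^sup>2 * A\<^sup>2" using \<eta> A by simp
  have "f (Suc j) - f j = - ((real s - real j) + (real K - real j) - 1)"
    by (simp add: f_def algebra_simps)
  then have f1: "\<bar>f (Suc j) - f j\<bar> \<le> 10 * A"
    using in_range[OF assms(1)] R K s by linarith
  have "g (Suc j) - g j = real R - real s - real K + 2 * real j + 3"
    by (simp add: g_def algebra_simps)
  then have g1: "\<bar>g (Suc j) - g j\<bar> \<le> 13 * A"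
    using in_range[OF assms(1)] R K s A by linarith
  have \<rho>2: "\<bar>\<rho> j\<bar> \<le> 2"
    using abs_\<rho>_minus_1[OF assms(1)] \<kappa>_small by linarith
  have nz: "g j \<noteq> 0" "g (Suc j) \<noteq> 0" using g pos by linarith+
  then have "\<rho> j * g j = f j" "\<rho> (Suc j) * g (Suc j) = f (Suc j)" unfolding \<rho> by simp_all
  then have "(\<rho> (Suc j) - \<rho> j) * g (Suc j) = (f (Suc j) - f j) - \<rho> j * (g (Suc j) - g j)"
    by (simp only: left_diff_distrib right_diff_distrib)
  then have "\<rho> (Suc j) - \<rho> j = ((f (Suc j) - f j) - \<rho> j * (g (Suc j) - g j)) / g (Suc j)"
    by (rule nonzero_eq_divide_eq[OF nz(2), THEN iffD2])
  moreover have "\<bar>(f (Suc j) - f j) - \<rho> j * (g (Suc j) - g j)\<bar> \<le> 36 * A"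
  proof -
    have "\<bar>\<rho> j * (g (Suc j) - g j)\<bar> \<le> 2 * (13 * A)"
      unfolding abs_mult using \<rho>2 g1 by (intro mult_mono) auto
    then show ?thesis using f1 by linarith
  qed
  ultimately have "\<bar>\<rho> (Suc j) - \<rho> j\<bar> \<le> 36 * A / (\<eta>\<^sup>2 * A\<^sup>2)"
    using abs_divide_le[OF _ pos g(2)] by metis
  also have "\<dots> = 36 * (1 / (\<eta>\<^sup>2 * A))"
    using A \<eta> by (simp add: field_simps power2_eq_square)
  also have "\<dots> \<le> 36 * \<kappa>\<^sup>2" using inverse_A_le by simp
  finally show ?thesis .
qed

lemma abs_diff_h:
  assumes "\<bar>X j\<bar> \<le> 4 * D"
  shows "\<bar>h (Suc j) - h j\<bar> \<le> 144 * \<kappa>\<^sup>2"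
proof -
  have w: "\<bar>X j\<bar> \<le> 5 * D" using assms D A by linarith
  have "h (Suc j) - h j = h j * (\<rho> j - 1)" by (simp add: h_Suc[OF w] algebra_simps)
  also have "\<bar>\<dots>\<bar> \<le> (24 * \<kappa>) * (6 * \<kappa>)"
    unfolding abs_mult using h_le[OF assms] abs_\<rho>_minus_1[OF w] hyp_nonneg[of R K s j] \<kappa>_pos
    by (intro mult_mono) auto
  finally show ?thesis by (simp add: power2_eq_square)
qed

text \<open>The second difference is \<open>h j\<close> times the product of two deviations of
  \<open>\<rho>\<close> from 1 plus an increment of \<open>\<rho>\<close>; both are of order
  \<open>\<kappa>\<^sup>2\<close>, and \<open>h j\<close> is of order
  \<open>\<kappa>\<close>.\<close>

lemma abs_diff2_h:
  assumes "\<bar>X j\<bar> \<le> 4 * D" "\<bar>X (Suc j)\<bar> \<le> 4 * D"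
  shows "\<bar>(h (Suc (Suc j)) - h (Suc j)) - (h (Suc j) - h j)\<bar> \<le> 6000 * \<kappa> ^ 3"
proof -
  have w: "\<bar>X j\<bar> \<le> 5 * D" "\<bar>X (Suc j)\<bar> \<le> 5 * D" using assms D A by linarith+
  have "(h (Suc (Suc j)) - h (Suc j)) - (h (Suc j) - h j)
     = h j * ((\<rho> j - 1) * (\<rho> (Suc j) - 1) + (\<rho> (Suc j) - \<rho> j))"
    by (simp add: h_Suc[OF w(1)] h_Suc[OF w(2)] algebra_simps)
  also have "\<bar>\<dots>\<bar> \<le> (24 * \<kappa>) * (72 * \<kappa>\<^sup>2)"
  proof -
    have "\<bar>(\<rho> j - 1) * (\<rho> (Suc j) - 1)\<bar> \<le> (6 * \<kappa>) * (6 * \<kappa>)"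
      unfolding abs_mult using abs_\<rho>_minus_1[OF w(1)] abs_\<rho>_minus_1[OF w(2)] \<kappa>_pos
      by (intro mult_mono) auto
    then have "\<bar>(\<rho> j - 1) * (\<rho> (Suc j) - 1) + (\<rho> (Suc j) - \<rho> j)\<bar> \<le> 72 * \<kappa>\<^sup>2"
      using abs_diff_\<rho>[OF w] by (simp add: power2_eq_square)
    then show ?thesis
      unfolding abs_mult using h_le[OF assms(1)] hyp_nonneg[of R K s j] \<kappa>_pos
      by (intro mult_mono) auto
  qed
  also have "\<dots> \<le> 6000 * \<kappa> ^ 3"
    using \<kappa>_pos by (simp add: eval_nat_numeral)
  finally show ?thesis .
qed

text \<open>One more marked item shifts the mean by \<open>K / R\<close>, about \<open>c\<close>, so
  to first order \<open>h\<close> is translated by \<open>c\<close>. Concretely,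
  \<open>\<sigma> - 1\<close> and \<open>\<rho> j - 1\<close> are close to
  \<open>- X j / (x * y)\<close> and \<open>X j / (u * v)\<close>, and \<open>c * (x * y)\<close> is
  close to \<open>u * v\<close>.\<close>

lemma abs_transport_h:
  assumes "\<bar>X j\<bar> \<le> 4 * D"
  shows "\<bar>(hyp R K (Suc s) j - h j) + c * (h (Suc j) - h j)\<bar> \<le> 6000 * \<kappa> ^ 3"
proof -
  have w: "\<bar>X j\<bar> \<le> 5 * D" using assms D A by linarith
  note b = bulk'[OF w] and r = in_range[OF w]
  define u where "u = real j + 1"
  define v where "v = real R - real s - real K + real j + 1"
  define x where "x = real s + 1 - real j"
  define y where "y = real R - real s"
  define \<sigma> where "\<sigma> = (real s + 1) * (real R - real s - real K + real j) / (x * y)"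
  have R0: "0 < real R" using s by simp
  have ge: "\<eta> * A \<le> u" "\<eta> * A \<le> v" "\<eta> * A \<le> x" "\<eta> * A \<le> y"
    using b r s unfolding u_def v_def x_def y_def by linarith+
  have pos: "0 < u" "0 < v" "0 < x" "0 < y" using ge \<eta>A by linarith+
  have le: "x \<le> 6 * A" "y \<le> 5 * A"
    using R A s unfolding x_def y_def by linarith+
  have xy: "\<eta>\<^sup>2 * A\<^sup>2 \<le> x * y"
  proof -
    have "(\<eta> * A) * (\<eta> * A) \<le> x * y" using ge \<eta>A by (intro mult_mono) auto
    then show ?thesis by (simp add: power2_eq_square mult_ac)
  qed
  have uv: "\<eta>\<^sup>2 * A\<^sup>2 \<le> u * v" using denom_ge[OF w] by (simp add: u_def v_def)
  have "hyp R K (Suc s) j * (x * y) = h j * ((real s + 1) * (real R - real s - real K + real j))"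
    unfolding x_def y_def by (rule hyp_Suc_left) (use r s in auto)
  then have \<sigma>: "hyp R K (Suc s) j = h j * \<sigma>"
    using pos by (simp add: \<sigma>_def field_simps)
  have "\<sigma> - 1 = ((real s + 1) * (real R - real s - real K + real j) - x * y) / (x * y)"
    using pos by (simp add: \<sigma>_def diff_divide_distrib)
  also have "(real s + 1) * (real R - real s - real K + real j) - x * y = - X j + (real j - real K)"
    by (simp add: X_def x_def y_def algebra_simps)
  finally have \<sigma>1: "\<sigma> - 1 = - X j / (x * y) + (real j - real K) / (x * y)"
    by (simp add: diff_divide_distrib)
  have \<rho>1: "\<rho> j - 1 = X j / (u * v) - (real R - real s - real K + 2 * real j + 1) / (u * v)"
    unfolding \<rho>_minus_1[OF w] u_def v_def by (simp add: diff_divide_distrib)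
  have "\<sigma> - 1 + c * (\<rho> j - 1) = X j * (c * (x * y) - u * v) / ((u * v) * (x * y))
     + (real j - real K) / (x * y) - c * (real R - real s - real K + 2 * real j + 1) / (u * v)"
  proof -
    have "\<xi> * (c * b - a) / (a * b) = c * \<xi> / a - \<xi> / b" if "a \<noteq> 0" "b \<noteq> 0" for \<xi> a b :: real
      using that by (simp add: field_simps)
    moreover have "u * v \<noteq> 0" "x * y \<noteq> 0" using pos by auto
    ultimately show ?thesis unfolding \<sigma>1 \<rho>1 by (simp add: right_diff_distrib)
  qed
  moreover have "\<bar>(real j - real K) / (x * y)\<bar> \<le> 5 * A / (\<eta>\<^sup>2 * A\<^sup>2)"
    using xy \<eta> A r R K by (intro abs_divide_le) auto
  moreover have "\<bar>c * (real R - real s - real K + 2 * real j + 1) / (u * v)\<bar> \<le> 11 * A / (\<eta>\<^sup>2 * A\<^sup>2)"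
  proof (intro abs_divide_le)
    have "\<bar>c\<bar> * \<bar>real R - real s - real K + 2 * real j + 1\<bar> \<le> 1 * (11 * A)"
      using c r R K s A by (intro mult_mono) auto
    then show "\<bar>c * (real R - real s - real K + 2 * real j + 1)\<bar> \<le> 11 * A"
      by (simp add: abs_mult)
  qed (use uv \<eta> A in auto)
  moreover have "\<bar>X j * (c * (x * y) - u * v) / ((u * v) * (x * y))\<bar>
     \<le> (4 * D) * (42 * D) / ((\<eta>\<^sup>2 * A\<^sup>2) * (\<eta>\<^sup>2 * A\<^sup>2))"
  proof (intro abs_divide_le)
    \<comment> \<open>At the mean \<open>j = s * \<theta>\<close> the leading parts of
      \<open>c * (x * y)\<close> and \<open>u * v\<close> agree exactly; in terms of the deviation
      \<open>\<xi>\<close> they differ by at most \<open>2 * \<bar>X j\<bar>\<close>.\<close>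
    define \<theta> where "\<theta> = real K / real R"
    define \<xi> where "\<xi> = X j / real R"
    have K\<theta>: "real K = \<theta> * real R" using R0 by (simp add: \<theta>_def)
    have j\<xi>: "real j = real s * \<theta> - \<xi>"
      using R0 by (simp add: \<xi>_def X_def \<theta>_def field_simps)
    have "\<theta> * (real s - real j) * (real R - real s) - real j * (real R - real s - real K + real j)
      = \<xi> * (real R - real s + \<theta> * real s) - \<xi>\<^sup>2"
      unfolding j\<xi> K\<theta> by (simp add: algebra_simps power2_eq_square)
    moreover have "\<bar>\<xi> * (real R - real s + \<theta> * real s)\<bar> \<le> \<bar>X j\<bar>"
    proof -
      have "0 \<le> \<theta>" "\<theta> \<le> 1" using K R0 by (auto simp: \<theta>_def)
      then have "\<bar>real R - real s + \<theta> * real s\<bar> \<le> real R"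
        using s mult_right_mono[of \<theta> 1 "real s"] by simp
      then have "\<bar>\<xi>\<bar> * \<bar>real R - real s + \<theta> * real s\<bar> \<le> \<bar>\<xi>\<bar> * real R"
        by (intro mult_left_mono) auto
      then show ?thesis using R0 by (simp add: \<xi>_def abs_mult)
    qed
    moreover have "\<bar>\<xi>\<^sup>2\<bar> \<le> \<bar>X j\<bar>"
    proof -
      have "\<bar>X j\<bar> \<le> real R * real R"
      proof -
        have "real s * real K \<le> real R * real R" "real j * real R \<le> real R * real R"
          using s K r by (intro mult_mono; simp)+
        moreover have "0 \<le> real s * real K" "0 \<le> real j * real R" by simp_all
        ultimately show ?thesis unfolding X_def by linarith
      qed
      then have "\<bar>X j\<bar> * \<bar>X j\<bar> \<le> \<bar>X j\<bar> * (real R * real R)" by (intro mult_left_mono) auto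
      then have "\<bar>X j\<bar> * \<bar>X j\<bar> / (real R * real R) \<le> \<bar>X j\<bar>" using R0 by (simp add: field_simps)
      then show ?thesis by (simp add: \<xi>_def power2_eq_square abs_mult)
    qed
    ultimately have main: "\<bar>\<theta> * (real s - real j) * (real R - real s) - real j * (real R - real s - real K + real j)\<bar> \<le> 8 * D"
      using assms by linarith
    have "c * (x * y) - u * v = (c - \<theta>) * (x * y)
      + (\<theta> * (real s - real j) * (real R - real s) - real j * (real R - real s - real K + real j))
      + \<theta> * y - (real R - real s - real K + 2 * real j + 1)"
      by (simp add: x_def y_def u_def v_def algebra_simps)
    moreover have "\<bar>(c - \<theta>) * (x * y)\<bar> \<le> 30 * D"
    proof -
      have "\<bar>c - \<theta>\<bar> * A\<^sup>2 \<le> D"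
      proof -
        have "c * real R - real K = (c - \<theta>) * real R" by (simp add: K\<theta> algebra_simps)
        then have "(\<bar>c - \<theta>\<bar> * A\<^sup>2) * real R \<le> D * real R"
          using c(3) by (simp add: abs_mult mult_ac)
        then show ?thesis using R0 by (rule mult_right_le_imp_le)
      qed
      moreover have "x * y \<le> (6 * A) * (5 * A)" using le pos A by (intro mult_mono) auto
      then have "\<bar>c - \<theta>\<bar> * (x * y) \<le> \<bar>c - \<theta>\<bar> * ((6 * A) * (5 * A))" by (intro mult_left_mono) auto
      ultimately show ?thesis using pos by (simp add: abs_mult power2_eq_square)
    qed
    moreover have "\<bar>\<theta> * y\<bar> \<le> 5 * A"
    proof -
      have "0 \<le> \<theta>" "\<theta> \<le> 1" using K R0 by (auto simp: \<theta>_def)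
      then have "\<theta> * y \<le> y" "0 \<le> \<theta> * y" using pos by (simp_all add: mult_left_le_one_le)
      then show ?thesis using le by linarith
    qed
    moreover have "\<bar>real R - real s - real K + 2 * real j + 1\<bar> \<le> 11 * A"
      using r R K s A by linarith
    ultimately have "\<bar>c * (x * y) - u * v\<bar> \<le> 42 * D"
      using main D A by linarith
    then show "\<bar>X j * (c * (x * y) - u * v)\<bar> \<le> 4 * D * (42 * D)"
      unfolding abs_mult using assms by (intro mult_mono) auto
    show "\<eta>\<^sup>2 * A\<^sup>2 * (\<eta>\<^sup>2 * A\<^sup>2) \<le> u * v * (x * y)"
      by (rule mult_mono[OF uv xy]) (use pos in simp_all)
  qed (use \<eta> A in auto)
  moreover have "(4 * D) * (42 * D) / ((\<eta>\<^sup>2 * A\<^sup>2) * (\<eta>\<^sup>2 * A\<^sup>2)) = 168 * \<kappa>\<^sup>2"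
    by (simp add: \<kappa>_def power2_eq_square)
  moreover have "5 * A / (\<eta>\<^sup>2 * A\<^sup>2) \<le> 5 * \<kappa>\<^sup>2" "11 * A / (\<eta>\<^sup>2 * A\<^sup>2) \<le> 11 * \<kappa>\<^sup>2"
  proof -
    have "A / (\<eta>\<^sup>2 * A\<^sup>2) = 1 / (\<eta>\<^sup>2 * A)" using A \<eta> by (simp add: field_simps power2_eq_square)
    then have "A / (\<eta>\<^sup>2 * A\<^sup>2) \<le> \<kappa>\<^sup>2" using inverse_A_le by simp
    then show "5 * A / (\<eta>\<^sup>2 * A\<^sup>2) \<le> 5 * \<kappa>\<^sup>2" "11 * A / (\<eta>\<^sup>2 * A\<^sup>2) \<le> 11 * \<kappa>\<^sup>2" by simp_all
  qed
  ultimately have main: "\<bar>\<sigma> - 1 + c * (\<rho> j - 1)\<bar> \<le> 200 * \<kappa>\<^sup>2"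
    by linarith
  have "(hyp R K (Suc s) j - h j) + c * (h (Suc j) - h j) = h j * (\<sigma> - 1 + c * (\<rho> j - 1))"
    by (simp add: h_Suc[OF w] \<sigma> algebra_simps)
  also have "\<bar>\<dots>\<bar> \<le> (24 * \<kappa>) * (200 * \<kappa>\<^sup>2)"
    unfolding abs_mult using h_le[OF assms] main hyp_nonneg[of R K s j] \<kappa>_pos
    by (intro mult_mono) auto
  also have "\<dots> \<le> 6000 * \<kappa> ^ 3" using \<kappa>_pos by (simp add: eval_nat_numeral)
  finally show ?thesis .
qed

end

section \<open>The alternating sum over flips\<close>

text \<open>The assumptions of \<open>hyp_window\<close>, uniformly in the number \<open>s\<close>
  of marked items that occurs along a path: it starts near \<open>a\<close> and grows with every
  second flip, while \<open>R\<close> stays fixed. The density is \<open>1 - q\<^sup>2\<close>, the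
  parameter of the geometric half gaps of a trace of an alternating string.\<close>

locale defect_walk =
  fixes q :: real and a L R :: nat and A \<eta> D :: real
  assumes q: "0 < q" "q < 1"
    and a: "2 \<le> a" and L: "2 \<le> L" and KR: "L - 2 \<le> R" and sR: "a + L div 2 < R" and aA: "A \<le> real R"
    and \<eta>: "0 < \<eta>" "\<eta> \<le> 1"
    and A: "1 \<le> A" and R: "real R \<le> 5 * A"
    and D: "30 * A \<le> D" "A ^ 3 \<le> D ^ 2" "24 * D \<le> \<eta>\<^sup>2 * A\<^sup>2"
    and c: "\<bar>(1 - q\<^sup>2) * real R - real (L - 2)\<bar> * A\<^sup>2 \<le> D * real R"
    and bulk: "\<And>s j::nat. a \<le> s + 1 \<Longrightarrow> s \<le> a + L div 2 \<Longrightarrow>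
       \<bar>real s * real (L - 2) - real j * real R\<bar> \<le> 5 * D \<Longrightarrow>
       \<eta> * A \<le> real j \<and> \<eta> * A \<le> real s - real j \<and> \<eta> * A \<le> real (L - 2) - real j \<and>
       \<eta> * A \<le> real R - real s - real (L - 2) + real j"
begin

definition K :: nat where "K = L - 2"

definition r :: real where "r = 1 / (1 + q)"

definition \<kappa> :: real where "\<kappa> = D / (\<eta>\<^sup>2 * A\<^sup>2)"

text \<open>The bound for \<open>G\<close> off the window, see \<open>tail_estimate\<close>. It is
  superpolynomially small once \<open>D\<close> exceeds \<open>A powr (3/2)\<close> by a
  logarithm.\<close>

definition \<tau> :: real where "\<tau> = 2 * (5 * A + 1) * exp (- (D\<^sup>2 / (250 * A ^ 3)))"

definition G :: "nat \<Rightarrow> nat \<Rightarrow> real" where "G s k = split_count R L s k / real (R choose K)"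

definition g :: "nat \<Rightarrow> nat \<Rightarrow> real" where "g s k = G s (Suc k) - G s k"

text \<open>This is \<open>a + E div 2\<close> in odd states and one less in even ones. A flip out
  of an odd state thus leaves \<open>S\<close> unchanged, so both outcomes of the next bit are
  compared at the same \<open>s\<close>; only flips out of even states need
  \<open>abs_transport_h\<close>.\<close>

definition S :: "nat \<Rightarrow> nat" where "S E = a + (E + 1) div 2 - 1"

text \<open>
  The coefficients of \<open>V\<close> solve a discrete Poisson equation to leading order: the first differences
  of \<open>G\<close> cancel in the conditional mean of \<open>I\<close>, because \<open>G (s + 1) k - G s k\<close> is close to
  \<open>- (1 - q\<^sup>2) * g s k\<close>.
\<close>

definition V :: "nat \<Rightarrow> nat \<Rightarrow> real" where
  "V E k = (if even E then r * G (S E) k else - (1 - r) * G (S E) k - q * g (S E) k)"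

definition I :: "nat \<Rightarrow> nat \<Rightarrow> bool \<Rightarrow> real" where
  "I E k \<epsilon> = V (E + of_bool \<epsilon>) (Suc k) - V E k + flip_term a G E k \<epsilon>"

text \<open>The analogue of \<open>X\<close> for a state of the path. The subtraction of 2 is real,
  so states with \<open>k < 2\<close> are covered.\<close>

definition \<xi> :: "nat \<Rightarrow> nat \<Rightarrow> real" where
  "\<xi> E k = real (S E) * real K - (real k - 2) * real R"

definition W :: "nat \<Rightarrow> nat \<Rightarrow> bool" where "W E k \<longleftrightarrow> \<bar>\<xi> E k\<bar> \<le> D"

lemma r: "0 < r" "r < 1" "1 - r = q * r" "r * (1 - q\<^sup>2) = 1 - q"
  using q by (auto simp: r_def field_simps power2_eq_square)

lemma \<kappa>_pos: "0 < \<kappa>"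
  using \<eta> A D(1) by (simp add: \<kappa>_def)

lemma \<kappa>_small: "24 * \<kappa> \<le> 1"
  using D(3) \<eta> A by (simp add: \<kappa>_def field_simps)

lemma \<tau>_nonneg: "0 \<le> \<tau>"
  using A by (simp add: \<tau>_def)

lemma G_nonneg: "0 \<le> G s k"
  by (simp add: G_def split_count_def)

lemma G_eq: "2 \<le> k \<Longrightarrow> k \<le> L \<Longrightarrow> G s k = hyp R K s (k - 2)"
proof -
  assume "2 \<le> k" "k \<le> L"
  moreover from this have "L - k = K - (k - 2)" by (simp add: K_def)
  ultimately show ?thesis by (simp add: G_def split_count_def hyp_def)
qed

lemma G_eq_0: "\<not> (2 \<le> k \<and> k \<le> L) \<Longrightarrow> G s k = 0"
  by (auto simp: G_def split_count_def)

lemma S_bounds: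
  assumes "E \<le> L"
  shows "a \<le> S E + 1" "S E \<le> a + L div 2" "S E < R" "0 < S E"
  using assms a sR by (auto simp: S_def)

lemma hyp_window_S:
  assumes "E \<le> L"
  shows "hyp_window R K (S E) A \<eta> D (1 - q\<^sup>2)"
proof
  show "0 \<le> 1 - q\<^sup>2" "1 - q\<^sup>2 \<le> 1" using q power_le_one[of q 2] by auto
  show "K \<le> R" using KR by (simp add: K_def)
  show "\<bar>(1 - q\<^sup>2) * real R - real K\<bar> * A\<^sup>2 \<le> D * real R" using c by (simp add: K_def)
  show "\<eta> * A \<le> real j \<and> \<eta> * A \<le> real (S E) - real j \<and> \<eta> * A \<le> real K - real j \<and>
       \<eta> * A \<le> real R - real (S E) - real K + real j"
    if "\<bar>real (S E) * real K - real j * real R\<bar> \<le> 5 * D" for j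
    using bulk[of "S E" j] that S_bounds[OF assms] by (simp add: K_def)
qed (use \<eta> A R D S_bounds[OF assms] in auto)

lemma window_estimates:
  assumes "E \<le> L" "W E k"
  shows "\<And>i. i \<le> 1 \<Longrightarrow> \<bar>g (S E) (k + i)\<bar> \<le> 144 * \<kappa>\<^sup>2"
    "\<And>i. i \<le> 1 \<Longrightarrow> \<bar>g (S E) (Suc (k + i)) - g (S E) (k + i)\<bar> \<le> 6000 * \<kappa> ^ 3"
    "\<And>i. i \<le> 2 \<Longrightarrow> \<bar>(G (Suc (S E)) (k + i) - G (S E) (k + i)) + (1 - q\<^sup>2) * g (S E) (k + i)\<bar>
        \<le> 6000 * \<kappa> ^ 3"
proof -
  interpret win: hyp_window R K "S E" A \<eta> D "1 - q\<^sup>2"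
    by (rule hyp_window_S[OF assms(1)])
  have \<eta>A: "0 < \<eta> * A" using \<eta> A by simp
  \<comment> \<open>Otherwise the index 0 would lie in the window too, but there \<open>bulk\<close>
    demands a positive index.\<close>
  have k: "2 \<le> k"
  proof (rule ccontr)
    assume "\<not> 2 \<le> k"
    then have "0 \<le> (2 - real k) * real R" by simp
    then have "\<bar>win.X 0\<bar> \<le> \<bar>\<xi> E k\<bar>" by (simp add: win.X_def \<xi>_def algebra_simps)
    then have "\<bar>win.X 0\<bar> \<le> 5 * D" using assms(2) D A unfolding W_def by linarith
    from win.bulk'(1)[OF this] show False using \<eta>A by simp
  qed
  define j where "j = k - 2"
  have kj: "k = j + 2" using k by (simp add: j_def)
  have X: "win.X (j + i) = \<xi> E k - real i * real R" for i
    by (simp add: win.X_def \<xi>_def kj algebra_simps)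
  have w: "\<bar>win.X (j + i)\<bar> \<le> 4 * D" if "i \<le> 3" for i
  proof -
    have "real i * real R \<le> 3 * (5 * A)" using that R by (intro mult_mono) auto
    moreover have "0 \<le> real i * real R" by simp
    ultimately show ?thesis using assms(2) D A X[of i] unfolding W_def by linarith
  qed
  have Geq: "G s (k + i) = hyp R K s (j + i)" if "i \<le> 3" for s i
  proof -
    have "\<bar>win.X (j + i)\<bar> \<le> 5 * D" using w[OF that] D A by linarith
    then have "j + i < K" by (rule win.in_range)
    then show ?thesis using G_eq[of "k + i" s] by (simp add: kj K_def)
  qed
  have geq: "g (S E) (k + i) = hyp R K (S E) (Suc (j + i)) - hyp R K (S E) (j + i)" if "i \<le> 2" for i
    using Geq[of i] Geq[of "Suc i"] that by (simp add: g_def)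
  have \<kappa>': "win.\<kappa> = \<kappa>" by (simp add: \<kappa>_def win.\<kappa>_def)
  show "\<bar>g (S E) (k + i)\<bar> \<le> 144 * \<kappa> ^ 2" if "i \<le> 1" for i
    using win.abs_diff_h[OF w[of i]] that geq[of i] \<kappa>' by simp
  show "\<bar>g (S E) (Suc (k + i)) - g (S E) (k + i)\<bar> \<le> 6000 * \<kappa> ^ 3" if "i \<le> 1" for i
    using win.abs_diff2_h[OF w[of i]] w[of "Suc i"] that geq[of i] geq[of "Suc i"] \<kappa>' by simp
  show "\<bar>(G (Suc (S E)) (k + i) - G (S E) (k + i)) + (1 - q\<^sup>2) * g (S E) (k + i)\<bar>
        \<le> 6000 * \<kappa> ^ 3" if "i \<le> 2" for i
    using win.abs_transport_h[OF w[of i]] that geq[of i] Geq[of i] \<kappa>' by simp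
qed

text \<open>The allowed shifts of \<open>s\<close> and \<open>k\<close> change \<open>\<xi>\<close>
  by at most \<open>2 * R \<le> D / 2\<close>, so \<open>hyp_le_exp\<close> applies at distance
  \<open>D / 2\<close>; \<open>R\<close> and \<open>s\<close> are at most \<open>5 * A\<close>,
  which gives the constant 250.\<close>

lemma tail_estimate:
  assumes "E \<le> L" "\<not> W E k" "s = S E \<or> s = Suc (S E)" "k \<le> k'" "k' \<le> k + 2"
  shows "G s k' \<le> \<tau>"
proof (cases "2 \<le> k' \<and> k' \<le> L")
  case False
  then show ?thesis using \<tau>_nonneg by (simp add: G_eq_0)
next
  case True
  note Sb = S_bounds[OF assms(1)]
  have s: "0 < s" "s \<le> R" using Sb assms(3) by auto
  have R0: "0 < real R" using s by simp
  define x where "x = real s * real K - real (k' - 2) * real R"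
  have "x = \<xi> E k + (real s - real (S E)) * real K - real (k' - k) * real R"
    using True assms(4) by (simp add: x_def \<xi>_def of_nat_diff algebra_simps)
  moreover have "0 \<le> (real s - real (S E)) * real K" "(real s - real (S E)) * real K \<le> real R"
    using assms(3) KR by (auto simp: K_def)
  moreover have "0 \<le> real (k' - k) * real R" "real (k' - k) * real R \<le> 2 * real R"
    using assms(4,5) by (auto intro!: mult_right_mono)
  ultimately have "D / 2 \<le> \<bar>x\<bar>"
    using assms(2) D A R unfolding W_def by linarith
  then have x2: "(D / 2)\<^sup>2 \<le> x\<^sup>2" using D A by (auto intro: power2_le_iff_abs_le[THEN iffD2] simp: abs_le_square_iff[symmetric])
  have "G s k' = hyp R K s (k' - 2)" using True by (simp add: G_eq)
  also have "\<dots> \<le> 2 * (real R + 1) * exp (- 2 * (x / real R)\<^sup>2 / real s)"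
    unfolding x_def by (rule hyp_le_exp) (use s KR True in \<open>auto simp: K_def\<close>)
  also have "\<dots> \<le> 2 * (5 * A + 1) * exp (- (D\<^sup>2 / (250 * A ^ 3)))"
  proof (intro mult_mono)
    have "(real R)\<^sup>2 * real s \<le> (5 * A)\<^sup>2 * (5 * A)"
      using R s by (intro mult_mono power_mono) auto
    then have "(real R)\<^sup>2 * real s \<le> 125 * A ^ 3" by (simp add: eval_nat_numeral)
    then have "2 * (D / 2)\<^sup>2 / (125 * A ^ 3) \<le> 2 * x\<^sup>2 / ((real R)\<^sup>2 * real s)"
      using x2 R0 s by (intro frac_le) auto
    moreover have "2 * (D / 2)\<^sup>2 / (125 * A ^ 3) = D\<^sup>2 / (250 * A ^ 3)"
      by (simp add: power2_eq_square)
    moreover have "- 2 * (x / real R)\<^sup>2 / real s = - (2 * x\<^sup>2 / ((real R)\<^sup>2 * real s))"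
      by (simp add: power_divide)
    ultimately show "exp (- 2 * (x / real R)\<^sup>2 / real s) \<le> exp (- (D\<^sup>2 / (250 * A ^ 3)))"
      by simp
  qed (use R A in auto)
  finally show ?thesis by (simp add: \<tau>_def)
qed

lemma S_Suc: "S (Suc E) = (if even E then Suc (S E) else S E)"
  using a by (auto simp: S_def elim!: evenE oddE)

lemma I_odd:
  assumes "odd E"
  shows "I E k False = - (1 - r) * g (S E) k - q * (g (S E) (Suc k) - g (S E) k)"
    "I E k True = - (1 - r) * g (S E) k + q * g (S E) k"
proof -
  have S: "a + E div 2 = S E" using assms a by (auto simp: S_def elim!: oddE)
  show "I E k False = - (1 - r) * g (S E) k - q * (g (S E) (Suc k) - g (S E) k)"
    using assms by (simp add: I_def V_def flip_term_def g_def algebra_simps)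
  show "I E k True = - (1 - r) * g (S E) k + q * g (S E) k"
    using assms S by (simp add: I_def V_def flip_term_def g_def S_Suc algebra_simps)
qed

lemma I_even:
  assumes "even E"
  shows "I E k False = r * g (S E) k"
    "I E k True = r * (G (Suc (S E)) (Suc k) - G (S E) k) - q * g (Suc (S E)) (Suc k)"
proof -
  have S: "a + E div 2 = Suc (S E)" using assms a by (auto simp: S_def elim!: evenE)
  show "I E k False = r * g (S E) k"
    using assms by (simp add: I_def V_def flip_term_def g_def algebra_simps)
  show "I E k True = r * (G (Suc (S E)) (Suc k) - G (S E) k) - q * g (Suc (S E)) (Suc k)"
    using assms S by (simp add: I_def V_def flip_term_def g_def S_Suc algebra_simps)
qed

text \<open>The error in replacing a step in \<open>s\<close> by \<open>- (1 - q\<^sup>2)\<close>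
  times a step in \<open>k\<close>; of order \<open>\<kappa> ^ 3\<close> in the window by
  \<open>window_estimates\<close>.\<close>

definition v :: "nat \<Rightarrow> nat \<Rightarrow> real" where
  "v s k = (G (Suc s) k - G s k) + (1 - q\<^sup>2) * g s k"

text \<open>The coefficient of the first difference is \<open>r * q - (1 - r) = 0\<close>.\<close>

lemma mean_I_odd:
  assumes "odd E"
  shows "r * I E k True + (1 - r) * I E k False = - ((1 - r) * q) * (g (S E) (Suc k) - g (S E) k)"
  unfolding I_odd[OF assms] r(3) by (simp add: algebra_simps) (use r(3) in algebra)

lemma g_Suc_left: "g (Suc s) k = g s k + (v s (Suc k) - v s k) - (1 - q\<^sup>2) * (g s (Suc k) - g s k)"
  by (simp add: v_def g_def algebra_simps)

text \<open>With the steps in \<open>s\<close> rewritten through \<open>v\<close>,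
  \<open>g (S E) (Suc k)\<close> receives the coefficient
  \<open>- (r * (1 - q\<^sup>2) + q) = - 1\<close> and pairs with \<open>g (S E) k\<close>. Only
  second differences and \<open>v\<close> remain.\<close>

lemma mean_I_even:
  assumes "even E"
  shows "r * I E k True + (1 - r) * I E k False =
    r * (r * v (S E) (Suc k) - (g (S E) (Suc k) - g (S E) k)
      - q * ((v (S E) (Suc (Suc k)) - v (S E) (Suc k))
           - (1 - q\<^sup>2) * (g (S E) (Suc (Suc k)) - g (S E) (Suc k))))"
proof -
  let ?s = "S E"
  have G: "G (Suc ?s) (Suc k) - G ?s k = v ?s (Suc k) - (1 - q\<^sup>2) * g ?s (Suc k) + g ?s k"
    by (simp add: v_def g_def)
  have "r * I E k True + (1 - r) * I E k False =
    r * (r * (v ?s (Suc k) - (1 - q\<^sup>2) * g ?s (Suc k) + g ?s k)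
      - q * (g ?s (Suc k) + (v ?s (Suc (Suc k)) - v ?s (Suc k)) - (1 - q\<^sup>2) * (g ?s (Suc (Suc k)) - g ?s (Suc k))))
    + (1 - r) * (r * g ?s k)"
    unfolding I_even[OF assms] g_Suc_left[of ?s "Suc k"] G by simp
  also have "\<dots> = r * (r * v ?s (Suc k) - (r * (1 - q\<^sup>2) + q) * g ?s (Suc k) + g ?s k
      - q * ((v ?s (Suc (Suc k)) - v ?s (Suc k)) - (1 - q\<^sup>2) * (g ?s (Suc (Suc k)) - g ?s (Suc k))))"
    by (simp add: algebra_simps)
  finally show ?thesis unfolding r(4) by (simp add: algebra_simps)
qed

end

section \<open>Bounds for the increments and the second moment\<close>

context defect_walk
begin

definition B :: "nat \<Rightarrow> nat \<Rightarrow> real" where "B E k = 1500 * \<kappa>\<^sup>2 * of_bool (W E k) + 4 * \<tau>"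

definition M :: "nat \<Rightarrow> nat \<Rightarrow> real" where "M E k = 36000 * \<kappa> ^ 3 * of_bool (W E k) + 8 * \<tau>"

lemma cube_le: "6000 * \<kappa> ^ 3 \<le> 250 * \<kappa>\<^sup>2"
proof -
  have "\<kappa>\<^sup>2 * (24 * \<kappa>) \<le> \<kappa>\<^sup>2 * 1" using \<kappa>_small by (intro mult_left_mono) auto
  then show ?thesis by (simp add: power2_eq_square power3_eq_cube)
qed

lemma abs_scale_le: "0 \<le> x \<Longrightarrow> x \<le> 1 \<Longrightarrow> \<bar>x * y\<bar> \<le> \<bar>y\<bar>" for x y :: real
  by (simp add: abs_mult mult_left_le_one_le)

lemma abs_I_le:
  assumes "E \<le> k" "k < L"
  shows "\<bar>I E k \<epsilon>\<bar> \<le> B E k"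
proof -
  have EL: "E \<le> L" using assms by simp
  let ?s = "S E"
  have c1: "0 \<le> 1 - q\<^sup>2" "1 - q\<^sup>2 \<le> 1" using q power_le_one[of q 2] by auto
  have I: "\<bar>I E k \<epsilon>\<bar> \<le> \<bar>g ?s k\<bar> + \<bar>g ?s (Suc k) - g ?s k\<bar>" if "odd E"
  proof (cases \<epsilon>)
    case True
    have "I E k \<epsilon> = (q - (1 - r)) * g ?s k" using True I_odd[OF that] by (simp add: algebra_simps)
    moreover have "0 \<le> q - (1 - r)" "q - (1 - r) \<le> 1"
      using q r(1-3) mult_pos_pos[OF q(1) r(1)] mult_left_le[of r q] by linarith+
    ultimately show ?thesis using abs_scale_le[of "q - (1 - r)" "g ?s k"] by simp
  next
    case False
    have "\<bar>(1 - r) * g ?s k\<bar> \<le> \<bar>g ?s k\<bar>"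
      "\<bar>q * (g ?s (Suc k) - g ?s k)\<bar> \<le> \<bar>g ?s (Suc k) - g ?s k\<bar>"
      using q r by (intro abs_scale_le; simp)+
    moreover have "I E k \<epsilon> = - ((1 - r) * g ?s k) - q * (g ?s (Suc k) - g ?s k)"
      using False I_odd[OF that] by (simp add: left_diff_distrib)
    ultimately show ?thesis by linarith
  qed
  show ?thesis
  proof (cases "W E k")
    case True
    note w = window_estimates[OF EL True]
    have gk: "\<bar>g ?s k\<bar> \<le> 144 * \<kappa>\<^sup>2" "\<bar>g ?s (Suc k)\<bar> \<le> 144 * \<kappa>\<^sup>2"
      using w(1)[of 0] w(1)[of 1] by simp_all
    have g2: "\<bar>g ?s (Suc k) - g ?s k\<bar> \<le> 250 * \<kappa>\<^sup>2" "\<bar>g ?s (Suc (Suc k)) - g ?s (Suc k)\<bar> \<le> 250 * \<kappa>\<^sup>2"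
      using w(2)[of 0] w(2)[of 1] cube_le by simp_all
    have vk: "\<bar>v ?s (Suc k)\<bar> \<le> 250 * \<kappa>\<^sup>2" "\<bar>v ?s (Suc (Suc k))\<bar> \<le> 250 * \<kappa>\<^sup>2"
      using w(3)[of 1] w(3)[of 2] cube_le by (simp_all add: v_def numeral_2_eq_2)
    have "\<bar>I E k \<epsilon>\<bar> \<le> 1500 * \<kappa>\<^sup>2"
    proof (cases "even E")
      case False
      then show ?thesis using I gk g2 by fastforce
    next
      case even: True
      show ?thesis
      proof (cases \<epsilon>)
        case False
        then show ?thesis using I_even[OF even] gk abs_scale_le[of r "g ?s k"] r by simp
      next
        case True
        have "\<bar>(1 - q\<^sup>2) * g ?s (Suc k)\<bar> \<le> 144 * \<kappa>\<^sup>2"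
          using abs_scale_le[OF c1, of "g ?s (Suc k)"] gk by linarith
        moreover have "G (Suc ?s) (Suc k) - G ?s k = v ?s (Suc k) - (1 - q\<^sup>2) * g ?s (Suc k) + g ?s k"
          by (simp add: v_def g_def)
        ultimately have 1: "\<bar>G (Suc ?s) (Suc k) - G ?s k\<bar> \<le> 538 * \<kappa>\<^sup>2"
          using vk gk by linarith
        have "\<bar>(1 - q\<^sup>2) * (g ?s (Suc (Suc k)) - g ?s (Suc k))\<bar> \<le> 250 * \<kappa>\<^sup>2"
          using abs_scale_le[OF c1, of "g ?s (Suc (Suc k)) - g ?s (Suc k)"] g2 by linarith
        then have 2: "\<bar>g (Suc ?s) (Suc k)\<bar> \<le> 894 * \<kappa>\<^sup>2"
          unfolding g_Suc_left[of ?s "Suc k"] using vk gk by linarith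
        have "\<bar>r * (G (Suc ?s) (Suc k) - G ?s k)\<bar> \<le> 538 * \<kappa>\<^sup>2"
          using abs_scale_le[of r "G (Suc ?s) (Suc k) - G ?s k"] r 1 by linarith
        moreover have "\<bar>q * g (Suc ?s) (Suc k)\<bar> \<le> 894 * \<kappa>\<^sup>2"
          using abs_scale_le[of q "g (Suc ?s) (Suc k)"] q 2 by linarith
        moreover have "0 \<le> \<kappa>\<^sup>2" by simp
        ultimately show ?thesis using I_even(2)[OF even] True by simp
      qed
    qed
    then show ?thesis using \<tau>_nonneg True by (simp add: B_def)
  next
    case False
    have t: "G s k' \<le> \<tau>" if "s = ?s \<or> s = Suc ?s" "k \<le> k'" "k' \<le> k + 2" for s k'
      by (rule tail_estimate[OF EL False that])
    have gk: "\<bar>g s k'\<bar> \<le> \<tau>" if "s = ?s \<or> s = Suc ?s" "k \<le> k'" "k' \<le> k + 1" for s k'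
      using t[OF that(1), of k'] t[OF that(1), of "Suc k'"] that G_nonneg[of s k'] G_nonneg[of s "Suc k'"]
      by (simp add: g_def)
    have "\<bar>I E k \<epsilon>\<bar> \<le> 4 * \<tau>"
    proof (cases "even E")
      case False
      then show ?thesis using I gk[of ?s k] gk[of ?s "Suc k"] by fastforce
    next
      case even: True
      have "\<bar>r * (G (Suc ?s) (Suc k) - G ?s k)\<bar> \<le> \<tau>"
        using abs_scale_le[of r "G (Suc ?s) (Suc k) - G ?s k"] r t[of "Suc ?s" "Suc k"] t[of ?s k]
          G_nonneg[of "Suc ?s" "Suc k"] G_nonneg[of ?s k] by simp
      moreover have "\<bar>q * g (Suc ?s) (Suc k)\<bar> \<le> \<tau>" "\<bar>r * g ?s k\<bar> \<le> \<tau>"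
        using abs_scale_le[of q "g (Suc ?s) (Suc k)"] abs_scale_le[of r "g ?s k"]
          q r gk[of "Suc ?s" "Suc k"] gk[of ?s k] by simp_all
      ultimately show ?thesis using I_even[OF even, of k] \<tau>_nonneg by (cases \<epsilon>) auto
    qed
    then show ?thesis using False by (simp add: B_def)
  qed
qed

lemma abs_mean_I_le:
  assumes "E \<le> k" "k < L"
  shows "\<bar>r * I E k True + (1 - r) * I E k False\<bar> \<le> M E k"
proof (cases "W E k")
  case False
  have "\<bar>r * I E k True\<bar> \<le> 4 * \<tau>" "\<bar>(1 - r) * I E k False\<bar> \<le> 4 * \<tau>"
    using abs_I_le[OF assms, of True] abs_I_le[OF assms, of False] False r
      abs_scale_le[of r "I E k True"] abs_scale_le[of "1 - r" "I E k False"]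
    by (simp_all add: B_def)
  then show ?thesis using False by (simp add: M_def)
next
  case True
  have EL: "E \<le> L" using assms by simp
  let ?s = "S E"
  have c1: "0 \<le> 1 - q\<^sup>2" "1 - q\<^sup>2 \<le> 1" using q power_le_one[of q 2] by auto
  note w = window_estimates[OF EL True]
  have g2: "\<bar>g ?s (Suc k) - g ?s k\<bar> \<le> 6000 * \<kappa> ^ 3" "\<bar>g ?s (Suc (Suc k)) - g ?s (Suc k)\<bar> \<le> 6000 * \<kappa> ^ 3"
    using w(2)[of 0] w(2)[of 1] by simp_all
  have vk: "\<bar>v ?s (Suc k)\<bar> \<le> 6000 * \<kappa> ^ 3" "\<bar>v ?s (Suc (Suc k))\<bar> \<le> 6000 * \<kappa> ^ 3"
    using w(3)[of 1] w(3)[of 2] by (simp_all add: v_def numeral_2_eq_2)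
  have "\<bar>r * I E k True + (1 - r) * I E k False\<bar> \<le> 36000 * \<kappa> ^ 3"
  proof (cases "even E")
    case False
    have "0 \<le> (1 - r) * q" "(1 - r) * q \<le> 1" using r q by (auto intro!: mult_le_one)
    then have "\<bar>(1 - r) * q * (g ?s (Suc k) - g ?s k)\<bar> \<le> 6000 * \<kappa> ^ 3"
      using abs_scale_le[of "(1 - r) * q" "g ?s (Suc k) - g ?s k"] g2 by linarith
    then show ?thesis using mean_I_odd[OF False, of k] \<kappa>_pos by (simp add: zero_le_power)
  next
    case even: True
    let ?x = "(v ?s (Suc (Suc k)) - v ?s (Suc k)) - (1 - q\<^sup>2) * (g ?s (Suc (Suc k)) - g ?s (Suc k))"
    let ?y = "r * v ?s (Suc k) - (g ?s (Suc k) - g ?s k) - q * ?x"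
    have "\<bar>(1 - q\<^sup>2) * (g ?s (Suc (Suc k)) - g ?s (Suc k))\<bar> \<le> 6000 * \<kappa> ^ 3"
      using abs_scale_le[OF c1, of "g ?s (Suc (Suc k)) - g ?s (Suc k)"] g2 by linarith
    then have "\<bar>?x\<bar> \<le> 18000 * \<kappa> ^ 3" using vk by linarith
    then have "\<bar>q * ?x\<bar> \<le> 18000 * \<kappa> ^ 3" using abs_scale_le[of q ?x] q by linarith
    moreover have "\<bar>r * v ?s (Suc k)\<bar> \<le> 6000 * \<kappa> ^ 3"
      using abs_scale_le[of r "v ?s (Suc k)"] r vk by linarith
    ultimately have "\<bar>?y\<bar> \<le> 30000 * \<kappa> ^ 3" using g2 by linarith
    moreover have "\<bar>r * ?y\<bar> \<le> \<bar>?y\<bar>" using abs_scale_le[of r ?y] r by simp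
    moreover have "0 \<le> \<kappa> ^ 3" using \<kappa>_pos by simp
    ultimately have "\<bar>r * ?y\<bar> \<le> 36000 * \<kappa> ^ 3" by linarith
    then show ?thesis unfolding mean_I_even[OF even] .
  qed
  then show ?thesis using True \<tau>_nonneg by (simp add: M_def)
qed

text \<open>Every bit lowers \<open>\<xi>\<close> by \<open>R\<close>, whereas flips raise
  \<open>S\<close> by at most one per two bits and hence \<open>\<xi>\<close> by at most
  \<open>K / 2 \<le> R / 2\<close> per bit, up to rounding. So \<open>\<xi>\<close> falls by about
  \<open>A / 2\<close> or more per bit and leaves the window of width \<open>2 * D\<close> after
  \<open>4 * D / A\<close> bits, plus one for the rounding.\<close>

lemma window_length:
  assumes "W E0 k0" "W E k" "E0 \<le> E" "E - E0 \<le> k - k0" "k0 \<le> k"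
  shows "k \<le> k0 + (nat \<lceil>4 * D / A\<rceil> + 1)"
proof -
  have "2 * real (S E) \<le> 2 * real (S E0) + real (k - k0) + 1"
  proof -
    have "2 * S E \<le> 2 * S E0 + (E - E0) + 1" using assms(3) a by (simp add: S_def)
    then have "2 * S E \<le> 2 * S E0 + (k - k0) + 1" using assms(4) by linarith
    then show ?thesis by linarith
  qed
  then have "2 * (real (S E) - real (S E0)) * real K \<le> (real (k - k0) + 1) * real R"
  proof (cases "0 \<le> real (S E) - real (S E0)")
    case True
    then show ?thesis using \<open>2 * real (S E) \<le> _\<close> KR by (intro mult_mono) (auto simp: K_def)
  next
    case False
    then have "2 * (real (S E) - real (S E0)) * real K \<le> 0" by (simp add: mult_nonpos_nonneg)
    also have "0 \<le> (real (k - k0) + 1) * real R" by simp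
    finally show ?thesis .
  qed
  moreover have "\<xi> E0 k0 - \<xi> E k = real (k - k0) * real R - (real (S E) - real (S E0)) * real K"
    using assms(5) by (simp add: \<xi>_def of_nat_diff algebra_simps)
  moreover have "\<xi> E0 k0 - \<xi> E k \<le> 2 * D" using assms(1,2) unfolding W_def by linarith
  ultimately have "(real (k - k0) - 1) * real R \<le> 4 * D"
    by (simp add: algebra_simps)
  moreover have "(real (k - k0) - 1) * A \<le> max 0 ((real (k - k0) - 1) * real R)"
  proof (cases "real (k - k0) - 1 \<le> 0")
    case True
    then have "(real (k - k0) - 1) * A \<le> 0" using A by (intro mult_nonpos_nonneg) auto
    then show ?thesis by simp
  next
    case False
    then have "(real (k - k0) - 1) * A \<le> (real (k - k0) - 1) * real R"
      using aA by (intro mult_left_mono) auto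
    then show ?thesis by simp
  qed
  ultimately have "(real (k - k0) - 1) * A \<le> 4 * D"
    using A D(1) by linarith
  then have "real (k - k0) - 1 \<le> 4 * D / A" using A by (simp add: pos_le_divide_eq)
  then have "real (k - k0) \<le> real (nat \<lceil>4 * D / A\<rceil> + 1)" by linarith
  then show ?thesis using assms(5) by linarith
qed

lemma path_sum_W: "path_sum (\<lambda>E k \<epsilon>. of_bool (W E k)) 0 0 c u \<le> 5 * D / A"
proof -
  have "path_sum (\<lambda>E k \<epsilon>. of_bool (W E k)) 0 0 c u \<le> real (nat \<lceil>4 * D / A\<rceil> + 1 + 1)"
    by (rule path_sum_window) (rule window_length)
  also have "\<dots> \<le> 4 * D / A + 3"
  proof -
    have "0 \<le> 4 * D / A" using A D(1) by simp
    then show ?thesis by linarith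
  qed
  also have "\<dots> \<le> 5 * D / A" using A D(1) by (simp add: field_simps)
  finally show ?thesis .
qed

lemma V_0: "V 0 0 = 0"
  by (simp add: V_def G_eq_0)

text \<open>At \<open>k = L\<close> the cell \<open>K - j\<close> is empty, which
  \<open>bulk\<close> excludes inside the window; so the end of every path is in the tail.\<close>

lemma abs_V_end_le:
  assumes "e \<le> L"
  shows "\<bar>V e L\<bar> \<le> 2 * \<tau>"
proof -
  have nW: "\<not> W e L"
  proof
    assume "W e L"
    then have "\<bar>real (S e) * real (L - 2) - real (L - 2) * real R\<bar> \<le> 5 * D"
      using L D(1) A by (simp add: W_def \<xi>_def K_def of_nat_diff)
    with bulk[of "S e" "L - 2"] S_bounds[OF assms] have "\<eta> * A \<le> real (L - 2) - real (L - 2)" by blast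
    then show False using \<eta> A by (simp add: mult_le_0_iff)
  qed
  have G: "G (S e) L \<le> \<tau>" "0 \<le> G (S e) L"
    using tail_estimate[OF assms nW, of "S e" L] G_nonneg by auto
  have g: "g (S e) L = - G (S e) L" by (simp add: g_def G_eq_0)
  have "\<bar>r * G (S e) L\<bar> \<le> \<tau>" "\<bar>(1 - r) * G (S e) L\<bar> \<le> \<tau>" "\<bar>q * G (S e) L\<bar> \<le> \<tau>"
    using abs_scale_le[of r "G (S e) L"] abs_scale_le[of "1 - r" "G (S e) L"] abs_scale_le[of q "G (S e) L"] G r q
    by simp_all
  moreover have "even e \<Longrightarrow> V e L = r * G (S e) L" "odd e \<Longrightarrow> V e L = q * G (S e) L - (1 - r) * G (S e) L"
    by (simp_all add: V_def g algebra_simps)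
  ultimately show ?thesis using \<tau>_nonneg by (cases "even e") linarith+
qed

text \<open>By \<open>path_sum_telescope\<close> the alternating sum differs from
  \<open>path_sum I\<close> only by the final value of \<open>V\<close>. The leading term is the
  squared increment, of order \<open>\<kappa> ^ 4\<close>, times the window length
  \<open>5 * D / A\<close>.\<close>

theorem second_moment_le:
  "(\<Sum>u\<in>bitstrings L. path_weight r True u * (path_sum (flip_term a G) 0 0 True u)\<^sup>2)
     \<le> 16 * (4500000 * \<kappa> ^ 4 * (5 * D / A) + 32 * \<tau>\<^sup>2 * real L)
       + 4 * (36000 * \<kappa> ^ 3 * (5 * D / A) + 8 * \<tau> * real L)\<^sup>2 + 8 * \<tau>\<^sup>2"
proof -
  let ?E = "\<lambda>F. \<Sum>u\<in>bitstrings L. path_weight r True u * F u"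
  define \<beta> where "\<beta> = 4500000 * \<kappa> ^ 4 * (5 * D / A) + 32 * \<tau>\<^sup>2 * real L"
  define \<mu> where "\<mu> = 36000 * \<kappa> ^ 3 * (5 * D / A) + 8 * \<tau> * real L"
  have I2: "?E (\<lambda>u. (path_sum I 0 0 True u)\<^sup>2) \<le> 8 * \<beta> + 2 * \<mu>\<^sup>2"
  proof (rule path_sum_second_moment_bound[where B = B and M = M])
    show "path_sum (\<lambda>E k \<epsilon>. (B E k)\<^sup>2) 0 0 True u \<le> \<beta>" if "length u = L" for u
    proof -
      have "(B E k)\<^sup>2 \<le> 4500000 * \<kappa> ^ 4 * of_bool (W E k) + 32 * \<tau>\<^sup>2" for E k
      proof -
        have "(x + y)\<^sup>2 \<le> 2 * x\<^sup>2 + 2 * y\<^sup>2" for x y :: real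
          using sum_squares_bound[of x y] by (simp add: power2_sum)
        from this[of "1500 * \<kappa>\<^sup>2 * of_bool (W E k)" "4 * \<tau>"] show ?thesis
          by (cases "W E k") (simp_all add: B_def power_mult_distrib)
      qed
      then have "path_sum (\<lambda>E k \<epsilon>. (B E k)\<^sup>2) 0 0 True u \<le>
        path_sum (\<lambda>E k \<epsilon>. 4500000 * \<kappa> ^ 4 * of_bool (W E k) + 32 * \<tau>\<^sup>2) 0 0 True u"
        using that by (intro path_sum_mono[where L = L]) auto
      also have "\<dots> = 4500000 * \<kappa> ^ 4 * path_sum (\<lambda>E k \<epsilon>. of_bool (W E k)) 0 0 True u + 32 * \<tau>\<^sup>2 * real L"
        using that by (simp add: path_sum_add path_sum_cmult path_sum_const)
      also have "\<dots> \<le> \<beta>"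
        unfolding \<beta>_def by (intro add_right_mono mult_left_mono path_sum_W) simp
      finally show ?thesis .
    qed
    show "path_sum (\<lambda>E k \<epsilon>. M E k) 0 0 True u \<le> \<mu>" if "length u = L" for u
    proof -
      have "path_sum (\<lambda>E k \<epsilon>. M E k) 0 0 True u =
        36000 * \<kappa> ^ 3 * path_sum (\<lambda>E k \<epsilon>. of_bool (W E k)) 0 0 True u + 8 * \<tau> * real L"
        using that unfolding M_def by (simp add: path_sum_add path_sum_cmult path_sum_const)
      also have "\<dots> \<le> \<mu>"
        unfolding \<mu>_def using \<kappa>_pos by (intro add_right_mono mult_left_mono path_sum_W) simp
      finally show ?thesis .
    qed
  qed (use r abs_I_le abs_mean_I_le in auto)
  have w: "0 \<le> path_weight r True u" for u by (rule path_weight_nonneg) (use r in auto)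
  have "(path_sum (flip_term a G) 0 0 True u)\<^sup>2 \<le> 2 * (path_sum I 0 0 True u)\<^sup>2 + 8 * \<tau>\<^sup>2"
    if "length u = L" for u
  proof -
    have "I = (\<lambda>E k \<epsilon>. (V (E + of_bool \<epsilon>) (Suc k) - V E k) + flip_term a G E k \<epsilon>)"
      by (simp add: I_def fun_eq_iff)
    then have "path_sum I 0 0 True u = V (0 + flips True u) (0 + length u) - V 0 0 + path_sum (flip_term a G) 0 0 True u"
      by (simp only: path_sum_add path_sum_telescope)
    then have eq: "path_sum (flip_term a G) 0 0 True u = path_sum I 0 0 True u - V (flips True u) L"
      using that V_0 by simp
    have "\<bar>V (flips True u) L\<bar> \<le> 2 * \<tau>" using abs_V_end_le flips_le[of True u] that by simp
    then have "(V (flips True u) L)\<^sup>2 \<le> (2 * \<tau>)\<^sup>2"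
      using \<tau>_nonneg power2_le_iff_abs_le[of "2 * \<tau>" "V (flips True u) L"] by linarith
    have "(x - y)\<^sup>2 \<le> 2 * x\<^sup>2 + 2 * y\<^sup>2" for x y :: real
    proof -
      have "0 \<le> (x + y)\<^sup>2" by simp
      then show ?thesis by (simp add: power2_eq_square algebra_simps)
    qed
    from this[of "path_sum I 0 0 True u" "V (flips True u) L"] show ?thesis
      unfolding eq using \<open>(V (flips True u) L)\<^sup>2 \<le> (2 * \<tau>)\<^sup>2\<close> by (simp add: power_mult_distrib)
  qed
  then have "?E (\<lambda>u. (path_sum (flip_term a G) 0 0 True u)\<^sup>2)
    \<le> ?E (\<lambda>u. 2 * (path_sum I 0 0 True u)\<^sup>2 + 8 * \<tau>\<^sup>2)"
    by (intro sum_mono mult_left_mono w) (auto simp: bitstrings_def)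
  also have "\<dots> = 2 * ?E (\<lambda>u. (path_sum I 0 0 True u)\<^sup>2)
     + 8 * \<tau>\<^sup>2 * (\<Sum>u\<in>bitstrings L. path_weight r True u)"
    by (simp add: distrib_left sum.distrib sum_distrib_left sum_distrib_right mult_ac)
  also have "\<dots> \<le> 2 * (8 * \<beta> + 2 * \<mu>\<^sup>2) + 8 * \<tau>\<^sup>2"
    using I2 by (simp add: sum_path_weight)
  finally show ?thesis unfolding \<beta>_def[symmetric] \<mu>_def[symmetric] by simp
qed

end

section \<open>Two strings with close trace laws\<close>

text \<open>The inserted \<open>True\<close> stands apart from the alternating pieces so that
  \<open>trace_prob_insert\<close> applies. It sits after one third of the block; bit
  \<open>L\<close> of the trace typically stems from a position near \<open>4 * a\<close>, halfway
  between the defect and the end.\<close>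

definition str_x :: "nat \<Rightarrow> bool list" where
  "str_x a = alt False (2 * a) @ True # alt False (4 * a + 1)"

definition str_y :: "nat \<Rightarrow> bool list" where
  "str_y a = alt False (2 * a + 1) @ True # alt True (4 * a)"

lemma length_str [simp]: "length (str_x a) = 6 * a + 2" "length (str_y a) = 6 * a + 2"
  by (simp_all add: str_x_def str_y_def)

lemma take_alt: "k \<le> n \<Longrightarrow> take k (alt c n) = alt c k"
proof (induction k arbitrary: c n)
  case (Suc k)
  then show ?case by (cases n) auto
qed simp

text \<open>A prefix that contains the defect has the shape of the whole string with a shorter tail,
  so \<open>trace_prob_defect_diff\<close> applies to each of them.\<close>

lemma take_str:
  assumes "2 * a + 2 \<le> t" "t \<le> 6 * a + 2"
  shows "take t (str_x a) = alt False (2 * a) @ True # alt False (t - 2 * a - 1)"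
    "take t (str_y a) = alt False (2 * a + 1) @ True # alt True (t - 2 * a - 1 - 1)"
proof -
  obtain k where t: "t = 2 * a + 2 + k" using assms(1) le_Suc_ex by blast
  then show "take t (str_x a) = alt False (2 * a) @ True # alt False (t - 2 * a - 1)"
    using assms(2) by (simp add: str_x_def take_Cons' take_alt del: alt.simps)
  show "take t (str_y a) = alt False (2 * a + 1) @ True # alt True (t - 2 * a - 1 - 1)"
    using assms(2) t by (simp add: str_y_def take_Cons' take_alt del: alt.simps)
qed

lemma str_suffix:
  assumes "2 * a + 2 \<le> t"
  shows "str_x a ! t = str_y a ! t" "drop (Suc t) (str_x a) = drop (Suc t) (str_y a)"
proof -
  have x: "str_x a = (alt False (2 * a) @ [True, False]) @ alt True (4 * a)"
    by (simp add: str_x_def)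
  have y: "str_y a = (alt False (2 * a + 1) @ [True]) @ alt True (4 * a)"
    by (simp only: str_y_def append_assoc append.simps)
  obtain k where t: "t = 2 * a + 2 + k" using assms le_Suc_ex by blast
  show "str_x a ! t = str_y a ! t" "drop (Suc t) (str_x a) = drop (Suc t) (str_y a)"
    unfolding x y t by (simp_all add: nth_append numeral_3_eq_3 del: alt.simps)
qed

definition flip_count_sum :: "nat \<Rightarrow> nat \<Rightarrow> nat \<Rightarrow> bool list \<Rightarrow> real" where
  "flip_count_sum a L R v = path_sum (flip_term a (split_count R L)) 0 0 True v"

lemma abs_path_sum_flip_term_le:
  assumes "\<And>E k. E < e \<Longrightarrow> \<bar>G (a + E div 2) k\<bar> \<le> C" "E + flips c u \<le> e" "0 \<le> C"
  shows "\<bar>path_sum (flip_term a G) E k c u\<bar> \<le> C * real (length u)"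
  using assms(2)
proof (induction u arbitrary: E k c)
  case (Cons b u)
  have "\<bar>path_sum (flip_term a G) (E + of_bool (b \<noteq> c)) (Suc k) b u\<bar> \<le> C * real (length u)"
    by (rule Cons.IH) (use Cons.prems in auto)
  moreover have "\<bar>flip_term a G E k (b \<noteq> c)\<bar> \<le> C"
    using assms(1)[of E "Suc k"] assms(3) Cons.prems by (auto simp: flip_term_def)
  ultimately show ?case by (simp add: distrib_left)
qed simp

text \<open>A single term of Vandermonde's sum.\<close>

lemma abs_split_count_le:
  assumes "s \<le> R"
  shows "\<bar>split_count R L s k\<bar> \<le> real (R choose (L - 2))"
proof (cases "2 \<le> k \<and> k \<le> L")
  case True
  have "(s choose (k - 2)) * (R - s choose (L - k)) = (s choose (k - 2)) * (R - s choose (L - 2 - (k - 2)))"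
  proof -
    have "L - k = L - 2 - (k - 2)" using True by linarith
    then show ?thesis by simp
  qed
  also have "\<dots> \<le> (\<Sum>j\<le>L - 2. (s choose j) * (R - s choose (L - 2 - j)))"
    using True by (intro member_le_sum) auto
  also have "\<dots> = R choose (L - 2)" using vandermonde[of s "R - s" "L - 2"] assms by simp
  finally show ?thesis using True by (simp add: split_count_def flip: of_nat_mult)
qed (auto simp: split_count_def)

text \<open>At most two values of \<open>t\<close> share the same half.\<close>

lemma sum_halves_le:
  fixes F :: "nat \<Rightarrow> real"
  assumes "\<And>i. 0 \<le> F i" "finite T" "\<And>t. t \<in> T \<Longrightarrow> (t + e) div 2 \<in> B" "finite B"
  shows "(\<Sum>t\<in>T. F ((t + e) div 2)) \<le> 2 * sum F B"
proof -
  have "(\<Sum>t\<in>T. F ((t + e) div 2)) = (\<Sum>i\<in>B. \<Sum>t\<in>{t \<in> T. (t + e) div 2 = i}. F ((t + e) div 2))"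
    using assms by (intro sum.group[symmetric]) auto
  also have "\<dots> = (\<Sum>i\<in>B. real (card {t \<in> T. (t + e) div 2 = i}) * F i)"
    by (intro sum.cong refl) simp
  also have "\<dots> \<le> (\<Sum>i\<in>B. 2 * F i)"
  proof (intro sum_mono mult_right_mono assms(1))
    fix i
    have "{t \<in> T. (t + e) div 2 = i} \<subseteq> {2 * i - e, 2 * i + 1 - e}"
      by (auto simp: le_antisym)
    then have "card {t \<in> T. (t + e) div 2 = i} \<le> card {2 * i - e, 2 * i + 1 - e}"
      by (intro card_mono) auto
    also have "\<dots> \<le> 2" by (simp add: card_insert_if)
    finally show "real (card {t \<in> T. (t + e) div 2 = i}) \<le> 2" by simp
  qed
  finally show ?thesis by (simp add: sum_distrib_left)
qed

text \<open>\<open>c\<close> times a summand is the probability that trial \<open>n + 1\<close> is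
  success number \<open>L + 1\<close>; for different \<open>n\<close> these events are
  disjoint.\<close>

lemma sum_binomial_pmf_upper_le:
  assumes "0 < c" "c \<le> 1"
  shows "(\<Sum>n\<le>N. pmf (binomial_pmf n c) L) \<le> 1 / c"
proof -
  have "(\<Sum>n\<le>N. c * pmf (binomial_pmf n c) L) = (\<Sum>n\<in>{L..N}. c * pmf (binomial_pmf n c) L)"
    using assms by (intro sum.mono_neutral_right) (auto simp: not_le binomial_eq_0)
  also have "\<dots> \<le> (\<Sum>n\<in>{L..N}. pmf (neg_binomial_pmf (Suc L) c) (n - L))"
  proof (intro sum_mono)
    fix n assume n: "n \<in> {L..N}"
    have "pmf (neg_binomial_pmf (Suc L) c) (n - L) = real (n - L + Suc L - 1 choose (n - L)) * c ^ Suc L * (1 - c) ^ (n - L)"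
      using assms by (subst pmf_neg_binomial) auto
    also have "n - L + Suc L - 1 = n" using n by auto
    also have "n choose (n - L) = n choose L" using n by (intro binomial_symmetric[symmetric]) auto
    finally show "c * pmf (binomial_pmf n c) L \<le> pmf (neg_binomial_pmf (Suc L) c) (n - L)"
      using assms by (simp add: mult_ac)
  qed
  also have "\<dots> = (\<Sum>k\<in>(\<lambda>n. n - L) ` {L..N}. pmf (neg_binomial_pmf (Suc L) c) k)"
    by (subst sum.reindex) (auto simp: inj_on_def)
  also have "\<dots> = measure_pmf.prob (neg_binomial_pmf (Suc L) c) ((\<lambda>n. n - L) ` {L..N})"
    by (subst measure_measure_pmf_finite) auto
  also have "\<dots> \<le> 1" by simp
  finally have "c * (\<Sum>n\<le>N. pmf (binomial_pmf n c) L) \<le> 1" by (simp add: sum_distrib_left)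
  then show ?thesis using assms by (simp add: pos_le_divide_eq mult.commute)
qed

text \<open>Only the event that the inserted bit is deleted is kept.\<close>

lemma trace_prob_str_lower:
  fixes q :: real and a n :: nat and v :: "bool list"
  assumes "0 < q" "q < 1" "1 \<le> n"
  defines "w \<equiv> q ^ (2 * a + 1 + n) * ((1 - q) / q) ^ length v
      * real ((2 * a + n + flips True v) div 2 choose length v)"
  shows "w \<le> trace_prob q (alt False (2 * a) @ True # alt False n) v"
    "w \<le> trace_prob q (alt False (2 * a + 1) @ True # alt True (n - 1)) v"
proof -
  have base: "alt False (2 * a) @ alt False n = alt False (2 * a + n)"
    "alt False (2 * a + 1) @ alt True (n - 1) = alt False (2 * a + n)"
    using alt_append[of False "2 * a" n] alt_append[of False "2 * a + 1" "n - 1"] assms(3) by auto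
  have nn: "0 \<le> (1 - q) * (\<Sum>k | k < length v \<and> v ! k = b.
      trace_prob q X (take k v) * trace_prob q Y (drop (Suc k) v))" for X Y b
    using assms by (intro mult_nonneg_nonneg sum_nonneg trace_prob_nonneg) auto
  have w: "w = q * trace_prob q (alt False (2 * a + n)) v"
    using trace_prob_alt[OF assms(1), of False "2 * a + n" v] by (simp add: w_def mult_ac)
  show "w \<le> trace_prob q (alt False (2 * a) @ True # alt False n) v"
    "w \<le> trace_prob q (alt False (2 * a + 1) @ True # alt True (n - 1)) v"
    unfolding w trace_prob_insert base by (rule add_increasing2[OF nn order_refl])+
qed

lemma chi_le_of_lower:
  assumes "0 < w" "0 < C" "w * C \<le> x" "w * C \<le> y" "x - y = w * d"
  shows "chi x y \<le> w * (d\<^sup>2 / (2 * C))"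
proof -
  have "chi x y = (w * d)\<^sup>2 / (x + y)" using assms by (simp add: chi_def)
  also have "\<dots> \<le> (w * d)\<^sup>2 / (2 * (w * C))"
    using assms by (intro divide_left_mono mult_pos_pos) (auto intro: add_pos_pos mult_pos_pos less_le_trans[OF mult_pos_pos])
  also have "\<dots> = w * (d\<^sup>2 / (2 * C))" using assms by (simp add: power2_eq_square)
  finally show ?thesis .
qed

text \<open>For \<open>L \<le> n\<close> this is \<open>q\<close> times the probability of one fixed
  outcome of \<open>n\<close> trials of success probability \<open>1 - q\<^sup>2\<close> with
  \<open>L\<close> successes; the trials are the half gaps.\<close>

definition str_weight :: "real \<Rightarrow> nat \<Rightarrow> nat \<Rightarrow> real" where
  "str_weight q L n = q * (q\<^sup>2) ^ n * ((1 - q\<^sup>2) / q\<^sup>2) ^ L"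

text \<open>Factors the weight of a trace into a part that depends only on \<open>n\<close> and the
  law of independent flips. The loss comes from the rounding in \<open>n\<close> alone and is at
  most a factor \<open>1 / q\<close>.\<close>

lemma power_le_str_weight:
  assumes q: "0 < q" "q < 1" and n: "n = (s + flips True v) div 2" and v: "length v = L"
  shows "q ^ Suc s * ((1 - q) / q) ^ L \<le> str_weight q L n * path_weight (1 / (1 + q)) True v"
proof -
  let ?e = "flips True v"
  have "2 * n \<le> s + ?e" using n by simp
  then have "q ^ (s + ?e + 1) \<le> q ^ (2 * n + 1)"
    using q by (intro power_decreasing) auto
  moreover have "q ^ (2 * n + 1) = q * (q\<^sup>2) ^ n" by (simp add: power_mult)
  moreover have "q ^ (s + ?e + 1) = q ^ Suc s * q ^ ?e" by (simp add: power_add)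
  ultimately have "q ^ Suc s * q ^ ?e \<le> q * (q\<^sup>2) ^ n" by (simp only:)
  then have 1: "q ^ Suc s \<le> q * (q\<^sup>2) ^ n / q ^ ?e" using q by (simp add: pos_le_divide_eq)
  have "1 - q\<^sup>2 = (1 - q) * (1 + q)" by (simp add: power2_eq_square algebra_simps)
  then have "((1 - q\<^sup>2) / q\<^sup>2) ^ L * (q ^ L / (1 + q) ^ L) = ((1 - q) * (1 + q) / (q * q) * (q / (1 + q))) ^ L"
    by (simp add: power_mult_distrib power_divide power2_eq_square)
  also have "(1 - q) * (1 + q) / (q * q) * (q / (1 + q)) = (1 - q) / q"
    using q by (simp add: divide_simps)
  finally have 2: "((1 - q\<^sup>2) / q\<^sup>2) ^ L * (q ^ L / (1 + q) ^ L) = ((1 - q) / q) ^ L" .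
  have "q ^ Suc s * ((1 - q) / q) ^ L \<le> q * (q\<^sup>2) ^ n / q ^ ?e * ((1 - q) / q) ^ L"
    using 1 q by (intro mult_right_mono) auto
  also have "\<dots> = str_weight q L n * path_weight (1 / (1 + q)) True v"
    unfolding 2[symmetric] str_weight_def path_weight_eq[OF q(1)] v by simp
  finally show ?thesis .
qed

lemma str_weight_binomial:
  assumes "0 < q" "q < 1"
  shows "str_weight q L n * real (n choose L) = q * pmf (binomial_pmf n (1 - q\<^sup>2)) L"
proof (cases "L \<le> n")
  case True
  have c: "0 \<le> 1 - q\<^sup>2" "1 - q\<^sup>2 \<le> 1" using assms power_le_one[of q 2] by auto
  have "(q\<^sup>2) ^ n = (q\<^sup>2) ^ (n - L) * (q\<^sup>2) ^ L" using True by (simp flip: power_add)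
  then show ?thesis using assms c by (simp add: str_weight_def power_divide)
next
  case False
  have c: "0 \<le> 1 - q\<^sup>2" "1 - q\<^sup>2 \<le> 1" using assms power_le_one[of q 2] by auto
  then show ?thesis using False by (simp add: binomial_eq_0)
qed

lemma str_weight_Suc:
  assumes "0 < q" "q < 1" "2 \<le> L"
  shows "str_weight q L (Suc n) = (1 - q\<^sup>2)\<^sup>2 / q\<^sup>2 * str_weight q (L - 2) n"
proof -
  obtain K where "L = Suc (Suc K)" using assms(3) by (metis add_2_eq_Suc le_Suc_ex)
  then show ?thesis using assms(1) by (simp add: str_weight_def power2_eq_square)
qed

text \<open>For a cut \<open>t\<close> behind the defect, \<open>n\<close> is the upper argument of
  the binomial coefficient of the dominating law. If \<open>n\<close> is typical
  (\<open>good\<close>), \<open>chi\<close> is controlled by the second moment under independent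
  flips, and the weights of all \<open>n\<close> add up to at most
  \<open>q / (1 - q\<^sup>2)\<close>. Otherwise \<open>chi\<close> is bounded by the absolute
  difference, and the binomial weight of such \<open>n\<close> is tiny. As
  \<open>t - 1 \<le> 6 * a\<close> and there are at most \<open>4 * a\<close> flips,
  \<open>n \<le> 5 * a\<close>.\<close>

theorem trace_chi_str_le:
  fixes q \<Delta> M :: real and a L :: nat
  assumes q: "0 < q" "q < 1" and a: "0 < a" and L: "3 \<le> L" "L \<le> 4 * a" and \<Delta>: "0 \<le> \<Delta>" and M: "0 \<le> M"
  defines "good \<equiv> \<lambda>n. \<bar>real (L - 2) - (1 - q\<^sup>2) * real (n - 1)\<bar> \<le> \<Delta>"
  assumes good: "\<And>n. 1 \<le> n \<Longrightarrow> n \<le> 5 * a \<Longrightarrow> good n \<Longrightarrow> L \<le> n \<and>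
     (\<Sum>v\<in>bitstrings L. path_weight (1 / (1 + q)) True v * (flip_count_sum a L (n - 1) v / real (n choose L))\<^sup>2) \<le> M"
  shows "trace_chi q (str_x a) (str_y a) \<le>
      2 * (\<Sum>l\<le>L. pmf (binomial_pmf (6 * a + 2) (1 - q)) l)
    + 2 * (\<Sum>t<2 * a + 2. pmf (binomial_pmf t (1 - q)) L)
    + q / (1 - q\<^sup>2) * M
    + 20 * real a * real L * (q * ((1 - q\<^sup>2)\<^sup>2 / q\<^sup>2)) * exp (- (2 * \<Delta>\<^sup>2 / (5 * real a)))"
proof -
  define c where "c = 1 - q\<^sup>2"
  have c: "0 < c" "c \<le> 1" using q power_less_one_iff[of q 2] by (auto simp: c_def)
  let ?x = "str_x a" and ?y = "str_y a" and ?\<mu> = "path_weight (1 / (1 + q)) True"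
  have q': "0 \<le> q" "q \<le> 1" using q by auto
  have \<mu>0: "0 \<le> ?\<mu> v" for v by (rule path_weight_nonneg) (use q in auto)
  have pos: "0 \<le> str_weight q L n" for n
    using q c by (simp add: str_weight_def c_def)
  define Z where "Z = (\<lambda>n v. if good n then (flip_count_sum a L (n - 1) v)\<^sup>2 / (2 * real (n choose L))
     else real L * real (n - 1 choose (L - 2)))"
  have Z0: "0 \<le> Z n v" for n v by (simp add: Z_def)
  have step: "chi (trace_prob q (take t ?x) v) (trace_prob q (take t ?y) v)
     \<le> str_weight q L ((t - 1 + flips True v) div 2) * ?\<mu> v * Z ((t - 1 + flips True v) div 2) v"
    if t: "2 * a + 2 \<le> t" "t < 6 * a + 2" and v: "v \<in> bitstrings L" for t v
  proof -
    define k where "k = t - 2 * a - 1"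
    have k: "1 \<le> k" "t = 2 * a + 1 + k" "t - 1 = 2 * a + k" using t by (auto simp: k_def)
    define n where "n = (t - 1 + flips True v) div 2"
    have len: "length v = L" using v by (simp add: bitstrings_def)
    have e: "flips True v \<le> L" using flips_le[of True v] len by simp
    define w where "w = q ^ t * ((1 - q) / q) ^ L"
    have w: "0 < w" using q by (simp add: w_def)
    have n5: "1 \<le> n" "n \<le> 5 * a" using t e L a by (auto simp: n_def)
    let ?F = "trace_prob q (take t ?x) v" and ?F' = "trace_prob q (take t ?y) v"
    have tk: "take t ?x = alt False (2 * a) @ True # alt False k"
      "take t ?y = alt False (2 * a + 1) @ True # alt True (k - 1)"
      using take_str[of a t] t by (auto simp: k_def simp del: alt.simps)
    have diff: "?F - ?F' = w * flip_count_sum a L (n - 1) v"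
      unfolding tk w_def flip_count_sum_def n_def
      using trace_prob_defect_diff[OF q, of k a v] k len by simp
    have low: "w * real (n choose L) \<le> ?F" "w * real (n choose L) \<le> ?F'"
      unfolding tk w_def n_def using trace_prob_str_lower[OF q k(1), of a v] k len by auto
    have "chi ?F ?F' \<le> w * Z n v"
    proof (cases "good n")
      case True
      then have "L \<le> n" using good n5 by blast
      then have "0 < real (n choose L)" by simp
      from chi_le_of_lower[OF w this low diff] show ?thesis using True by (simp add: Z_def)
    next
      case False
      have "\<bar>flip_count_sum a L (n - 1) v\<bar> \<le> real (n - 1 choose (L - 2)) * real (length v)"
        unfolding flip_count_sum_def
      proof (rule abs_path_sum_flip_term_le[where e = "flips True v"])
        show "\<bar>split_count (n - 1) L (a + E div 2) k\<bar> \<le> real (n - 1 choose (L - 2))"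
          if "E < flips True v" for E k
        proof (rule abs_split_count_le)
          have "2 * a + 1 + flips True v \<le> t - 1 + flips True v" using t by simp
          then show "a + E div 2 \<le> n - 1" using that unfolding n_def by linarith
        qed
      qed auto
      then have "\<bar>?F - ?F'\<bar> \<le> w * (real L * real (n - 1 choose (L - 2)))"
        unfolding diff abs_mult using w len by (simp add: mult_ac)
      moreover have "chi ?F ?F' \<le> \<bar>?F - ?F'\<bar>"
        by (intro chi_le_abs_diff trace_prob_nonneg q')
      ultimately show ?thesis using False by (simp add: Z_def)
    qed
    also have "\<dots> \<le> (str_weight q L n * ?\<mu> v) * Z n v"
    proof (rule mult_right_mono[OF _ Z0])
      have "t = Suc (t - 1)" using t by simp
      then show "w \<le> str_weight q L n * ?\<mu> v"
        unfolding w_def using power_le_str_weight[OF q n_def len] by simp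
    qed
    finally show ?thesis by (simp add: n_def)
  qed
  define N where "N = {1..5 * a}"
  have "(\<Sum>t\<in>{2 * a + 2..<6 * a + 2}. \<Sum>v\<in>bitstrings L. chi (trace_prob q (take t ?x) v) (trace_prob q (take t ?y) v))
    \<le> (\<Sum>t\<in>{2 * a + 2..<6 * a + 2}. \<Sum>v\<in>bitstrings L.
        str_weight q L ((t - 1 + flips True v) div 2) * ?\<mu> v * Z ((t - 1 + flips True v) div 2) v)"
    by (intro sum_mono step) auto
  also have "\<dots> = (\<Sum>v\<in>bitstrings L. \<Sum>t\<in>{2 * a + 2..<6 * a + 2}.
        str_weight q L ((t - 1 + flips True v) div 2) * ?\<mu> v * Z ((t - 1 + flips True v) div 2) v)"
    by (rule sum.swap)
  also have "\<dots> \<le> (\<Sum>v\<in>bitstrings L. 2 * (\<Sum>n\<in>N. str_weight q L n * ?\<mu> v * Z n v))"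
  proof (intro sum_mono)
    fix v assume "v \<in> bitstrings L"
    then have e: "flips True v \<le> L" using flips_le[of True v] by (simp add: bitstrings_def)
    have "(\<Sum>t\<in>{2 * a + 2..<6 * a + 2}.
        str_weight q L ((t - 1 + flips True v) div 2) * ?\<mu> v * Z ((t - 1 + flips True v) div 2) v)
      = (\<Sum>s\<in>{2 * a + 1..<6 * a + 1}.
        str_weight q L ((s + flips True v) div 2) * ?\<mu> v * Z ((s + flips True v) div 2) v)"
      by (rule sum.reindex_bij_witness[where i = Suc and j = "\<lambda>t. t - 1"]) auto
    also have "\<dots> \<le> 2 * (\<Sum>n\<in>N. str_weight q L n * ?\<mu> v * Z n v)"
      using e L a by (intro sum_halves_le) (auto simp: N_def pos \<mu>0 Z0)
    finally show "(\<Sum>t\<in>{2 * a + 2..<6 * a + 2}.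
        str_weight q L ((t - 1 + flips True v) div 2) * ?\<mu> v * Z ((t - 1 + flips True v) div 2) v) \<le> \<dots>" .
  qed
  also have "\<dots> = 2 * (\<Sum>n\<in>N. \<Sum>v\<in>bitstrings L. str_weight q L n * ?\<mu> v * Z n v)"
    by (subst sum_distrib_left[symmetric], subst sum.swap, rule refl)
  also have "\<dots> \<le> 2 * (\<Sum>n\<in>N. q / 2 * M * pmf (binomial_pmf n c) L
       + real L * (q * (c\<^sup>2 / q\<^sup>2)) * (2 * exp (- (2 * \<Delta>\<^sup>2 / (5 * real a)))))"
  proof (intro mult_left_mono sum_mono)
    fix n assume n: "n \<in> N"
    have rhs2: "0 \<le> real L * (q * (c\<^sup>2 / q\<^sup>2)) * (2 * exp (- (2 * \<Delta>\<^sup>2 / (5 * real a))))"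
      using q by simp
    show "(\<Sum>v\<in>bitstrings L. str_weight q L n * ?\<mu> v * Z n v)
      \<le> q / 2 * M * pmf (binomial_pmf n c) L + real L * (q * (c\<^sup>2 / q\<^sup>2)) * (2 * exp (- (2 * \<Delta>\<^sup>2 / (5 * real a))))"
    proof (cases "good n")
      case True
      from good[OF _ _ this] n have g: "L \<le> n"
        "(\<Sum>v\<in>bitstrings L. ?\<mu> v * (flip_count_sum a L (n - 1) v / real (n choose L))\<^sup>2) \<le> M"
        by (auto simp: N_def)
      have "(\<Sum>v\<in>bitstrings L. str_weight q L n * ?\<mu> v * Z n v)
        = (\<Sum>v\<in>bitstrings L. (str_weight q L n * real (n choose L)) / 2 *
             (?\<mu> v * (flip_count_sum a L (n - 1) v / real (n choose L))\<^sup>2))"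
        using g(1) True by (intro sum.cong refl) (simp add: Z_def power2_eq_square)
      also have "\<dots> = q / 2 * pmf (binomial_pmf n c) L *
         (\<Sum>v\<in>bitstrings L. ?\<mu> v * (flip_count_sum a L (n - 1) v / real (n choose L))\<^sup>2)"
        unfolding str_weight_binomial[OF q] c_def by (simp only: sum_distrib_left) simp
      also have "\<dots> \<le> q / 2 * pmf (binomial_pmf n c) L * M"
        using g(2) q by (intro mult_left_mono mult_nonneg_nonneg pmf_nonneg) auto
      finally show ?thesis using rhs2 by (simp add: mult_ac)
    next
      case False
      obtain R where R: "n = Suc R" using n by (cases n) (auto simp: N_def)
      have "(\<Sum>v\<in>bitstrings L. str_weight q L n * ?\<mu> v * Z n v)
        = str_weight q L n * (real L * real (R choose (L - 2))) * (\<Sum>v\<in>bitstrings L. ?\<mu> v)"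
        using False R by (simp add: Z_def sum_distrib_left mult_ac)
      also have "\<dots> = real L * (c\<^sup>2 / q\<^sup>2) * (str_weight q (L - 2) R * real (R choose (L - 2)))"
        using L by (simp add: sum_path_weight R str_weight_Suc[OF q] c_def)
      also have "\<dots> = real L * (q * (c\<^sup>2 / q\<^sup>2)) * pmf (binomial_pmf R c) (L - 2)"
        unfolding str_weight_binomial[OF q] c_def by simp
      also have "\<dots> \<le> real L * (q * (c\<^sup>2 / q\<^sup>2)) * (2 * exp (- (2 * \<Delta>\<^sup>2 / (5 * real a))))"
      proof (intro mult_left_mono)
        show "pmf (binomial_pmf R c) (L - 2) \<le> 2 * exp (- (2 * \<Delta>\<^sup>2 / (5 * real a)))"
        proof (cases "R = 0")
          case True
          have "pmf (binomial_pmf 0 c) (L - 2) = 0" using c L by (simp add: binomial_pmf_0)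
          then show ?thesis using True by simp
        next
          case R0: False
          have "\<Delta> \<le> \<bar>real (L - 2) - real R * c\<bar>"
            using False R by (simp add: good_def c_def mult.commute)
          then have "\<Delta>\<^sup>2 \<le> (real (L - 2) - real R * c)\<^sup>2"
            using \<Delta> by (metis abs_of_nonneg abs_le_square_iff abs_abs)
          then have "2 * \<Delta>\<^sup>2 / (5 * real a) \<le> 2 * (real (L - 2) - real R * c)\<^sup>2 / real R"
            using n R R0 a by (intro frac_le mult_left_mono) (auto simp: N_def)
          then have "exp (- 2 * (real (L - 2) - real R * c)\<^sup>2 / real R) \<le> exp (- (2 * \<Delta>\<^sup>2 / (5 * real a)))"
            by simp
          moreover have "pmf (binomial_pmf R c) (L - 2) \<le> 2 * exp (- 2 * (real (L - 2) - real R * c)\<^sup>2 / real R)"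
            by (rule pmf_binomial_le_exp) (use c R0 in auto)
          ultimately show ?thesis by linarith
        qed
      qed (use q in simp)
      finally have "(\<Sum>v\<in>bitstrings L. str_weight q L n * ?\<mu> v * Z n v)
        \<le> real L * (q * (c\<^sup>2 / q\<^sup>2)) * (2 * exp (- (2 * \<Delta>\<^sup>2 / (5 * real a))))" .
      moreover have "0 \<le> q / 2 * M * pmf (binomial_pmf n c) L"
        using q M by (intro mult_nonneg_nonneg pmf_nonneg) auto
      ultimately show ?thesis by linarith
    qed
  qed simp
  also have "\<dots> = q * M * (\<Sum>n\<in>N. pmf (binomial_pmf n c) L)
     + 20 * real a * real L * (q * (c\<^sup>2 / q\<^sup>2)) * exp (- (2 * \<Delta>\<^sup>2 / (5 * real a)))"
  proof -
    have "card N = 5 * a" by (simp add: N_def)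
    then show ?thesis
      by (simp only: sum.distrib sum_distrib_left[symmetric] sum_constant) (simp add: distrib_left)
  qed
  also have "(\<Sum>n\<in>N. pmf (binomial_pmf n c) L) \<le> (\<Sum>n\<le>5 * a. pmf (binomial_pmf n c) L)"
    by (intro sum_mono2) (auto simp: N_def simp del: pmf_binomial)
  also have "(\<Sum>n\<le>5 * a. pmf (binomial_pmf n c) L) \<le> 1 / c"
    by (rule sum_binomial_pmf_upper_le[OF c])
  finally have third: "(\<Sum>t\<in>{2 * a + 2..<6 * a + 2}. \<Sum>v\<in>bitstrings L.
       chi (trace_prob q (take t ?x) v) (trace_prob q (take t ?y) v))
    \<le> q * M * (1 / c) + 20 * real a * real L * (q * (c\<^sup>2 / q\<^sup>2)) * exp (- (2 * \<Delta>\<^sup>2 / (5 * real a)))"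
    using q M by (simp add: mult_left_mono)
  have bin: "(\<Sum>v\<in>bitstrings l. trace_prob q z v) = pmf (binomial_pmf k (1 - q)) l"
    if "length z = k" for z l k
    using sum_trace_prob_bitstrings[OF q', of z l] that by simp
  have first: "(\<Sum>l\<le>L. \<Sum>u\<in>bitstrings l. trace_prob q ?x u + trace_prob q ?y u)
     = 2 * (\<Sum>l\<le>L. pmf (binomial_pmf (6 * a + 2) (1 - q)) l)"
    unfolding sum.distrib by (simp only: bin[OF length_str(1)] bin[OF length_str(2)] mult_2)
  have second: "(\<Sum>t<2 * a + 2. \<Sum>v\<in>bitstrings L. trace_prob q (take t ?x) v + trace_prob q (take t ?y) v)
     = 2 * (\<Sum>t<2 * a + 2. pmf (binomial_pmf t (1 - q)) L)"
  proof -
    have "(\<Sum>v\<in>bitstrings L. trace_prob q (take t ?x) v + trace_prob q (take t ?y) v)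
      = 2 * pmf (binomial_pmf t (1 - q)) L" if "t < 2 * a + 2" for t
    proof -
      have "length (take t ?x) = t" "length (take t ?y) = t" using that by auto
      then show ?thesis unfolding sum.distrib by (simp only: bin mult_2)
    qed
    then show ?thesis by (simp add: sum_distrib_left del: pmf_binomial)
  qed
  have "trace_chi q ?x ?y \<le>
     (\<Sum>l\<le>L. \<Sum>u\<in>bitstrings l. trace_prob q ?x u + trace_prob q ?y u)
   + (\<Sum>t<2 * a + 2. \<Sum>v\<in>bitstrings L. trace_prob q (take t ?x) v + trace_prob q (take t ?y) v)
   + (\<Sum>t\<in>{2 * a + 2..<length ?x}. \<Sum>v\<in>bitstrings L. chi (trace_prob q (take t ?x) v) (trace_prob q (take t ?y) v))"
    by (rule trace_chi_le[OF q']) (use str_suffix a in auto)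
  then show ?thesis unfolding first second using third unfolding length_str(1) c_def by simp
qed

text \<open>\<open>P\<close> bounds both \<open>1 - q\<close> and \<open>q\<^sup>2\<close> from
  below and serves as the margin. From \<open>L\<close> near \<open>4 * (1 - q) * b\<close> and
  \<open>K\<close> near \<open>(1 - q\<^sup>2) * R\<close> it follows that
  \<open>(1 + q) * R\<close> is near \<open>4 * b\<close>, the source of the fractions just below 4
  and 2.\<close>

lemma defect_walk_params:
  fixes q \<Delta> :: real and a L R :: nat
  defines "P \<equiv> (1 - q) * q\<^sup>2" and "b \<equiv> real a"
  assumes q: "0 < q" "q < 1" and big: "10000 \<le> P * b" "1000 * \<Delta> \<le> P * b"
    and \<Delta>: "30 \<le> \<Delta>" "b \<le> \<Delta>\<^sup>2" "24 * \<Delta> \<le> (P / 10)\<^sup>2 * b"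
    and L: "L = nat \<lfloor>4 * (1 - q) * b\<rfloor>"
    and R: "\<bar>real (L - 2) - (1 - q\<^sup>2) * real R\<bar> \<le> \<Delta>" "R \<le> 5 * a"
  shows "defect_walk q a L R b (P / 10) (b * \<Delta>)" "P * b \<le> real R - real (L - 2)"
    "L - 2 \<le> R" "4 \<le> L" "real L \<le> 4 * b"
proof -
  define p where "p = 1 - q"
  have p: "0 < p" "p < 1" using q by (auto simp: p_def)
  have q2: "0 < q\<^sup>2" "q\<^sup>2 < 1" using q power_less_one_iff[of q 2] by auto
  have P: "0 < P" "P \<le> p" "P \<le> 1" "P = p * q\<^sup>2"
    using p q2 by (auto simp: P_def p_def mult_left_le intro: mult_le_one)
  have b: "10000 \<le> b"
    using big(1) P mult_right_mono[of P 1 b] by (simp add: b_def)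
  have Pb: "P * b \<le> p * b" "P * b \<le> b" using P b mult_right_mono[of P p b] mult_right_mono[of P 1 b] by auto
  have "0 \<le> 4 * (1 - q) * b" using q b by simp
  then have Lr: "real L = of_int \<lfloor>4 * (1 - q) * b\<rfloor>" unfolding L by (intro of_nat_nat) simp
  then have L1: "real L \<le> 4 * (p * b)" "4 * (p * b) - 1 < real L"
  proof -
    have "4 * (1 - q) * b = 4 * (p * b)" by (simp add: p_def)
    then have "real L = of_int \<lfloor>4 * (p * b)\<rfloor>" using Lr by (simp only:)
    then show "real L \<le> 4 * (p * b)" "4 * (p * b) - 1 < real L" by linarith+
  qed
  then show L4: "4 \<le> L" using big(1) Pb by linarith
  have pb: "p * b \<le> b" using p b by (simp add: mult_left_le_one_le)
  then show "real L \<le> 4 * b" using L1 by simp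
  define K where "K = L - 2"
  have K: "real K = real L - 2" using L4 by (simp add: K_def)
  define k where "k = real K"
  define \<rho> where "\<rho> = real R"
  have cR: "\<bar>k - (1 - q\<^sup>2) * \<rho>\<bar> \<le> \<Delta>" using R by (simp add: k_def K_def \<rho>_def)
  have k: "4 * (p * b) - 3 \<le> k" "k \<le> 4 * (p * b) - 2" using K L1 by (auto simp: k_def)
  have c_eq: "1 - q\<^sup>2 = p * (1 + q)" by (simp add: p_def power2_eq_square algebra_simps)
  have "p * (399 / 100 * b) \<le> p * ((1 + q) * \<rho>)"
    using cR k big Pb unfolding c_eq mult.assoc abs_le_iff by linarith
  then have \<rho>1: "399 / 100 * b \<le> (1 + q) * \<rho>" using p by simp
  have \<rho>5: "\<rho> \<le> 5 * b" using R(2) by (simp add: \<rho>_def b_def)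
  have \<rho>0: "0 \<le> \<rho>" by (simp add: \<rho>_def)
  have "(1 + q) * \<rho> \<le> 2 * \<rho>" using q \<rho>0 by (intro mult_right_mono) auto
  then have \<rho>2: "199 / 100 * b \<le> \<rho>" using \<rho>1 b by linarith
  have RK: "3 / 2 * (P * b) \<le> \<rho> - k"
  proof -
    have "q\<^sup>2 * (199 / 100 * b) \<le> q\<^sup>2 * \<rho>" using q2 \<rho>2 by (intro mult_left_mono) auto
    moreover have "P * b \<le> q\<^sup>2 * b"
      using P p q2 b by (intro mult_right_mono) (auto simp: mult_left_le_one_le)
    moreover have "\<rho> - k \<ge> q\<^sup>2 * \<rho> - \<Delta>" using cR by (simp add: left_diff_distrib abs_le_iff)
    ultimately show ?thesis using big by linarith
  qed
  then show "P * b \<le> real R - real (L - 2)" using big by (simp add: \<rho>_def k_def K_def)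
  then show KR: "L - 2 \<le> R" using big by linarith
  \<comment> \<open>\<open>3 + q - 2 * q\<^sup>2\<close> is largest at \<open>q = 1 / 4\<close>,
    with value \<open>25 / 8\<close>; against \<open>399 / 100\<close> this leaves more than
    \<open>86 / 100\<close>, and dividing by \<open>1 + q < 2\<close> gives the claim.\<close>
  have s_far: "2 / 5 * b \<le> \<rho> - real s" if "s \<le> a + L div 2" for s
  proof -
    have "real s \<le> real a + real L / 2" using that by linarith
    then have "real s \<le> b * (1 + 2 * p)" using L1 by (simp add: b_def algebra_simps)
    then have "(1 + q) * real s \<le> (1 + q) * (b * (1 + 2 * p))" using q by (intro mult_left_mono) auto
    moreover have "(1 + q) * (b * (1 + 2 * p)) = b * (3 + q - 2 * q\<^sup>2)"
      by (simp add: p_def power2_eq_square algebra_simps)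
    moreover have "b * (3 + q - 2 * q\<^sup>2) \<le> b * (3 + 1 / 8)"
    proof (intro mult_left_mono)
      have "0 \<le> (q - 1 / 4)\<^sup>2" by simp
      then show "3 + q - 2 * q\<^sup>2 \<le> 3 + 1 / 8" by (simp add: power2_eq_square algebra_simps)
    qed (use b in simp)
    ultimately have ge: "86 / 100 * b \<le> (1 + q) * (\<rho> - real s)"
      using \<rho>1 b by (simp add: right_diff_distrib)
    then have "0 < (1 + q) * (\<rho> - real s)" using b by linarith
    then have "0 < \<rho> - real s" using q by (simp add: zero_less_mult_iff)
    then have "(1 + q) * (\<rho> - real s) \<le> 2 * (\<rho> - real s)" using q by (intro mult_right_mono) auto
    with ge have "86 / 100 * b \<le> 2 * (\<rho> - real s)" by (rule order_trans)
    then show ?thesis using b by simp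
  qed
  show "defect_walk q a L R b (P / 10) (b * \<Delta>)"
  proof
    show "2 \<le> a" using b by (simp add: b_def)
    show "a + L div 2 < R" using s_far[of "a + L div 2"] b by (simp add: \<rho>_def)
    show "b \<le> real R" using \<rho>2 b by (simp add: \<rho>_def)
    show "b ^ 3 \<le> (b * \<Delta>)\<^sup>2"
    proof -
      have "b ^ 3 = b\<^sup>2 * b" by (simp add: eval_nat_numeral)
      also have "\<dots> \<le> b\<^sup>2 * \<Delta>\<^sup>2" using \<Delta> by (intro mult_left_mono) auto
      finally show ?thesis by (simp add: power_mult_distrib)
    qed
    show "24 * (b * \<Delta>) \<le> (P / 10)\<^sup>2 * b\<^sup>2"
      using mult_left_mono[OF \<Delta>(3), of b] b by (simp add: power2_eq_square mult_ac)
    show "\<bar>(1 - q\<^sup>2) * real R - real (L - 2)\<bar> * b\<^sup>2 \<le> b * \<Delta> * real R"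
    proof -
      have "\<bar>(1 - q\<^sup>2) * real R - real (L - 2)\<bar> * (b * b) \<le> \<Delta> * (b * \<rho>)"
        using R(1) \<rho>2 b \<Delta> by (intro mult_mono mult_left_mono) (auto simp: abs_minus_commute)
      then show ?thesis by (simp add: \<rho>_def power2_eq_square mult_ac)
    qed
    show "P / 10 * b \<le> real j \<and> P / 10 * b \<le> real s - real j \<and> P / 10 * b \<le> real (L - 2) - real j \<and>
         P / 10 * b \<le> real R - real s - real (L - 2) + real j"
      if s: "a \<le> s + 1" "s \<le> a + L div 2"
        and X: "\<bar>real s * real (L - 2) - real j * real R\<bar> \<le> 5 * (b * \<Delta>)" for s j
    proof -
      define \<sigma> where "\<sigma> = real s"
      define x where "x = real j"
      have X': "\<bar>\<sigma> * k - x * \<rho>\<bar> \<le> 5 * (b * \<Delta>)"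
        using X by (simp add: \<sigma>_def x_def k_def K_def \<rho>_def)
      have bD: "5 * (b * \<Delta>) \<le> b * (P * b) / 200"
        using mult_left_mono[OF big(2), of b] b by simp
      have \<sigma>: "99 / 100 * b \<le> \<sigma>" "2 / 5 * b \<le> \<rho> - \<sigma>"
        using s b s_far[OF s(2)] by (auto simp: \<sigma>_def b_def)
      have k1: "399 / 100 * (p * b) \<le> k" using k big Pb by linarith
      \<comment> \<open>Dividing by \<open>\<rho> \<le> 5 * b\<close> turns a bound for a cell times
        \<open>\<rho>\<close> into one for the cell; hence the margin \<open>P / 10\<close>.\<close>
      have scale: "P / 10 * b \<le> z" if "b * (P * b) / 2 \<le> z * \<rho>" for z
      proof (rule ccontr)
        assume "\<not> P / 10 * b \<le> z"
        then have z: "z < P / 10 * b" by simp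
        have "z * \<rho> < b * (P * b) / 2"
        proof (cases "0 \<le> z")
          case True
          then have "z * \<rho> \<le> z * (5 * b)" using \<rho>5 by (intro mult_left_mono) auto
          also have "\<dots> < P / 10 * b * (5 * b)" using z b by (intro mult_strict_right_mono) auto
          finally show ?thesis by (simp add: mult_ac)
        next
          case False
          then have "z * \<rho> \<le> 0" using \<rho>0 by (simp add: mult_nonpos_nonneg)
          moreover have "0 < b * (P * b)" using P b by simp
          ultimately show ?thesis by linarith
        qed
        then show False using that by simp
      qed
      have Pp: "b * (P * b) \<le> b * (p * b)" using Pb b by (intro mult_left_mono) auto
      have pos: "0 < b * (P * b)" using P b by simp
      \<comment> \<open>At the mean each of the four cells times \<open>\<rho>\<close> is a product
        of two margins. These products exceed \<open>b * (P * b) / 2\<close> by enough to absorb the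
        deviation \<open>5 * (b * \<Delta>)\<close>.\<close>
      have 1: "99 / 100 * b * (399 / 100 * (p * b)) \<le> \<sigma> * k"
        using \<sigma> k1 b p by (intro mult_mono) auto
      have 2: "99 / 100 * b * (3 / 2 * (P * b)) \<le> \<sigma> * (\<rho> - k)"
        using \<sigma> RK b P by (intro mult_mono) auto
      have 3: "2 / 5 * b * (399 / 100 * (p * b)) \<le> (\<rho> - \<sigma>) * k"
        using \<sigma> k1 b p by (intro mult_mono) auto
      have 4: "2 / 5 * b * (3 / 2 * (P * b)) \<le> (\<rho> - \<sigma>) * (\<rho> - k)"
        using \<sigma> RK b P by (intro mult_mono) auto
      have "b * (P * b) / 2 \<le> x * \<rho>" using X' bD 1 Pp pos by (simp add: mult_ac)
      moreover have "b * (P * b) / 2 \<le> (\<sigma> - x) * \<rho>"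
        using X' bD 2 pos by (simp add: algebra_simps)
      moreover have "b * (P * b) / 2 \<le> (k - x) * \<rho>"
        using X' bD 3 Pp pos by (simp add: algebra_simps)
      moreover have "b * (P * b) / 2 \<le> (\<rho> - \<sigma> - k + x) * \<rho>"
        using X' bD 4 pos by (simp add: algebra_simps)
      ultimately show ?thesis
        using scale unfolding \<sigma>_def x_def k_def K_def \<rho>_def by blast
    qed
  qed (use q P b \<Delta> L4 KR \<rho>5 in \<open>auto simp: \<rho>_def b_def\<close>)
qed

section \<open>Explicit bounds and their asymptotics\<close>

lemma path_sum_flip_term_cmult:
  "path_sum (flip_term a (\<lambda>s k. x * G s k)) E k c u = x * path_sum (flip_term a G) E k c u"
  by (induction u arbitrary: E k c) (auto simp: flip_term_def algebra_simps)

text \<open>\<open>G\<close> is normalised by \<open>R choose K\<close>, whereas the dominating law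
  involves \<open>n choose L\<close> with \<open>n = R + 1\<close> and \<open>L = K + 2\<close>;
  this compares the two.\<close>

lemma choose_ratio_le:
  assumes "K < R"
  shows "real (R choose K) / real (Suc R choose (K + 2)) \<le> (real K + 2) / (real R - real K)"
proof -
  have 1: "real (Suc R choose Suc (Suc K)) * (real (Suc K) + 1) = real (Suc R choose Suc K) * (real (Suc R) - real (Suc K))"
    by (rule choose_Suc_ratio)
  have pos: "0 < real (Suc R choose (K + 2))"
    using assms by (simp del: binomial_Suc_Suc add_2_eq_Suc')
  have "real (R choose K) * (real R - real K) \<le> (real K + 2) * real (Suc R choose (K + 2))"
  proof -
    have "real (R choose K) \<le> real (Suc R choose Suc K)"
      by simp
    then have "real (R choose K) * (real R - real K) \<le> real (Suc R choose Suc K) * (real R - real K)"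
      using assms by (intro mult_right_mono) auto
    also have "\<dots> = (real K + 2) * real (Suc R choose (K + 2))" using 1 by (simp add: mult_ac add_ac)
    finally show ?thesis .
  qed
  then show ?thesis using pos assms by (simp add: pos_divide_le_eq pos_le_divide_eq mult_ac)
qed

lemma bigo_cmult: "f \<in> O[F](g) \<Longrightarrow> (\<lambda>x. c * f x) \<in> O[F](g)" for f g :: "real \<Rightarrow> real"
  by (cases "c = 0") auto

text \<open>The bound of \<open>second_moment_le\<close> for \<open>A = b\<close>,
  \<open>\<eta> = P / 10\<close> and \<open>D = b * sqrt b * ln b\<close>, with \<open>L\<close>
  replaced by \<open>4 * b\<close>.\<close>

definition walk_bound :: "real \<Rightarrow> real \<Rightarrow> real" where
  "walk_bound P b = (let \<kappa> = ln b / sqrt b * (100 / P\<^sup>2); \<tau> = 2 * (5 * b + 1) * exp (- (ln b)\<^sup>2 / 250) in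
     16 * (4500000 * \<kappa> ^ 4 * (5 * (sqrt b * ln b)) + 32 * \<tau>\<^sup>2 * (4 * b))
       + 4 * (36000 * \<kappa> ^ 3 * (5 * (sqrt b * ln b)) + 8 * \<tau> * (4 * b))\<^sup>2 + 8 * \<tau>\<^sup>2)"

lemma walk_bound_bigo:
  fixes P :: real
  shows "walk_bound P \<in> O(\<lambda>b. ln b ^ 5 / b powr (3/2))"
proof -
  let ?g = "\<lambda>b::real. ln b ^ 5 / b powr (3/2)"
  let ?\<tau> = "\<lambda>b. 2 * (5 * b + 1) * exp (- (ln b)\<^sup>2 / 250) :: real"
  \<comment> \<open>The leading term: four logarithms from the increments and one from the window
    length.\<close>
  have 1: "(\<lambda>b. (ln b / sqrt b) ^ 4 * (sqrt b * ln b)) \<in> O(?g)" by real_asymp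
  have 2: "(\<lambda>b. (?\<tau> b)\<^sup>2 * b) \<in> O(?g)" by real_asymp
  have 3: "(\<lambda>b. ((ln b / sqrt b) ^ 3 * (sqrt b * ln b))\<^sup>2) \<in> O(?g)" by real_asymp
  have 4: "(\<lambda>b. (ln b / sqrt b) ^ 3 * (sqrt b * ln b) * (?\<tau> b * b)) \<in> O(?g)" by real_asymp
  have 5: "(\<lambda>b. (?\<tau> b * b)\<^sup>2) \<in> O(?g)" by real_asymp
  have 6: "(\<lambda>b. (?\<tau> b)\<^sup>2) \<in> O(?g)" by real_asymp
  have eq: "walk_bound P = (\<lambda>b. (360000000 * (100 / P\<^sup>2) ^ 4) * ((ln b / sqrt b) ^ 4 * (sqrt b * ln b))
      + 2048 * ((?\<tau> b)\<^sup>2 * b) + (129600000000 * (100 / P\<^sup>2) ^ 6) * ((ln b / sqrt b) ^ 3 * (sqrt b * ln b))\<^sup>2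
      + (46080000 * (100 / P\<^sup>2) ^ 3) * ((ln b / sqrt b) ^ 3 * (sqrt b * ln b) * (?\<tau> b * b))
      + 4096 * (?\<tau> b * b)\<^sup>2 + 8 * (?\<tau> b)\<^sup>2)" (is "_ = ?R")
  proof (rule ext)
    fix b :: real
    define Q where "Q = 100 / P\<^sup>2"
    define x where "x = ln b / sqrt b"
    define y where "y = sqrt b * ln b"
    define t where "t = ?\<tau> b"
    have "walk_bound P b = 16 * (4500000 * (x * Q) ^ 4 * (5 * y) + 32 * t\<^sup>2 * (4 * b))
       + 4 * (36000 * (x * Q) ^ 3 * (5 * y) + 8 * t * (4 * b))\<^sup>2 + 8 * t\<^sup>2"
      by (simp only: walk_bound_def Let_def x_def y_def t_def Q_def)
    also have "\<dots> = (360000000 * Q ^ 4) * (x ^ 4 * y) + 2048 * (t\<^sup>2 * b)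
      + (129600000000 * Q ^ 6) * (x ^ 3 * y)\<^sup>2 + (46080000 * Q ^ 3) * (x ^ 3 * y * (t * b))
      + 4096 * (t * b)\<^sup>2 + 8 * t\<^sup>2"
      by (simp add: power2_eq_square eval_nat_numeral algebra_simps)
    finally show "walk_bound P b = ?R b"
      by (simp only: x_def y_def t_def Q_def)
  qed
  show ?thesis unfolding eq
    by (intro sum_in_bigo bigo_cmult 1 2 3 4 5 6)
qed

text \<open>The summands stem, in this order, from traces of at most \<open>L\<close> bits, from
  cuts within the first \<open>2 * a + 2\<close> positions, from typical \<open>n\<close> and from
  untypical \<open>n\<close>.\<close>

definition str_bound :: "real \<Rightarrow> real \<Rightarrow> real" where
  "str_bound q b = 8 * ((4 * b + 1) * exp (- ((1 - q)\<^sup>2 * b)))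
     + 8 * ((2 * b + 2) * exp (- ((1 - q)\<^sup>2 * b / 2)))
     + q / (1 - q\<^sup>2) * (4 / ((1 - q) * q\<^sup>2))\<^sup>2 * walk_bound ((1 - q) * q\<^sup>2) b
     + 80 * (q * ((1 - q\<^sup>2)\<^sup>2 / q\<^sup>2)) * (b\<^sup>2 * exp (- (2 * (ln b)\<^sup>2 / 5)))"

lemma str_bound_bigo:
  assumes "q < 1"
  shows "str_bound q \<in> O(\<lambda>b. ln b ^ 5 / b powr (3/2))"
proof -
  let ?g = "\<lambda>b::real. ln b ^ 5 / b powr (3/2)"
  have p: "(1 - q)\<^sup>2 > 0" using assms by simp
  have "(\<lambda>b. (4 * b + 1) * exp (- (r * b))) \<in> O(?g)" "(\<lambda>b. (2 * b + 2) * exp (- (r * b / 2))) \<in> O(?g)"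
    if "r > 0" for r :: real
    using that by real_asymp+
  note 1 = this[OF p]
  have 2: "(\<lambda>b. b\<^sup>2 * exp (- (2 * (ln b)\<^sup>2 / 5))) \<in> O(?g)" by real_asymp
  show ?thesis
    unfolding str_bound_def by (intro sum_in_bigo bigo_cmult 1 2 walk_bound_bigo)
qed

lemma flip_count_sum_moment_le:
  fixes q \<Delta> :: real and a L n :: nat
  defines "P \<equiv> (1 - q) * q\<^sup>2" and "b \<equiv> real a"
  assumes q: "0 < q" "q < 1" and big: "10000 \<le> P * b" "1000 * \<Delta> \<le> P * b"
    and \<Delta>: "30 \<le> \<Delta>" "b \<le> \<Delta>\<^sup>2" "24 * \<Delta> \<le> (P / 10)\<^sup>2 * b" "\<Delta> = sqrt b * ln b"
    and L: "L = nat \<lfloor>4 * (1 - q) * b\<rfloor>"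
    and n: "\<bar>real (L - 2) - (1 - q\<^sup>2) * real (n - 1)\<bar> \<le> \<Delta>" "1 \<le> n" "n \<le> 5 * a"
  shows "L \<le> n"
    "(\<Sum>v\<in>bitstrings L. path_weight (1 / (1 + q)) True v * (flip_count_sum a L (n - 1) v / real (n choose L))\<^sup>2)
      \<le> (4 / P)\<^sup>2 * walk_bound P b"
proof -
  define R where "R = n - 1"
  have n_eq: "n = Suc R" using n by (simp add: R_def)
  have R5: "R \<le> 5 * a" using n by (simp add: R_def)
  note par = defect_walk_params[OF q big[unfolded P_def b_def] \<Delta>(1) \<Delta>(2)[unfolded b_def] \<Delta>(3)[unfolded P_def b_def]
      L[unfolded b_def] n(1)[folded R_def] R5, folded P_def b_def]
  interpret defect_walk q a L R b "P / 10" "b * \<Delta>" by (rule par(1))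
  have P: "0 < P" using q by (simp add: P_def)
  have b: "0 < b" using A by simp
  have "0 < P * b" using P b by simp
  then have KR': "K < R" using par(2) by (simp add: K_def)
  then show "L \<le> n" using par(4) by (simp add: n_eq K_def)
  have Kp: "K + 2 = L" using par(4) by (simp add: K_def)
  define x where "x = real (R choose K) / real (Suc R choose L)"
  have x: "0 \<le> x" "x \<le> 4 / P"
  proof -
    have "x \<le> (real K + 2) / (real R - real K)" unfolding x_def by (rule choose_ratio_le[OF KR', unfolded Kp])
    also have "\<dots> \<le> (4 * b) / (P * b)"
      using par(2,5) Kp P b by (intro frac_le) (auto simp: K_def)
    finally show "x \<le> 4 / P" using b by simp
  qed (simp add: x_def)
  have "flip_count_sum a L (n - 1) v / real (n choose L) = x * path_sum (flip_term a G) 0 0 True v" for v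
  proof -
    have C: "real (R choose K) \<noteq> 0" using KR' by simp
    then have "split_count R L = (\<lambda>s k. real (R choose K) * G s k)"
      by (simp add: G_def fun_eq_iff)
    then have "flip_count_sum a L (n - 1) v = real (R choose K) * path_sum (flip_term a G) 0 0 True v"
      unfolding flip_count_sum_def R_def[symmetric] by (simp only: path_sum_flip_term_cmult)
    then show ?thesis by (simp add: x_def n_eq del: binomial_Suc_Suc)
  qed
  then have "(\<Sum>v\<in>bitstrings L. path_weight (1 / (1 + q)) True v * (flip_count_sum a L (n - 1) v / real (n choose L))\<^sup>2)
    = x\<^sup>2 * (\<Sum>v\<in>bitstrings L. path_weight r True v * (path_sum (flip_term a G) 0 0 True v)\<^sup>2)"
    by (simp add: r_def sum_distrib_left power_mult_distrib mult_ac)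
  also have "\<dots> \<le> (4 / P)\<^sup>2 * walk_bound P b"
  proof (intro mult_mono)
    have \<kappa>: "\<kappa> = ln b / sqrt b * (100 / P\<^sup>2)"
    proof -
      have "\<Delta> / b = ln b / sqrt b"
        using b unfolding \<Delta>(4) by (simp add: field_simps)
      moreover have "\<kappa> = \<Delta> / b * (100 / P\<^sup>2)"
        using b by (simp add: \<kappa>_def power_divide power2_eq_square)
      ultimately show ?thesis by simp
    qed
    have \<tau>: "\<tau> = 2 * (5 * b + 1) * exp (- (ln b)\<^sup>2 / 250)"
    proof -
      have "(b * \<Delta>)\<^sup>2 / (250 * b ^ 3) = (ln b)\<^sup>2 / 250"
      proof -
        have "\<Delta>\<^sup>2 = b * (ln b)\<^sup>2" using b unfolding \<Delta>(4) by (simp add: power_mult_distrib)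
        then have "(b * \<Delta>)\<^sup>2 = b ^ 3 * (ln b)\<^sup>2"
          by (simp add: power_mult_distrib power2_eq_square power3_eq_cube)
        then show ?thesis using b by simp
      qed
      then show ?thesis by (simp add: \<tau>_def)
    qed
    have D: "5 * (b * \<Delta>) / b = 5 * (sqrt b * ln b)" using b unfolding \<Delta>(4) by simp
    have Lb: "real L \<le> 4 * b" by (rule par(5))
    have "(\<Sum>v\<in>bitstrings L. path_weight r True v * (path_sum (flip_term a G) 0 0 True v)\<^sup>2)
      \<le> 16 * (4500000 * \<kappa> ^ 4 * (5 * (b * \<Delta>) / b) + 32 * \<tau>\<^sup>2 * real L)
       + 4 * (36000 * \<kappa> ^ 3 * (5 * (b * \<Delta>) / b) + 8 * \<tau> * real L)\<^sup>2 + 8 * \<tau>\<^sup>2"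
      by (rule second_moment_le)
    also have "\<dots> \<le> 16 * (4500000 * \<kappa> ^ 4 * (5 * (b * \<Delta>) / b) + 32 * \<tau>\<^sup>2 * (4 * b))
       + 4 * (36000 * \<kappa> ^ 3 * (5 * (b * \<Delta>) / b) + 8 * \<tau> * (4 * b))\<^sup>2 + 8 * \<tau>\<^sup>2"
      using Lb \<tau>_nonneg \<kappa>_pos b \<Delta>(1)
      by (intro add_mono mult_left_mono power_mono order_refl) auto
    also have "\<dots> = walk_bound P b"
      by (simp only: D \<kappa> \<tau> walk_bound_def Let_def)
    finally show "(\<Sum>v\<in>bitstrings L. path_weight r True v * (path_sum (flip_term a G) 0 0 True v)\<^sup>2) \<le> walk_bound P b" .
    show "x\<^sup>2 \<le> (4 / P)\<^sup>2" using x by (intro power_mono) auto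
    have "0 \<le> path_weight r True v" for v by (rule path_weight_nonneg) (use r in auto)
    then show "0 \<le> (\<Sum>v\<in>bitstrings L. path_weight r True v * (path_sum (flip_term a G) 0 0 True v)\<^sup>2)"
      by (intro sum_nonneg mult_nonneg_nonneg) auto
  qed simp
  finally show "(\<Sum>v\<in>bitstrings L. path_weight (1 / (1 + q)) True v * (flip_count_sum a L (n - 1) v / real (n choose L))\<^sup>2)
      \<le> (4 / P)\<^sup>2 * walk_bound P b" .
qed

lemma walk_bound_nonneg: "1 \<le> b \<Longrightarrow> 0 \<le> walk_bound P b"
  unfolding walk_bound_def Let_def by (intro add_nonneg_nonneg mult_nonneg_nonneg) auto

lemma trace_chi_str_le_bound:
  fixes q :: real and a :: nat
  defines "p \<equiv> 1 - q" and "P \<equiv> (1 - q) * q\<^sup>2" and "b \<equiv> real a"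
  assumes q: "0 < q" "q < 1" and big: "10000 \<le> P * b" "1000 * (sqrt b * ln b) \<le> P * b"
    and \<Delta>: "30 \<le> sqrt b * ln b" "b \<le> (sqrt b * ln b)\<^sup>2" "24 * (sqrt b * ln b) \<le> (P / 10)\<^sup>2 * b"
  shows "trace_chi q (str_x a) (str_y a) \<le> str_bound q b"
proof -
  define \<Delta> where "\<Delta> = sqrt b * ln b"
  define L where "L = nat \<lfloor>4 * (1 - q) * b\<rfloor>"
  have p: "0 < p" "p < 1" using q by (auto simp: p_def)
  have q2: "0 < q\<^sup>2" "q\<^sup>2 < 1" using q power_less_one_iff[of q 2] by auto
  have P: "0 < P" "P \<le> p" using q p q2 by (auto simp: P_def p_def mult_left_le)
  have Pb: "P * b \<le> p * b" using P by (intro mult_right_mono) (auto simp: b_def)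
  have pb: "10000 \<le> p * b" using Pb big by linarith
  have "p * b \<le> 1 * b" using p by (intro mult_right_mono) (auto simp: b_def)
  then have b: "10000 \<le> b" using pb by simp
  have a0: "0 < a" using b by (simp add: b_def)
  have "0 \<le> 4 * (1 - q) * b" using q b by simp
  then have "real L = of_int \<lfloor>4 * (1 - q) * b\<rfloor>" unfolding L_def by (intro of_nat_nat) simp
  moreover have "4 * (1 - q) * b = 4 * (p * b)" by (simp add: p_def)
  ultimately have "real L = of_int \<lfloor>4 * (p * b)\<rfloor>" by (simp only:)
  then have L1: "real L \<le> 4 * (p * b)" "4 * (p * b) - 1 < real L" by linarith+
  have L4: "real L \<le> 4 * b" using L1 \<open>p * b \<le> 1 * b\<close> by simp
  have L3: "3 \<le> L" using L1 pb by linarith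
  have p01: "0 \<le> p" "p \<le> 1" using p by auto
  \<comment> \<open>\<open>L\<close> is at most \<open>4 * p * b\<close> while the mean trace length
    exceeds \<open>6 * p * b\<close>: Hoeffding's inequality at distance
    \<open>2 * p * b\<close>.\<close>
  have first: "(\<Sum>l\<le>L. pmf (binomial_pmf (6 * a + 2) p) l) \<le> (4 * b + 1) * (2 * exp (- (p\<^sup>2 * b)))"
  proof -
    have "pmf (binomial_pmf (6 * a + 2) p) l \<le> 2 * exp (- (p\<^sup>2 * b))" if "l \<le> L" for l
    proof -
      define n where "n = real (6 * a + 2)"
      have n: "n = 6 * b + 2" "0 < n" using b by (simp_all add: n_def b_def)
      have "2 * (p * b) \<le> n * p - real l"
        using that L1 p n by (simp add: algebra_simps)
      then have "(2 * (p * b))\<^sup>2 \<le> (n * p - real l)\<^sup>2" using p b by (intro power_mono) auto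
      then have "2 * (2 * (p * b))\<^sup>2 / (8 * b) \<le> 2 * (real l - n * p)\<^sup>2 / n"
        using n b by (intro frac_le) (auto simp: power2_commute)
      moreover have "2 * (2 * (p * b))\<^sup>2 / (8 * b) = p\<^sup>2 * b" using b by (simp add: power2_eq_square)
      ultimately have "exp (- 2 * (real l - n * p)\<^sup>2 / n) \<le> exp (- (p\<^sup>2 * b))" by simp
      moreover have "pmf (binomial_pmf (6 * a + 2) p) l \<le> 2 * exp (- 2 * (real l - n * p)\<^sup>2 / n)"
        unfolding n_def by (rule pmf_binomial_le_exp[OF p01]) simp
      ultimately show ?thesis by linarith
    qed
    then have "(\<Sum>l\<le>L. pmf (binomial_pmf (6 * a + 2) p) l) \<le> (\<Sum>l\<le>L. 2 * exp (- (p\<^sup>2 * b)))"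
      by (intro sum_mono) auto
    also have "\<dots> = (real L + 1) * (2 * exp (- (p\<^sup>2 * b)))" by (simp add: add.commute)
    also have "\<dots> \<le> (4 * b + 1) * (2 * exp (- (p\<^sup>2 * b)))" using L4 by (intro mult_right_mono) auto
    finally show ?thesis .
  qed
  \<comment> \<open>Such a prefix has at most about \<open>2 * p * b\<close> surviving bits on
    average, so \<open>L\<close> survivors lie at distance at least \<open>p * b\<close> from the
    mean.\<close>
  have second: "(\<Sum>t<2 * a + 2. pmf (binomial_pmf t p) L) \<le> (2 * b + 2) * (2 * exp (- (p\<^sup>2 * b / 2)))"
  proof -
    have "pmf (binomial_pmf t p) L \<le> 2 * exp (- (p\<^sup>2 * b / 2))" if t: "t < 2 * a + 2" for t
    proof (cases "t = 0")
      case True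
      then show ?thesis using p01 L3 by (simp add: binomial_pmf_0)
    next
      case False
      have tb: "real t \<le> 2 * b + 1" using t by (simp add: b_def)
      then have "real t * p \<le> (2 * b + 1) * p" using p by (intro mult_right_mono) auto
      then have "p * b \<le> real L - real t * p"
        using L1 pb p by (simp add: algebra_simps)
      then have "(p * b)\<^sup>2 \<le> (real L - real t * p)\<^sup>2" using p b by (intro power_mono) auto
      then have "2 * (p * b)\<^sup>2 / (4 * b) \<le> 2 * (real L - real t * p)\<^sup>2 / real t"
        using tb b False by (intro frac_le) auto
      moreover have "2 * (p * b)\<^sup>2 / (4 * b) = p\<^sup>2 * b / 2" using b by (simp add: power2_eq_square)
      ultimately have "exp (- 2 * (real L - real t * p)\<^sup>2 / real t) \<le> exp (- (p\<^sup>2 * b / 2))" by simp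
      moreover have "pmf (binomial_pmf t p) L \<le> 2 * exp (- 2 * (real L - real t * p)\<^sup>2 / real t)"
        by (rule pmf_binomial_le_exp[OF p01]) (use False in simp)
      ultimately show ?thesis by linarith
    qed
    then have "(\<Sum>t<2 * a + 2. pmf (binomial_pmf t p) L) \<le> (\<Sum>t<2 * a + 2. 2 * exp (- (p\<^sup>2 * b / 2)))"
      by (intro sum_mono) auto
    then show ?thesis by (simp add: b_def algebra_simps)
  qed
  have M0: "0 \<le> (4 / P)\<^sup>2 * walk_bound P b"
    using walk_bound_nonneg[of b P] b by simp
  have "trace_chi q (str_x a) (str_y a) \<le>
      2 * (\<Sum>l\<le>L. pmf (binomial_pmf (6 * a + 2) (1 - q)) l)
    + 2 * (\<Sum>t<2 * a + 2. pmf (binomial_pmf t (1 - q)) L)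
    + q / (1 - q\<^sup>2) * ((4 / P)\<^sup>2 * walk_bound P b)
    + 20 * real a * real L * (q * ((1 - q\<^sup>2)\<^sup>2 / q\<^sup>2)) * exp (- (2 * \<Delta>\<^sup>2 / (5 * real a)))"
  proof (rule trace_chi_str_le[OF q a0 L3 _ _ M0])
    show "L \<le> 4 * a" using L4 by (simp add: b_def)
    show "0 \<le> \<Delta>" using \<Delta> by (simp add: \<Delta>_def)
    show "L \<le> n \<and> (\<Sum>v\<in>bitstrings L. path_weight (1 / (1 + q)) True v *
         (flip_count_sum a L (n - 1) v / real (n choose L))\<^sup>2) \<le> (4 / P)\<^sup>2 * walk_bound P b"
      if n: "1 \<le> n" "n \<le> 5 * a" "\<bar>real (L - 2) - (1 - q\<^sup>2) * real (n - 1)\<bar> \<le> \<Delta>" for n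
      using flip_count_sum_moment_le[OF q big(1)[unfolded P_def b_def] big(2)[unfolded P_def b_def]
          \<Delta>(1)[unfolded b_def] \<Delta>(2)[unfolded b_def] \<Delta>(3)[unfolded P_def b_def] refl
          L_def[unfolded b_def] n(3)[unfolded \<Delta>_def b_def] n(1,2)]
      unfolding P_def b_def by blast
  qed
  also have "\<dots> \<le> 2 * ((4 * b + 1) * (2 * exp (- (p\<^sup>2 * b)))) + 2 * ((2 * b + 2) * (2 * exp (- (p\<^sup>2 * b / 2))))
    + q / (1 - q\<^sup>2) * ((4 / P)\<^sup>2 * walk_bound P b)
    + 80 * (q * ((1 - q\<^sup>2)\<^sup>2 / q\<^sup>2)) * (b\<^sup>2 * exp (- (2 * (ln b)\<^sup>2 / 5)))"
  proof (intro add_mono order_refl mult_left_mono)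
    show "(\<Sum>l\<le>L. pmf (binomial_pmf (6 * a + 2) (1 - q)) l) \<le> (4 * b + 1) * (2 * exp (- (p\<^sup>2 * b)))"
      using first by (simp only: p_def)
    show "(\<Sum>t<2 * a + 2. pmf (binomial_pmf t (1 - q)) L) \<le> (2 * b + 2) * (2 * exp (- (p\<^sup>2 * b / 2)))"
      using second by (simp only: p_def)
    have "2 * \<Delta>\<^sup>2 / (5 * b) = 2 * (ln b)\<^sup>2 / 5"
      using b by (simp add: \<Delta>_def power_mult_distrib)
    then have e: "exp (- (2 * \<Delta>\<^sup>2 / (5 * real a))) = exp (- (2 * (ln b)\<^sup>2 / 5))" by (simp add: b_def)
    have "20 * b * real L * (q * ((1 - q\<^sup>2)\<^sup>2 / q\<^sup>2)) \<le> 20 * b * (4 * b) * (q * ((1 - q\<^sup>2)\<^sup>2 / q\<^sup>2))"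
      using L4 b q by (intro mult_right_mono mult_left_mono) auto
    then have "20 * b * real L * (q * ((1 - q\<^sup>2)\<^sup>2 / q\<^sup>2)) * exp (- (2 * (ln b)\<^sup>2 / 5))
      \<le> 20 * b * (4 * b) * (q * ((1 - q\<^sup>2)\<^sup>2 / q\<^sup>2)) * exp (- (2 * (ln b)\<^sup>2 / 5))"
      by (rule mult_right_mono) simp
    then show "20 * real a * real L * (q * ((1 - q\<^sup>2)\<^sup>2 / q\<^sup>2)) * exp (- (2 * \<Delta>\<^sup>2 / (5 * real a)))
      \<le> 80 * (q * ((1 - q\<^sup>2)\<^sup>2 / q\<^sup>2)) * (b\<^sup>2 * exp (- (2 * (ln b)\<^sup>2 / 5)))"
      unfolding e unfolding b_def[symmetric] power2_eq_square[of b] by (simp only: mult_ac)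
  qed simp_all
  also have "\<dots> \<le> str_bound q b"
  proof -
    have "0 \<le> (4 * b + 1) * exp (- (p\<^sup>2 * b))" "0 \<le> (2 * b + 2) * exp (- (p\<^sup>2 * b / 2))"
      using b by auto
    then show ?thesis unfolding str_bound_def p_def P_def by (simp add: mult.assoc)
  qed
  finally show ?thesis .
qed

theorem trace_chi_str_asymptotic:
  fixes q :: real
  assumes q: "0 < q" "q < 1"
  shows "\<exists>C>0. \<forall>\<^sub>F a in sequentially.
    trace_chi q (str_x a) (str_y a) \<le> C * (ln (real a) ^ 5 / real a powr (3/2))"
proof -
  define P where "P = (1 - q) * q\<^sup>2"
  have P: "0 < P" using q by (simp add: P_def)
  have P2: "0 < (P / 10)\<^sup>2" using P by simp
  obtain C where C: "C > 0" "\<forall>\<^sub>F b in at_top. norm (str_bound q b) \<le> C * norm (ln b ^ 5 / b powr (3/2))"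
    using landau_o.bigE[OF str_bound_bigo[OF q(2)]] by blast
  have "\<forall>\<^sub>F b in at_top. 10000 \<le> P * b \<and> 1000 * (sqrt b * ln b) \<le> P * b"
    using P by (intro eventually_conj; real_asymp)
  moreover have "\<forall>\<^sub>F b::real in at_top. 30 \<le> sqrt b * ln b \<and> b \<le> (sqrt b * ln b)\<^sup>2"
    by (intro eventually_conj; real_asymp)
  moreover have "\<forall>\<^sub>F b::real in at_top. 24 * (sqrt b * ln b) \<le> r * b" if "0 < r" for r
    using that by real_asymp
  from this[OF P2] have "\<forall>\<^sub>F b::real in at_top. 24 * (sqrt b * ln b) \<le> (P / 10)\<^sup>2 * b" .
  moreover note C(2)
  moreover have "\<forall>\<^sub>F b::real in at_top. 1 \<le> b" by (rule eventually_ge_at_top)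
  ultimately have "\<forall>\<^sub>F b in at_top. (10000 \<le> P * b \<and> 1000 * (sqrt b * ln b) \<le> P * b) \<and>
      (30 \<le> sqrt b * ln b \<and> b \<le> (sqrt b * ln b)\<^sup>2) \<and> 24 * (sqrt b * ln b) \<le> (P / 10)\<^sup>2 * b
      \<and> str_bound q b \<le> C * (ln b ^ 5 / b powr (3/2))"
  proof eventually_elim
    case (elim b)
    have "norm (ln b ^ 5 / b powr (3/2)) = ln b ^ 5 / b powr (3/2)" using elim(5) by simp
    moreover have "str_bound q b \<le> norm (str_bound q b)" by simp
    ultimately have "str_bound q b \<le> C * (ln b ^ 5 / b powr (3/2))" using elim(4) by (simp only:) 
    then show ?case using elim by blast
  qed
  then have "\<forall>\<^sub>F a in sequentially. (10000 \<le> P * real a \<and> 1000 * (sqrt (real a) * ln (real a)) \<le> P * real a) \<and>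
      (30 \<le> sqrt (real a) * ln (real a) \<and> real a \<le> (sqrt (real a) * ln (real a))\<^sup>2)
      \<and> 24 * (sqrt (real a) * ln (real a)) \<le> (P / 10)\<^sup>2 * real a
      \<and> str_bound q (real a) \<le> C * (ln (real a) ^ 5 / real a powr (3/2))"
    by (rule eventually_compose_filterlim[OF _ filterlim_real_sequentially])
  then have "\<forall>\<^sub>F a in sequentially. trace_chi q (str_x a) (str_y a) \<le> C * (ln (real a) ^ 5 / real a powr (3/2))"
  proof eventually_elim
    case (elim a)
    have "trace_chi q (str_x a) (str_y a) \<le> str_bound q (real a)"
      by (rule trace_chi_str_le_bound) (use q elim in \<open>auto simp: P_def\<close>)
    then show ?case using elim by linarith
  qed
  then show ?thesis using C(1) by blast
qed

section \<open>From blocks to random strings\<close>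

definition tuple_prob :: "real \<Rightarrow> bool list \<Rightarrow> bool list list \<Rightarrow> real" where
  "tuple_prob q x us = (\<Prod>u\<leftarrow>us. trace_prob q x u)"

lemma tuple_prob_simps [simp]:
  "tuple_prob q x [] = 1" "tuple_prob q x (u # us) = trace_prob q x u * tuple_prob q x us"
  by (simp_all add: tuple_prob_def)

lemma tuple_prob_nonneg: "0 \<le> q \<Longrightarrow> q \<le> 1 \<Longrightarrow> 0 \<le> tuple_prob q x us"
  by (induction us) (auto intro!: mult_nonneg_nonneg trace_prob_nonneg)

lemma tuples_0 [simp]: "tuples 0 A = {[]}"
  by (auto simp: tuples_def)

lemma tuples_Suc: "tuples (Suc T) A = (\<lambda>(u, us). u # us) ` (A \<times> tuples T A)"
  by (auto simp: tuples_def length_Suc_conv image_iff)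

lemma finite_tuples: "finite A \<Longrightarrow> finite (tuples T A)"
  by (induction T) (auto simp: tuples_Suc)

lemma sum_tuples_Suc:
  "(\<Sum>us\<in>tuples (Suc T) A. f us) = (\<Sum>u\<in>A. \<Sum>us\<in>tuples T A. f (u # us))"
  unfolding tuples_Suc
  by (subst sum.reindex) (auto simp: inj_on_def sum.cartesian_product case_prod_unfold)

lemma sum_tuples_prod: "(\<Sum>us\<in>tuples T A. \<Prod>u\<leftarrow>us. f u) = (\<Sum>u\<in>A. f u :: real) ^ T"
proof (induction T)
  case (Suc T)
  have "(\<Sum>us\<in>tuples (Suc T) A. \<Prod>u\<leftarrow>us. f u) = (\<Sum>u\<in>A. f u * (\<Sum>us\<in>tuples T A. \<Prod>u\<leftarrow>us. f u))"
    by (simp add: sum_tuples_Suc sum_distrib_left)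
  then show ?case by (simp add: Suc sum_distrib_right)
qed simp

lemma sum_trace_prob_upto:
  assumes "0 \<le> q" "q \<le> 1" "length x \<le> n"
  shows "(\<Sum>u\<in>bitstrings_upto n. trace_prob q x u) = 1"
proof -
  have "set_pmf (trace_pmf q x) \<subseteq> bitstrings_upto n"
    using set_pmf_trace_subset[of q x] assms(3) by (auto simp: bitstrings_upto_def)
  then have "sum (pmf (trace_pmf q x)) (bitstrings_upto n) = 1"
    by (intro sum_pmf_eq_1 finite_bitstrings_upto)
  then show ?thesis using assms by (simp add: pmf_trace_pmf)
qed

lemma sum_tuple_prob:
  assumes "0 \<le> q" "q \<le> 1" "length x \<le> n"
  shows "(\<Sum>us\<in>tuples T (bitstrings_upto n). tuple_prob q x us) = 1"
  unfolding tuple_prob_def sum_tuples_prod sum_trace_prob_upto[OF assms] by simp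

lemma sum_trace_prob_append:
  assumes q: "0 \<le> q" "q \<le> 1"
  shows "(\<Sum>u\<in>bitstrings_upto (length x + length y). trace_prob q (x @ y) u * F u) =
    (\<Sum>u\<in>bitstrings_upto (length x). \<Sum>w\<in>bitstrings_upto (length y).
       trace_prob q x u * trace_prob q y w * (F (u @ w) :: real))"
proof -
  let ?E = "measure_pmf.expectation"
  have fin: "finite (set_pmf (trace_pmf q z))" for z
    using finite_subset[OF set_pmf_trace_subset finite_bitstrings_upto] .
  have sum_E: "?E (trace_pmf q z) G = (\<Sum>u\<in>bitstrings_upto k. trace_prob q z u * G u)"
    if "length z = k" for z k and G :: "bool list \<Rightarrow> real"
  proof -
    have "?E (trace_pmf q z) G = (\<Sum>u\<in>bitstrings_upto k. G u * pmf (trace_pmf q z) u)"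
      by (rule integral_measure_pmf_real[OF finite_bitstrings_upto]) (use set_pmf_trace_subset that in blast)
    then show ?thesis using q by (simp add: pmf_trace_pmf mult.commute)
  qed
  have "?E (trace_pmf q (x @ y)) F =
      (\<Sum>u\<in>bitstrings_upto (length x). pmf (trace_pmf q x) u *\<^sub>R ?E (map_pmf (\<lambda>w. u @ w) (trace_pmf q y)) F)"
    unfolding trace_pmf_append
    by (rule pmf_expectation_bind) (use finite_bitstrings_upto set_pmf_trace_subset fin in auto)
  then show ?thesis
    using q sum_E[of "x @ y" "length x + length y" F] sum_E[OF refl, of y]
    by (simp add: pmf_trace_pmf sum_distrib_left mult.assoc)
qed

text \<open>The traces of a concatenation are concatenations of independent traces. On the
  right-hand side the cut points are visible, which is the extra information revealed.\<close>

lemma sum_tuple_prob_append: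
  assumes q: "0 \<le> q" "q \<le> 1"
  shows "(\<Sum>us\<in>tuples T (bitstrings_upto (length x + length y)). tuple_prob q (x @ y) us * F us) =
    (\<Sum>us\<in>tuples T (bitstrings_upto (length x)). \<Sum>ws\<in>tuples T (bitstrings_upto (length y)).
       tuple_prob q x us * tuple_prob q y ws * (F (map2 (@) us ws) :: real))"
proof (induction T arbitrary: F)
  case (Suc T)
  let ?U = "bitstrings_upto (length x)" and ?V = "bitstrings_upto (length y)"
  have "(\<Sum>us\<in>tuples (Suc T) (bitstrings_upto (length x + length y)). tuple_prob q (x @ y) us * F us)
    = (\<Sum>u\<in>bitstrings_upto (length x + length y). trace_prob q (x @ y) u *
        (\<Sum>us\<in>tuples T (bitstrings_upto (length x + length y)). tuple_prob q (x @ y) us * F (u # us)))"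
    by (simp add: sum_tuples_Suc sum_distrib_left mult.assoc)
  also have "\<dots> = (\<Sum>u\<in>?U. \<Sum>w\<in>?V. trace_prob q x u * trace_prob q y w *
       (\<Sum>us\<in>tuples T ?U. \<Sum>ws\<in>tuples T ?V. tuple_prob q x us * tuple_prob q y ws * F ((u @ w) # map2 (@) us ws)))"
    unfolding Suc by (rule sum_trace_prob_append[OF q])
  also have "\<dots> = (\<Sum>u\<in>?U. \<Sum>w\<in>?V. \<Sum>us\<in>tuples T ?U. \<Sum>ws\<in>tuples T ?V.
       tuple_prob q x (u # us) * tuple_prob q y (w # ws) * F (map2 (@) (u # us) (w # ws)))"
    by (simp add: sum_distrib_left mult_ac)
  also have "\<dots> = (\<Sum>u\<in>?U. \<Sum>us\<in>tuples T ?U. \<Sum>w\<in>?V. \<Sum>ws\<in>tuples T ?V.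
       tuple_prob q x (u # us) * tuple_prob q y (w # ws) * F (map2 (@) (u # us) (w # ws)))"
    by (rule sum.cong[OF refl], rule sum.swap)
  also have "\<dots> = (\<Sum>us\<in>tuples (Suc T) ?U. \<Sum>ws\<in>tuples (Suc T) ?V.
       tuple_prob q x us * tuple_prob q y ws * F (map2 (@) us ws))"
    unfolding sum_tuples_Suc ..
  finally show ?case .
qed simp

lemma pmf_replicate_pmf:
  "pmf (replicate_pmf T p) us = (if length us = T then \<Prod>u\<leftarrow>us. pmf p u else 0)"
proof (induction T arbitrary: us)
  case (Suc T)
  have S: "replicate_pmf (Suc T) p = map_pmf (\<lambda>(u, us). u # us) (pair_pmf p (replicate_pmf T p))"
    by (simp add: pair_pmf_def map_bind_pmf)
  have inj: "inj (\<lambda>(u, us). u # us)" by (auto simp: inj_def)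
  show ?case
  proof (cases us)
    case Nil
    have "pmf (replicate_pmf (Suc T) p) [] = 0" unfolding S by (intro pmf_map_outside) auto
    then show ?thesis using Nil by simp
  next
    case (Cons u ws)
    show ?thesis unfolding S using pmf_map_inj'[OF inj, of _ "(u, ws)"]
      by (simp add: Cons pmf_pair Suc)
  qed
qed (auto simp: indicator_def)

text \<open>The success probability times \<open>2 ^ n\<close>, see
  \<open>prob_random_string_traces\<close>. Here \<open>g\<close> ranges over all functions, because
  the induction over blocks derives new estimators from \<open>g\<close>.\<close>

definition success_weight :: "real \<Rightarrow> nat \<Rightarrow> nat \<Rightarrow> (bool list list \<Rightarrow> bool list) \<Rightarrow> real" where
  "success_weight q T n g = (\<Sum>x\<in>bitstrings n. \<Sum>us\<in>tuples T (bitstrings_upto n).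
     tuple_prob q x us * of_bool (g us = x))"

lemma card_bitstrings: "card (bitstrings n) = 2 ^ n"
  using card_lists_length_eq[of "UNIV :: bool set" n] by (simp add: bitstrings_def)

lemma prob_random_string_traces:
  assumes q: "0 \<le> q" "q \<le> 1"
  shows "measure_pmf.prob (random_string_traces_pmf q n T) {(x, us). g us = x} = success_weight q T n g / 2 ^ n"
proof -
  let ?M = "random_string_traces_pmf q n T"
  let ?S = "bitstrings n \<times> tuples T (bitstrings_upto n)"
  have pmf: "pmf ?M (x, us) = tuple_prob q x us / 2 ^ n" if "(x, us) \<in> ?S" for x us
  proof -
    have inj: "inj (Pair y)" for y :: "bool list" by (auto simp: inj_def)
    have tr: "pmf (trace_pmf q x) = trace_prob q x" by (rule ext) (rule pmf_trace_pmf[OF q])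
    have *: "pmf (map_pmf (Pair y) (replicate_pmf T (trace_pmf q y))) (x, us)
        = (if y = x then tuple_prob q x us else 0)" for y
    proof (cases "y = x")
      case True
      have "pmf (map_pmf (Pair x) (replicate_pmf T (trace_pmf q x))) (x, us) = pmf (replicate_pmf T (trace_pmf q x)) us"
        by (rule pmf_map_inj'[OF inj])
      also have "\<dots> = tuple_prob q x us"
        using that by (simp add: pmf_replicate_pmf tuples_def tuple_prob_def tr)
      finally show ?thesis using True by simp
    next
      case False
      then have "pmf (map_pmf (Pair y) (replicate_pmf T (trace_pmf q y))) (x, us) = 0"
        by (intro pmf_map_outside) auto
      then show ?thesis using False by simp
    qed
    have "pmf ?M (x, us) = (\<Sum>y\<in>bitstrings n. (if y = x then tuple_prob q x us else 0) * pmf (pmf_of_set (bitstrings n)) y)"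
      unfolding random_string_traces_pmf_def pmf_bind *
      by (rule integral_measure_pmf_real) (use bitstrings_nonempty finite_bitstrings in auto)
    also have "\<dots> = (\<Sum>y\<in>bitstrings n. if y = x then tuple_prob q x us / 2 ^ n else 0)"
      using bitstrings_nonempty[of n] finite_bitstrings[of n]
      by (intro sum.cong refl) (simp add: card_bitstrings)
    also have "\<dots> = tuple_prob q x us / 2 ^ n"
      using that finite_bitstrings[of n] by simp
    finally show ?thesis .
  qed
  have "set_pmf ?M \<subseteq> ?S"
  proof -
    have "us \<in> tuples T (bitstrings_upto n)"
      if "length us = T" "us \<in> lists (set_pmf (trace_pmf q x))" "length x = n" for us x
      using that set_pmf_trace_subset[of q x] by (auto simp: tuples_def)
    then show ?thesis
      using bitstrings_nonempty[of n] finite_bitstrings[of n]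
      by (auto simp: random_string_traces_pmf_def set_replicate_pmf bitstrings_def)
  qed
  then have "measure_pmf.prob ?M {(x, us). g us = x} = measure_pmf.prob ?M (?S \<inter> {(x, us). g us = x})"
    by (intro measure_eq_AE) (auto simp: AE_measure_pmf_iff)
  also have "\<dots> = (\<Sum>z\<in>?S \<inter> {(x, us). g us = x}. pmf ?M z)"
    by (rule measure_measure_pmf_finite) (auto intro: finite_subset[of _ ?S] simp: finite_bitstrings finite_tuples finite_bitstrings_upto)
  also have "\<dots> = (\<Sum>z\<in>?S. pmf ?M z * of_bool (g (snd z) = fst z))"
    by (rule sum.mono_neutral_cong_left) (auto simp: finite_bitstrings finite_tuples finite_bitstrings_upto)
  also have "\<dots> = (\<Sum>(x, us)\<in>?S. tuple_prob q x us * of_bool (g us = x) / 2 ^ n)"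
    by (intro sum.cong refl) (auto simp: pmf simp del: of_bool_eq_iff)
  finally show ?thesis
    unfolding success_weight_def by (simp add: sum.cartesian_product sum_divide_distrib split_def)
qed

section \<open>Product structure over blocks\<close>

lemma bitstrings_add: "bitstrings (m + n) = (\<lambda>(x, y). x @ y) ` (bitstrings m \<times> bitstrings n)"
proof
  show "bitstrings (m + n) \<subseteq> (\<lambda>(x, y). x @ y) ` (bitstrings m \<times> bitstrings n)"
  proof
    fix z :: "bool list" assume "z \<in> bitstrings (m + n)"
    then have "z = (\<lambda>(x, y). x @ y) (take m z, drop m z)" "(take m z, drop m z) \<in> bitstrings m \<times> bitstrings n"
      by (auto simp: bitstrings_def)
    then show "z \<in> (\<lambda>(x, y). x @ y) ` (bitstrings m \<times> bitstrings n)" by (rule image_eqI)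
  qed
qed (auto simp: bitstrings_def)

lemma sum_bitstrings_add:
  "(\<Sum>z\<in>bitstrings (m + n). f z) = (\<Sum>x\<in>bitstrings m. \<Sum>y\<in>bitstrings n. f (x @ y))"
  unfolding bitstrings_add
  by (subst sum.reindex) (auto simp: inj_on_def bitstrings_def sum.cartesian_product case_prod_unfold)

text \<open>One minus the total variation distance of the laws of \<open>T\<close> traces, for
  strings of equal length.\<close>

definition overlap :: "real \<Rightarrow> nat \<Rightarrow> bool list \<Rightarrow> bool list \<Rightarrow> real" where
  "overlap q T x y = (\<Sum>us\<in>tuples T (bitstrings_upto (length x)). min (tuple_prob q x us) (tuple_prob q y us))"

lemma success_weight_le: 
  assumes q: "0 \<le> q" "q \<le> 1"
  shows "success_weight q T n g \<le> 2 ^ n"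
proof -
  have "success_weight q T n g \<le> (\<Sum>x\<in>bitstrings n. \<Sum>us\<in>tuples T (bitstrings_upto n). tuple_prob q x us)"
    unfolding success_weight_def using tuple_prob_nonneg[OF q] by (intro sum_mono) (auto simp: of_bool_def)
  also have "\<dots> = (\<Sum>x\<in>bitstrings n. 1)"
    by (intro sum.cong refl sum_tuple_prob q) (auto simp: bitstrings_def)
  finally show ?thesis by (simp add: card_bitstrings)
qed

text \<open>
  The block is guessed from its own traces \<open>us\<close>; \<open>\<phi> us\<close> bounds the likelihood of every block, since
  the block \<open>x\<close> differs from \<open>x0\<close> or from \<open>y0\<close>.
\<close>

lemma success_weight_add:
  assumes q: "0 \<le> q" "q \<le> 1" and x0: "x0 \<in> bitstrings m" and y0: "y0 \<in> bitstrings m" and ne: "x0 \<noteq> y0"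
    and H: "\<And>g. success_weight q T n g \<le> H"
  shows "success_weight q T (m + n) g \<le> (2 ^ m - overlap q T x0 y0) * H"
proof -
  let ?U = "tuples T (bitstrings_upto m)" and ?V = "tuples T (bitstrings_upto n)"
  let ?P = "tuple_prob q"
  note nn = tuple_prob_nonneg[OF q]
  define \<phi> where "\<phi> = (\<lambda>us. (\<Sum>z\<in>bitstrings m. ?P z us) - min (?P x0 us) (?P y0 us))"
  have \<phi>: "?P x us \<le> \<phi> us" if x: "x \<in> bitstrings m" for x us
  proof -
    define w where "w = (if x = x0 then y0 else x0)"
    have w: "w \<noteq> x" "w \<in> bitstrings m" using ne x0 y0 by (auto simp: w_def)
    have "?P x us + ?P w us = (\<Sum>z\<in>{x, w}. ?P z us)" using w by simp
    also have "\<dots> \<le> (\<Sum>z\<in>bitstrings m. ?P z us)"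
      using x w by (intro sum_mono2) (auto simp: finite_bitstrings nn)
    finally have "?P x us + ?P w us \<le> (\<Sum>z\<in>bitstrings m. ?P z us)" .
    moreover have "min (?P x0 us) (?P y0 us) \<le> ?P w us" by (auto simp: w_def)
    ultimately show ?thesis by (simp add: \<phi>_def)
  qed
  have \<phi>0: "0 \<le> \<phi> us" for us using \<phi>[OF x0, of us] nn[of x0 us] by linarith
  define A where "A = (\<lambda>us x. \<Sum>y\<in>bitstrings n. \<Sum>ws\<in>?V. ?P y ws * of_bool (g (map2 (@) us ws) = x @ y))"
  have A0: "0 \<le> A us x" for us x unfolding A_def by (intro sum_nonneg mult_nonneg_nonneg nn) auto
  \<comment> \<open>For fixed traces \<open>us\<close> of the block, the answer of \<open>g\<close>
    without its first \<open>m\<close> bits is an estimator of the remaining string, to which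
    \<open>H\<close> applies; only one block \<open>x\<close> can match the first \<open>m\<close>
    bits.\<close>
  have A: "(\<Sum>x\<in>bitstrings m. A us x) \<le> H" for us
  proof -
    have "(\<Sum>x\<in>bitstrings m. A us x) = (\<Sum>y\<in>bitstrings n. \<Sum>ws\<in>?V. \<Sum>x\<in>bitstrings m. ?P y ws * of_bool (g (map2 (@) us ws) = x @ y))"
      unfolding A_def by (subst sum.swap) (intro sum.cong refl sum.swap)
    also have "\<dots> \<le> (\<Sum>y\<in>bitstrings n. \<Sum>ws\<in>?V. ?P y ws * of_bool (drop m (g (map2 (@) us ws)) = y))"
    proof (intro sum_mono)
      fix y ws
      define z where "z = g (map2 (@) us ws)"
      have "(\<Sum>x\<in>bitstrings m. ?P y ws * of_bool (z = x @ y))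
         \<le> (\<Sum>x\<in>bitstrings m. if x = take m z then ?P y ws * of_bool (drop m z = y) else 0)"
        by (intro sum_mono) (auto simp: bitstrings_def nn)
      also have "\<dots> \<le> ?P y ws * of_bool (drop m z = y)"
        using finite_bitstrings[of m] nn[of y ws] by (simp add: sum.delta')
      finally show "(\<Sum>x\<in>bitstrings m. ?P y ws * of_bool (g (map2 (@) us ws) = x @ y))
         \<le> ?P y ws * of_bool (drop m (g (map2 (@) us ws)) = y)" by (simp only: z_def)
    qed
    also have "\<dots> \<le> H" using H[of "\<lambda>ws. drop m (g (map2 (@) us ws))"] by (simp add: success_weight_def)
    finally show ?thesis .
  qed
  have "success_weight q T (m + n) g = (\<Sum>x\<in>bitstrings m. \<Sum>y\<in>bitstrings n. 
      \<Sum>us\<in>tuples T (bitstrings_upto (m + n)). ?P (x @ y) us * of_bool (g us = x @ y))"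
    unfolding success_weight_def by (rule sum_bitstrings_add)
  also have "\<dots> = (\<Sum>x\<in>bitstrings m. \<Sum>y\<in>bitstrings n. \<Sum>us\<in>?U. \<Sum>ws\<in>?V.
      ?P x us * ?P y ws * of_bool (g (map2 (@) us ws) = x @ y))"
  proof (rule sum.cong[OF refl], rule sum.cong[OF refl])
    fix x y :: "bool list" assume "x \<in> bitstrings m" "y \<in> bitstrings n"
    then have "length x = m" "length y = n" by (auto simp: bitstrings_def)
    then show "(\<Sum>us\<in>tuples T (bitstrings_upto (m + n)). ?P (x @ y) us * of_bool (g us = x @ y))
      = (\<Sum>us\<in>?U. \<Sum>ws\<in>?V. ?P x us * ?P y ws * of_bool (g (map2 (@) us ws) = x @ y))"
      using sum_tuple_prob_append[OF q, where T = T and x = x and y = y and F = "\<lambda>us. of_bool (g us = x @ y)"] by simp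
  qed
  also have "\<dots> = (\<Sum>x\<in>bitstrings m. \<Sum>us\<in>?U. \<Sum>y\<in>bitstrings n. \<Sum>ws\<in>?V.
      ?P x us * ?P y ws * of_bool (g (map2 (@) us ws) = x @ y))"
    by (rule sum.cong[OF refl], rule sum.swap)
  also have "\<dots> = (\<Sum>x\<in>bitstrings m. \<Sum>us\<in>?U. ?P x us * A us x)"
    unfolding A_def by (simp add: sum_distrib_left mult.assoc)
  also have "\<dots> = (\<Sum>us\<in>?U. \<Sum>x\<in>bitstrings m. ?P x us * A us x)"
    by (rule sum.swap)
  also have "\<dots> \<le> (\<Sum>us\<in>?U. \<phi> us * H)"
  proof (intro sum_mono)
    fix us
    have "(\<Sum>x\<in>bitstrings m. ?P x us * A us x) \<le> (\<Sum>x\<in>bitstrings m. \<phi> us * A us x)"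
      by (intro sum_mono mult_right_mono \<phi> A0)
    also have "\<dots> \<le> \<phi> us * H"
      unfolding sum_distrib_left[symmetric] by (intro mult_left_mono A \<phi>0)
    finally show "(\<Sum>x\<in>bitstrings m. ?P x us * A us x) \<le> \<phi> us * H" .
  qed
  also have "\<dots> = (\<Sum>us\<in>?U. \<phi> us) * H" by (simp add: sum_distrib_right)
  also have "(\<Sum>us\<in>?U. \<phi> us) = (\<Sum>z\<in>bitstrings m. \<Sum>us\<in>?U. ?P z us) - overlap q T x0 y0"
    unfolding \<phi>_def sum_subtractf overlap_def using x0 by (subst sum.swap) (simp add: bitstrings_def)
  also have "(\<Sum>z\<in>bitstrings m. \<Sum>us\<in>?U. ?P z us) = (\<Sum>z\<in>bitstrings m. 1)"
    by (intro sum.cong refl sum_tuple_prob q) (auto simp: bitstrings_def)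
  finally show ?thesis by (simp add: card_bitstrings)
qed

lemma overlap_nonneg: "0 \<le> q \<Longrightarrow> q \<le> 1 \<Longrightarrow> 0 \<le> overlap q T x y"
  unfolding overlap_def by (intro sum_nonneg) (auto intro: tuple_prob_nonneg)

lemma overlap_le_1:
  assumes q: "0 \<le> q" "q \<le> 1"
  shows "overlap q T x y \<le> 1"
proof -
  have "overlap q T x y \<le> (\<Sum>us\<in>tuples T (bitstrings_upto (length x)). tuple_prob q x us)"
    unfolding overlap_def by (intro sum_mono) auto
  then show ?thesis by (simp add: sum_tuple_prob[OF q])
qed

lemma success_weight_blocks:
  assumes q: "0 \<le> q" "q \<le> 1" and xy: "x0 \<in> bitstrings m" "y0 \<in> bitstrings m" "x0 \<noteq> y0"
  shows "success_weight q T (k * m + n) g \<le> (2 ^ m - overlap q T x0 y0) ^ k * 2 ^ n"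
proof (induction k arbitrary: g)
  case 0
  then show ?case using success_weight_le[OF q, of T n g] by simp
next
  case (Suc k)
  have "success_weight q T (m + (k * m + n)) g \<le> (2 ^ m - overlap q T x0 y0) * ((2 ^ m - overlap q T x0 y0) ^ k * 2 ^ n)"
    by (rule success_weight_add[OF q xy Suc])
  then show ?case by (simp add: add.assoc mult.assoc)
qed

text \<open>The \<open>n mod m\<close> bits left over are bounded by probability one; the blocks
  give \<open>(1 - \<omega> / 2 ^ m) ^ k\<close>, and \<open>1 - t \<le> exp (- t)\<close>.\<close>

lemma success_prob_le:
  assumes q: "0 \<le> q" "q \<le> 1" and xy: "x0 \<in> bitstrings m" "y0 \<in> bitstrings m" "x0 \<noteq> y0"
  shows "measure_pmf.prob (random_string_traces_pmf q n T) {(x, us). g us = x}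
     \<le> exp (- (real (n div m) * overlap q T x0 y0 / 2 ^ m))"
proof -
  define k where "k = n div m"
  define \<omega> where "\<omega> = overlap q T x0 y0"
  have n: "n = k * m + n mod m" by (simp add: k_def)
  have \<omega>: "0 \<le> \<omega>" "\<omega> \<le> 1" unfolding \<omega>_def by (rule overlap_nonneg[OF q] overlap_le_1[OF q])+
  have two: "(1::real) \<le> 2 ^ m" by simp
  have "success_weight q T n g \<le> (2 ^ m - \<omega>) ^ k * 2 ^ (n mod m)"
    using success_weight_blocks[OF q xy, of T k "n mod m" g] n by (simp add: \<omega>_def)
  moreover have "(2::real) ^ n = (2 ^ m) ^ k * 2 ^ (n mod m)"
    by (subst (1) n) (simp add: power_add mult.commute[of k m] power_mult)
  ultimately have "success_weight q T n g / 2 ^ n \<le> ((2 ^ m - \<omega>) / 2 ^ m) ^ k"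
    by (simp add: power_divide pos_divide_le_eq)
  also have "\<dots> \<le> (exp (- (\<omega> / 2 ^ m))) ^ k"
  proof (intro power_mono)
    show "(2 ^ m - \<omega>) / 2 ^ m \<le> exp (- (\<omega> / 2 ^ m))"
      using exp_ge_add_one_self[of "- (\<omega> / 2 ^ m)"] by (simp add: diff_divide_distrib)
    have "\<omega> \<le> 2 ^ m" using \<omega> two by linarith
    then show "0 \<le> (2 ^ m - \<omega>) / 2 ^ m" by simp
  qed
  also have "\<dots> = exp (- (real k * \<omega> / 2 ^ m))"
    by (simp add: exp_of_nat_mult[symmetric])
  finally show ?thesis unfolding prob_random_string_traces[OF q] k_def \<omega>_def .
qed

text \<open>Multiply by \<open>(sqrt x + sqrt y)\<^sup>2 \<ge> x + y\<close>. Summed up, the squared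
  Hellinger distance is at most the chi distance.\<close>

lemma sqrt_diff_square_le_chi:
  assumes "0 \<le> x" "0 \<le> y"
  shows "(sqrt x - sqrt y)\<^sup>2 \<le> chi x y"
proof (cases "x + y = 0")
  case False
  then have pos: "0 < x + y" using assms by linarith
  have "x + y \<le> (sqrt x + sqrt y)\<^sup>2" using assms by (simp add: power2_sum)
  then have "(sqrt x - sqrt y)\<^sup>2 * (x + y) \<le> (sqrt x - sqrt y)\<^sup>2 * (sqrt x + sqrt y)\<^sup>2"
    by (intro mult_left_mono) auto
  also have "\<dots> = ((sqrt x - sqrt y) * (sqrt x + sqrt y))\<^sup>2" by (simp only: power_mult_distrib)
  also have "(sqrt x - sqrt y) * (sqrt x + sqrt y) = (sqrt x)\<^sup>2 - (sqrt y)\<^sup>2"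
    by (simp add: power2_eq_square algebra_simps)
  also have "\<dots> = x - y" using assms by simp
  finally show ?thesis using pos by (simp add: chi_def pos_le_divide_eq)
qed (use assms in \<open>simp add: add_nonneg_eq_0_iff\<close>)

text \<open>The Bhattacharyya coefficient \<open>b\<close> of one trace satisfies
  \<open>b \<ge> 1 - J / 2 \<ge> 1 / (1 + J) \<ge> exp (- J)\<close>, where the middle step needs
  \<open>J \<le> 1\<close>, and it is multiplicative over the traces. Since the product of two
  numbers is that of their minimum and maximum, the Cauchy-Schwarz inequality gives
  \<open>b ^ (2 T) \<le> 2 * overlap\<close>, as the maxima sum to at most 2.\<close>

lemma overlap_ge:
  assumes q: "0 \<le> q" "q \<le> 1" and len: "length y = length x" and small: "trace_chi q x y \<le> 1"
  shows "exp (- (2 * real T * trace_chi q x y)) / 2 \<le> overlap q T x y"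
proof -
  define J where "J = trace_chi q x y"
  let ?U = "bitstrings_upto (length x)" and ?p = "trace_prob q x" and ?r = "trace_prob q y"
  let ?TU = "tuples T ?U"
  note nn = trace_prob_nonneg[OF q] and nnT = tuple_prob_nonneg[OF q]
  have J0: "0 \<le> J" unfolding J_def trace_chi_def by (intro sum_nonneg chi_nonneg nn)
  define b where "b = (\<Sum>u\<in>?U. sqrt (?p u * ?r u))"
  have "1 - J / 2 \<le> b"
  proof -
    have "(\<Sum>u\<in>?U. ?p u + ?r u - chi (?p u) (?r u)) \<le> (\<Sum>u\<in>?U. 2 * sqrt (?p u * ?r u))"
    proof (intro sum_mono)
      fix u
      have "(sqrt (?p u) - sqrt (?r u))\<^sup>2 = ?p u + ?r u - 2 * sqrt (?p u * ?r u)"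
        using nn[of x u] nn[of y u] by (simp add: power2_diff real_sqrt_mult)
      then show "?p u + ?r u - chi (?p u) (?r u) \<le> 2 * sqrt (?p u * ?r u)"
        using sqrt_diff_square_le_chi[OF nn nn, of x u y u] by simp
    qed
    moreover have "(\<Sum>u\<in>?U. ?p u) = 1" "(\<Sum>u\<in>?U. ?r u) = 1"
      by (rule sum_trace_prob_upto[OF q]; simp add: len)+
    ultimately show ?thesis
      by (simp add: sum.distrib sum_subtractf b_def J_def trace_chi_def sum_distrib_left[symmetric])
  qed
  moreover have "exp (- J) \<le> 1 - J / 2"
  proof -
    have "exp (- J) \<le> 1 / (1 + J)"
      using exp_ge_add_one_self[of J] J0 by (simp add: exp_minus field_simps)
    also have "\<dots> \<le> 1 - J / 2"
    proof -
      have "0 \<le> J * (1 - J)" using J0 small by (simp add: J_def)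
      then show ?thesis using J0 by (subst pos_divide_le_eq) (simp_all add: algebra_simps)
    qed
    finally show ?thesis .
  qed
  ultimately have "exp (- J) \<le> b" by linarith
  then have "exp (- J) ^ T \<le> b ^ T" by (intro power_mono) auto
  also have "b ^ T = (\<Sum>us\<in>?TU. sqrt (tuple_prob q x us * tuple_prob q y us))"
  proof -
    have "sqrt (tuple_prob q x us * tuple_prob q y us) = (\<Prod>u\<leftarrow>us. sqrt (?p u * ?r u))" for us
      by (induction us) (simp_all add: real_sqrt_mult mult_ac)
    then show ?thesis by (simp add: sum_tuples_prod b_def)
  qed
  finally have B: "exp (- J) ^ T \<le> (\<Sum>us\<in>?TU. sqrt (tuple_prob q x us * tuple_prob q y us))" .
  let ?m = "\<lambda>us. min (tuple_prob q x us) (tuple_prob q y us)" and ?M = "\<lambda>us. max (tuple_prob q x us) (tuple_prob q y us)"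
  have mM: "0 \<le> ?m us" "0 \<le> ?M us" for us using nnT[of x us] nnT[of y us] by auto
  have "exp (- (2 * real T * J)) = (exp (- J) ^ T)\<^sup>2"
    by (simp add: exp_of_nat_mult[symmetric] exp_double[symmetric] mult_ac)
  also have "\<dots> \<le> (\<Sum>us\<in>?TU. sqrt (tuple_prob q x us * tuple_prob q y us))\<^sup>2"
    using B by (intro power_mono) auto
  also have "(\<Sum>us\<in>?TU. sqrt (tuple_prob q x us * tuple_prob q y us)) = (\<Sum>us\<in>?TU. sqrt (?m us) * sqrt (?M us))"
    by (intro sum.cong refl) (auto simp: min_def max_def real_sqrt_mult)
  also have "\<dots>\<^sup>2 \<le> (\<Sum>us\<in>?TU. (sqrt (?m us))\<^sup>2) * (\<Sum>us\<in>?TU. (sqrt (?M us))\<^sup>2)"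
    by (rule Cauchy_Schwarz_ineq_sum)
  also have "\<dots> = overlap q T x y * (\<Sum>us\<in>?TU. ?M us)"
    using mM by (simp add: overlap_def)
  also have "\<dots> \<le> overlap q T x y * 2"
  proof (intro mult_left_mono overlap_nonneg q)
    have "(\<Sum>us\<in>?TU. ?M us) \<le> (\<Sum>us\<in>?TU. tuple_prob q x us + tuple_prob q y us)"
      using nnT by (intro sum_mono) (auto simp: max_def)
    also have "\<dots> = 2" using len by (simp add: sum.distrib sum_tuple_prob[OF q])
    finally show "(\<Sum>us\<in>?TU. ?M us) \<le> 2" .
  qed
  finally show ?thesis by (simp add: J_def)
qed

section \<open>Assembly and choice of constants\<close>

lemma str_ne: "str_x a \<noteq> str_y a"
proof
  assume "str_x a = str_y a"
  then have "str_x a ! (2 * a) = str_y a ! (2 * a)" by simp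
  moreover have "alt False (2 * a + 1) ! (2 * a) = False"
  proof -
    have "alt False (2 * a) @ alt False 1 = alt False (2 * a + 1)"
      using alt_append[of False "2 * a" 1] by simp
    then have "alt False (2 * a + 1) ! (2 * a) = (alt False (2 * a) @ [False]) ! (2 * a)" by simp
    then show ?thesis by (simp add: nth_append)
  qed
  ultimately show False by (simp add: str_x_def str_y_def nth_append del: alt.simps)
qed

lemma success_prob_str_le:
  assumes q: "0 < q" "q < 1" and J: "trace_chi q (str_x a) (str_y a) \<le> J" "J \<le> 1"
  shows "measure_pmf.prob (random_string_traces_pmf q n T) {(x, us). g us = x}
     \<le> exp (- (real (n div (6 * a + 2)) * exp (- (2 * real T * J)) / 2 ^ (6 * a + 3)))"
proof -
  let ?m = "6 * a + 2"
  have q': "0 \<le> q" "q \<le> 1" using q by auto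
  have "exp (- (2 * real T * J)) / 2 \<le> exp (- (2 * real T * trace_chi q (str_x a) (str_y a))) / 2"
    using J by (simp add: mult_left_mono)
  also have "\<dots> \<le> overlap q T (str_x a) (str_y a)"
    using J by (intro overlap_ge q') auto
  finally have "real (n div ?m) * (exp (- (2 * real T * J)) / 2) / 2 ^ ?m \<le>
     real (n div ?m) * overlap q T (str_x a) (str_y a) / 2 ^ ?m"
    by (intro divide_right_mono mult_left_mono) auto
  moreover have "real (n div ?m) * (exp (- (2 * real T * J)) / 2) / 2 ^ ?m
     = real (n div ?m) * exp (- (2 * real T * J)) / 2 ^ (6 * a + 3)"
    by (simp add: power_add)
  moreover have "measure_pmf.prob (random_string_traces_pmf q n T) {(x, us). g us = x}
     \<le> exp (- (real (n div ?m) * overlap q T (str_x a) (str_y a) / 2 ^ ?m))"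
    by (rule success_prob_le[OF q' _ _ str_ne]) (simp_all add: bitstrings_def)
  ultimately show ?thesis
    by (elim order_trans) (simp only: exp_le_cancel_iff neg_le_iff_le)
qed

text \<open>With \<open>y = ln x\<close>, the number of blocks is at least \<open>x / y - 1\<close>,
  the overlap costs \<open>exp (- y / 10)\<close> and the block probability
  \<open>8 * exp (y / 3)\<close>, because \<open>2 ^ (6 * a) \<le> exp (6 * a)\<close> and
  \<open>a \<le> y / 18\<close>. So about \<open>x powr (17/30)\<close> survives, up to a logarithm,
  which exceeds \<open>x powr 0.15\<close>. The constant 1800 turns \<open>2 * 90 / 1800\<close>
  into \<open>1 / 10\<close>, where 90 bounds \<open>20 powr (3/2)\<close>.\<close>

lemma success_exponent_le:
  fixes C x T :: real and a n :: nat
  assumes C: "0 < C"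
    and a: "ln x / 20 \<le> real a" "real a \<le> ln x / 18" and x: "x = real n" "1 \<le> ln (ln x)" "6 \<le> ln x"
    and T: "0 \<le> T" "T \<le> 1 / (1800 * C) * ln x powr (5/2) / ln (ln x) ^ 7"
    and main: "x powr 0.15 \<le> (x / ln x - 1) * exp (- (ln x / 10)) / (8 * exp (ln x / 3))"
    and nonneg: "0 \<le> x / ln x - 1"
  shows "x powr 0.15 \<le> real (n div (6 * a + 2)) * exp (- (2 * T * (C * (ln (ln x) ^ 5 / (ln x / 20) powr (3/2))))) / 2 ^ (6 * a + 3)"
proof -
  define y where "y = ln x"
  define z where "z = ln y"
  have y: "6 \<le> y" and z: "1 \<le> z" using x by (auto simp: y_def z_def)
  have "T * (C * (z ^ 5 / (y / 20) powr (3/2)))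
    \<le> (1 / (1800 * C) * y powr (5/2) / z ^ 7) * (C * (z ^ 5 / (y / 20) powr (3/2)))"
    using T C y z by (intro mult_right_mono) (auto simp: y_def z_def)
  also have "\<dots> = (y powr (5/2) / (y / 20) powr (3/2)) / (1800 * z\<^sup>2)"
    using C z by (simp add: field_simps eval_nat_numeral)
  also have "y powr (5/2) / (y / 20) powr (3/2) = 20 powr (3/2) * y"
  proof -
    have "y powr (5/2) = y powr (3/2) * y" using y powr_add[of y "3/2" 1] by simp
    then show ?thesis using y by (simp add: powr_divide)
  qed
  also have "20 powr (3/2) * y / (1800 * z\<^sup>2) \<le> 90 * y / (1800 * 1)"
  proof (intro frac_le mult_mono mult_left_mono)
    have "(20 powr (3/2))\<^sup>2 = (20::real) powr 3" by (simp add: powr_powr flip: powr_realpow)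
    also have "\<dots> = 8000" by simp
    finally have "(20 powr (3/2))\<^sup>2 \<le> (90::real)\<^sup>2" by simp
    then show "20 powr (3/2) \<le> (90::real)" by (rule power2_le_imp_le) simp
    show "1 \<le> z\<^sup>2" using z by (simp add: one_le_power)
  qed (use y in auto)
  finally have "T * (C * (z ^ 5 / (y / 20) powr (3/2))) \<le> 90 * y / (1800 * 1)" .
  then have TJ: "2 * T * (C * (z ^ 5 / (y / 20) powr (3/2))) \<le> y / 10"
    unfolding mult.assoc[of 2 T] by linarith
  have pow: "(2::real) ^ (6 * a + 3) \<le> 8 * exp (y / 3)"
  proof -
    have "(2::real) ^ (6 * a) \<le> exp 1 ^ (6 * a)"
      using exp_ge_add_one_self[of 1] by (intro power_mono) auto
    also have "\<dots> = exp (6 * real a)" by (simp flip: exp_of_nat_mult)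
    also have "\<dots> \<le> exp (y / 3)" using a by (simp add: y_def)
    finally show ?thesis by (simp add: power_add)
  qed
  have div: "x / y - 1 \<le> real (n div (6 * a + 2))"
  proof -
    have "real (6 * a + 2) \<le> y" using a y by (simp add: y_def)
    then have "x / y \<le> real n / real (6 * a + 2)" using x y by (intro frac_le) auto
    also have "\<dots> \<le> real (n div (6 * a + 2)) + 1"
    proof -
      have "n < n div (6 * a + 2) * (6 * a + 2) + (6 * a + 2)" 
        using dividend_less_div_times[of "6 * a + 2" n] by (simp add: add.commute del: mult_Suc_right)
      then have "real n \<le> (real (n div (6 * a + 2)) + 1) * real (6 * a + 2)"
        by (simp only: distrib_right mult_1 of_nat_mult[symmetric] of_nat_add[symmetric] of_nat_le_iff less_imp_le)
      then show ?thesis by (subst pos_divide_le_eq) auto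
    qed
    finally show ?thesis by simp
  qed
  have "(x / y - 1) * exp (- (y / 10)) / (8 * exp (y / 3)) \<le>
    real (n div (6 * a + 2)) * exp (- (2 * T * (C * (z ^ 5 / (y / 20) powr (3/2))))) / 2 ^ (6 * a + 3)"
    using div TJ pow nonneg by (intro frac_le mult_mono) (auto simp: y_def)
  then show ?thesis using main unfolding y_def z_def by linarith
qed

theorem theorem2:
  fixes q :: real
  assumes "0 < q" and "q < 1"
  shows "\<exists>c::real. c > 0 \<and>
    (\<forall>\<^sub>F n::nat in sequentially.
      \<forall>g \<in> tuples (num_traces c n) (bitstrings_upto n) \<rightarrow> bitstrings n.
        measure_pmf.prob (random_string_traces_pmf q n (num_traces c n)) {(x, us). g us = x}
          \<le> exp (- (real n powr 0.15)))"
proof -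
  obtain C where C: "C > 0" "\<forall>\<^sub>F a in sequentially.
      trace_chi q (str_x a) (str_y a) \<le> C * (ln (real a) ^ 5 / real a powr (3/2))"
    using trace_chi_str_asymptotic[OF assms] by blast
  define c where "c = 1 / (1800 * C)"
  define block where "block = (\<lambda>n::nat. nat \<lfloor>ln (real n) / 18\<rfloor>)"
  have "filterlim (\<lambda>n::nat. ln (real n) / 18) at_top sequentially" by real_asymp
  then have "filterlim block at_top sequentially"
    unfolding block_def
    by (intro filterlim_compose[OF filterlim_nat_sequentially] filterlim_compose[OF filterlim_floor_sequentially])
  then have "\<forall>\<^sub>F n in sequentially. trace_chi q (str_x (block n)) (str_y (block n))
      \<le> C * (ln (real (block n)) ^ 5 / real (block n) powr (3/2))"
    by (rule eventually_compose_filterlim[OF C(2)])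
  \<comment> \<open>Rounding down costs less than 1, so the block parameter lies between
    \<open>ln n / 20\<close> and \<open>ln n / 18\<close>.\<close>
  moreover have "\<forall>\<^sub>F n::nat in sequentially. ln (real n) / 20 \<le> ln (real n) / 18 - 1"
    "\<forall>\<^sub>F n::nat in sequentially. 1 \<le> ln (ln (real n))"
    "\<forall>\<^sub>F n::nat in sequentially. 40 \<le> ln (real n)"
    "\<forall>\<^sub>F n::nat in sequentially. 0 \<le> real n / ln (real n) - 1"
    "\<forall>\<^sub>F n::nat in sequentially. real n powr 0.15 \<le>
       (real n / ln (real n) - 1) * exp (- (ln (real n) / 10)) / (8 * exp (ln (real n) / 3))"
    by real_asymp+
  \<comment> \<open>The smallness of the chi distance that \<open>overlap_ge\<close>
    requires.\<close>
  moreover have "\<forall>\<^sub>F n::nat in sequentially. C * (ln (ln (real n)) ^ 5 / (ln (real n) / 20) powr (3/2)) \<le> 1"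
    using C(1) by real_asymp
  ultimately have "\<forall>\<^sub>F n::nat in sequentially.
      \<forall>g \<in> tuples (num_traces c n) (bitstrings_upto n) \<rightarrow> bitstrings n.
        measure_pmf.prob (random_string_traces_pmf q n (num_traces c n)) {(x, us). g us = x}
          \<le> exp (- (real n powr 0.15))"
  proof eventually_elim
    case (elim n)
    define y where "y = ln (real n)"
    define J where "J = C * (ln y ^ 5 / (y / 20) powr (3/2))"
    define a where "a = block n"
    define T where "T = num_traces c n"
    have y: "40 \<le> y" using elim by (simp add: y_def)
    have a: "real a = of_int \<lfloor>y / 18\<rfloor>"
      unfolding a_def block_def y_def[symmetric] using y by (intro of_nat_nat) simp
    then have a2: "y / 20 \<le> real a" "real a \<le> y / 18" using elim(2) unfolding y_def[symmetric] by linarith+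
    have "ln (real a) \<le> ln y" "0 \<le> ln (real a)" using a2 y by (auto simp: ln_ge_zero)
    then have "ln (real a) ^ 5 / real a powr (3/2) \<le> ln y ^ 5 / (y / 20) powr (3/2)"
      using a2 y by (intro frac_le power_mono powr_mono2) auto
    then have "C * (ln (real a) ^ 5 / real a powr (3/2)) \<le> J"
      unfolding J_def using C(1) by (intro mult_left_mono) auto
    then have J: "trace_chi q (str_x a) (str_y a) \<le> J" "J \<le> 1"
      using elim unfolding a_def J_def y_def by linarith+
    have T: "real T \<le> 1 / (1800 * C) * y powr (5/2) / ln y ^ 7"
    proof -
      have nn: "0 \<le> c * y powr (5/2) / ln y ^ 7" using C(1) elim(3) by (simp add: c_def y_def)
      then have "real T = of_int \<lfloor>c * y powr (5/2) / ln y ^ 7\<rfloor>"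
        unfolding T_def num_traces_def y_def[symmetric] by (intro of_nat_nat) simp
      then show ?thesis unfolding c_def by linarith
    qed
    have "real n powr 0.15 \<le> real (n div (6 * a + 2)) * exp (- (2 * real T * J)) / 2 ^ (6 * a + 3)"
      unfolding J_def y_def
      by (rule success_exponent_le[OF C(1)]) (use a2 T elim in \<open>auto simp: y_def\<close>)
    then have "exp (- (real (n div (6 * a + 2)) * exp (- (2 * real T * J)) / 2 ^ (6 * a + 3)))
      \<le> exp (- (real n powr 0.15))" by simp
    then show ?case
      unfolding T_def[symmetric] using success_prob_str_le[OF assms J, of n T] by (meson order_trans)
  qed
  moreover have "c > 0" using C(1) by (simp add: c_def)
  ultimately show ?thesis by blast
qed

end
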